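(* Let $G$ be a simple graph on $[n]$, let $S=\mathbb{K}[x_1,\dots,x_n,y_1,\dots,y_n]$, and let $H$ be an induced subgraph of $G$. Then for all $i,j>0$ and $m\ge 1$, $$\beta_{i,j}(S/J_H^{(m)})\le\beta_{i,j}(S/J_G^{(m)}).$$ In particular, $\mathrm{reg}(J_H^{(m)})\le\mathrm{reg}(J_G^{(m)})$ for every $m\ge 1$, and $\widehat{\mathrm{reg}}(J_H)\le\widehat{\mathrm{reg}}(J_G)$.
   Context: $\mathbb{K}$ is a field. For a simple graph $H$ with vertices in $[n]=\{1,\dots,n\}$, the binomial edge ideal is $J_H=(x_iy_j-x_jy_i\mid\{i,j\}\in E(H))$, here regarded as an ideal of $S$; it is radical. Symbolic powers: for a prime $P$ of a ring $R$, $P^{(m)}=\{r\in R\mid rq\in P^m\text{ for some }q\notin P\}$; for a radical ideal $I$ with minimal primes $P_1,\dots,P_s$, $I^{(m)}=\bigcap_k P_k^{(m)}$. $\beta_{i,j}(M)=\dim_{\mathbb{K}}\mathrm{Tor}_i^S(M,\mathbb{K})_j$ is the $(i,j)$-th graded Betti number of a graded $S$-module $M$ (standard grading). $\mathrm{reg}$ is Castelnuovo–Mumford regularity, and the asymptotic regularity is $\widehat{\mathrm{reg}}(I)=\lim_{m\to\infty}\mathrm{reg}(I^{(m)})/m$, provided that this limit exists. *)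

theory Defs
  imports
    "HOL-Library.Poly_Mapping"
    "HOL-Library.Extended_Real"
    "HOL-Algebra.Ideal_Product"
    "HOL-Algebra.Algebraic_Closure_Type"
    "Graph_Theory.Graph_Theory"
begin

section \<open>The polynomial ring\<close>

text \<open>
  The vertex set \<open>[n]\<close> is a finite type \<open>'v\<close>, so that \<open>n = CARD('v)\<close>, and
  \<open>S = K[x_1, \<dots>, x_n, y_1, \<dots>, y_n]\<close> is the monoid algebra over the field \<open>'k\<close> of the monoid
  of exponent vectors of \<open>x_v = Xvar v\<close>, \<open>y_v = Yvar v\<close>.
\<close>

datatype 'v pvar = Xvar 'v | Yvar 'v

type_synonym ('v, 'k) mpoly = "('v pvar \<Rightarrow>\<^sub>0 nat) \<Rightarrow>\<^sub>0 'k"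

definition Var :: "'v pvar \<Rightarrow> ('v, 'k::field) mpoly" where
  "Var z = Poly_Mapping.single (Poly_Mapping.single z 1) 1"

definition Const :: "'k \<Rightarrow> ('v, 'k::field) mpoly" where
  "Const c = Poly_Mapping.single 0 c"

definition mon_deg :: "('v pvar \<Rightarrow>\<^sub>0 nat) \<Rightarrow> nat" where
  "mon_deg t = (\<Sum>z\<in>Poly_Mapping.keys t. Poly_Mapping.lookup t z)"

definition homogeneous :: "nat \<Rightarrow> ('v, 'k::field) mpoly \<Rightarrow> bool" where
  "homogeneous j p \<longleftrightarrow> (\<forall>t\<in>Poly_Mapping.keys p. mon_deg t = j)"

abbreviation mpoly_ring :: "('v, 'k::field) mpoly ring" where
  "mpoly_ring \<equiv> ring_of_type_algebra"


section \<open>Binomial edge ideals and symbolic powers\<close>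

text \<open>
  A simple graph is a \<^locale>\<open>pair_graph\<close>: an edge \<open>{u, v}\<close> is the pair of arcs \<open>(u, v)\<close>, \<open>(v, u)\<close>.
  The two arcs yield the same generator up to sign.
\<close>

definition binomial_edge_ideal :: "'v pair_pre_digraph \<Rightarrow> ('v, 'k::field) mpoly set" where
  "binomial_edge_ideal H =
     Idl\<^bsub>mpoly_ring\<^esub> {Var (Xvar u) * Var (Yvar v) - Var (Xvar v) * Var (Yvar u) | u v. (u, v) \<in> parcs H}"

definition minimal_primes :: "('a, 'b) ring_scheme \<Rightarrow> 'a set \<Rightarrow> 'a set set" where
  "minimal_primes R I =
     {P. primeideal P R \<and> I \<subseteq> P \<and> (\<forall>Q. primeideal Q R \<and> I \<subseteq> Q \<and> Q \<subseteq> P \<longrightarrow> Q = P)}"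

definition prime_symbolic_power :: "('a, 'b) ring_scheme \<Rightarrow> 'a set \<Rightarrow> nat \<Rightarrow> 'a set" where
  "prime_symbolic_power R P m =
     {r \<in> carrier R. \<exists>q \<in> carrier R - P. r \<otimes>\<^bsub>R\<^esub> q \<in> P [^]\<^bsub>ideals_set R\<^esub> m}"

text \<open>Intended for radical ideals \<open>I\<close>.\<close>

definition symbolic_power :: "('a, 'b) ring_scheme \<Rightarrow> 'a set \<Rightarrow> nat \<Rightarrow> 'a set" where
  "symbolic_power R I m = carrier R \<inter> (\<Inter>P\<in>minimal_primes R I. prime_symbolic_power R P m)"


section \<open>Graded free modules\<close>

text \<open>
  All free modules are submodules of the free \<open>S\<close>-module on \<open>nat\<close>: a set \<open>B\<close> of indices stands for
  the submodule with basis \<open>B\<close>. Countable rank suffices for what follows, because the modules to be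
  resolved are subquotients of \<open>S\<close>, whose graded pieces are finite-dimensional.
\<close>

type_synonym ('v, 'k) fvec = "nat \<Rightarrow>\<^sub>0 ('v, 'k) mpoly"

definition fscale :: "('v, 'k::field) mpoly \<Rightarrow> ('v, 'k) fvec \<Rightarrow> ('v, 'k) fvec" where
  "fscale a w = Poly_Mapping.map ((*) a) w"

definition kscale :: "'k \<Rightarrow> ('v, 'k::field) fvec \<Rightarrow> ('v, 'k) fvec" where
  "kscale c w = fscale (Const c) w"

definition free_on :: "nat set \<Rightarrow> ('v, 'k::field) fvec set" where
  "free_on B = {w. Poly_Mapping.keys w \<subseteq> B}"

text \<open>Here the basis element \<open>b\<close> has degree \<open>s b\<close>.\<close>

definition fhomogeneous :: "(nat \<Rightarrow> nat) \<Rightarrow> nat \<Rightarrow> ('v, 'k::field) fvec \<Rightarrow> bool" where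
  "fhomogeneous s j w \<longleftrightarrow>
     (\<forall>b\<in>Poly_Mapping.keys w. \<forall>t\<in>Poly_Mapping.keys (Poly_Mapping.lookup w b). mon_deg t + s b = j)"

definition basis_vec :: "nat \<Rightarrow> ('v, 'k::field) fvec" where
  "basis_vec b = Poly_Mapping.single b 1"

text \<open>
  The submodule \<open>\<mm>F\<close> of \<open>F = free_on B\<close>, where \<open>\<mm>\<close> is the ideal generated by the variables, i.e.
  the set of polynomials without constant term. Thus \<open>F \<otimes> K = F/\<mm>F\<close>.
\<close>

definition max_times :: "nat set \<Rightarrow> ('v, 'k::field) fvec set" where
  "max_times B = {w \<in> free_on B. \<forall>b. Poly_Mapping.lookup (Poly_Mapping.lookup w b) 0 = 0}"

lemma lookup_fscale: "Poly_Mapping.lookup (fscale a w) b = a * Poly_Mapping.lookup w b"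
  by (simp add: fscale_def Poly_Mapping.map.rep_eq when_def)

interpretation fmod: Modules.module "fscale :: ('v, 'k::field) mpoly \<Rightarrow> _"
  by unfold_locales (auto intro!: poly_mapping_eqI simp: lookup_fscale lookup_add algebra_simps)

lemma Const_simps: "Const (a + b) = Const a + Const b" "Const (a * b) = Const a * Const b" "Const 1 = 1"
  by (simp_all add: Const_def single_add mult_single)

interpretation kmod: vector_space "kscale :: 'k::field \<Rightarrow> ('v, 'k) fvec \<Rightarrow> _"
  by unfold_locales (auto simp: kscale_def Const_simps algebra_simps)


section \<open>Tor, Betti numbers and regularity\<close>

text \<open>
  A graded \<open>S\<close>-module \<open>M\<close> is given as a subquotient \<open>M = U/V\<close> of \<open>S\<close> by homogeneous ideals
  \<open>V \<subseteq> U\<close>; so \<open>S/I\<close> is \<open>(UNIV, I)\<close> and the module \<open>I\<close> is \<open>(I, {0})\<close>.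

  A free resolution \<open>\<dots> \<rightarrow> F_1 \<rightarrow> F_0 \<rightarrow> M \<rightarrow> 0\<close> has \<open>F_i = free_on (gens F i)\<close>, with basis degrees
  \<open>shift F i\<close>, \<open>bdry F i : F_(i+1) \<rightarrow> F_i\<close>, and \<open>aug F\<close> a lift to \<open>S\<close> of the augmentation \<open>F_0 \<rightarrow> M\<close>.
  Maps are linear on the whole free module on \<open>nat\<close>, which is no restriction, as a map on \<open>F_i\<close>
  extends.
\<close>

record (overloaded) ('v, 'k) free_complex =
  gens :: "nat \<Rightarrow> nat set"
  shift :: "nat \<Rightarrow> nat \<Rightarrow> nat"
  aug :: "('v, 'k) fvec \<Rightarrow> ('v, 'k) mpoly"
  bdry :: "nat \<Rightarrow> ('v, 'k) fvec \<Rightarrow> ('v, 'k) fvec"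

definition graded_free_resolution ::
  "('v, 'k::field) mpoly set \<Rightarrow> ('v, 'k) mpoly set \<Rightarrow> ('v, 'k) free_complex \<Rightarrow> bool" where
  "graded_free_resolution U V F \<longleftrightarrow>
     module_hom fscale (*) (aug F) \<and>
     (\<forall>i. module_hom fscale fscale (bdry F i)) \<and>
     (\<forall>b\<in>gens F 0. homogeneous (shift F 0 b) (aug F (basis_vec b))) \<and>
     (\<forall>i. \<forall>b\<in>gens F (Suc i). fhomogeneous (shift F i) (shift F (Suc i) b) (bdry F i (basis_vec b))) \<and>
     {aug F w + v | w v. w \<in> free_on (gens F 0) \<and> v \<in> V} = U \<and>
     bdry F 0 ` free_on (gens F 1) = {w \<in> free_on (gens F 0). aug F w \<in> V} \<and>
     (\<forall>i. bdry F (Suc i) ` free_on (gens F (Suc (Suc i))) =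
          {w \<in> free_on (gens F (Suc i)). bdry F i w = 0})"

text \<open>
  Degree \<open>j\<close> cycles and boundaries of the complex \<open>F \<otimes> K = F/\<mm>F\<close>, as subspaces of \<open>F_i\<close>
  (that is, the preimages under \<open>F_i \<rightarrow> F_i/\<mm>F_i\<close>). Their quotient is \<open>Tor_i(M, K)_j\<close>.
\<close>

definition tor_cycles :: "('v, 'k::field) free_complex \<Rightarrow> nat \<Rightarrow> nat \<Rightarrow> ('v, 'k) fvec set" where
  "tor_cycles F i j = {w \<in> free_on (gens F i). fhomogeneous (shift F i) j w \<and>
     (case i of 0 \<Rightarrow> True | Suc l \<Rightarrow> bdry F l w \<in> max_times (gens F l))}"

definition tor_boundaries :: "('v, 'k::field) free_complex \<Rightarrow> nat \<Rightarrow> nat \<Rightarrow> ('v, 'k) fvec set" where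
  "tor_boundaries F i j = {w \<in> free_on (gens F i). fhomogeneous (shift F i) j w \<and>
     (\<exists>u\<in>free_on (gens F (Suc i)). w - bdry F i u \<in> max_times (gens F i))}"

text \<open>
  The dimension of \<open>Z/W\<close> for subspaces \<open>W \<subseteq> Z\<close>: the size of a set of representatives in \<open>Z\<close> of a
  basis of \<open>Z/W\<close> (and 0 if \<open>Z/W\<close> is infinite-dimensional).
\<close>

definition (in vector_space) quotient_dim :: "'b set \<Rightarrow> 'b set \<Rightarrow> nat" where
  "quotient_dim Z W =
     card (SOME C. independent C \<and> span C \<inter> W = {0} \<and> span (C \<union> W) = Z)"

text \<open>
  \<open>Tor\<close> does not depend on the resolution; we choose one. The Betti numbers of the finitely generated
  modules considered here are finite.
\<close>

definition betti :: "('v, 'k::field) mpoly set \<Rightarrow> ('v, 'k) mpoly set \<Rightarrow> nat \<Rightarrow> nat \<Rightarrow> nat" where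
  "betti U V i j =
     (let F = (SOME F. graded_free_resolution U V F)
      in kmod.quotient_dim (tor_cycles F i j) (tor_boundaries F i j))"

text \<open>The regularity is \<open>-\<infinity>\<close> for the zero module.\<close>

definition regularity :: "('v, 'k::field) mpoly set \<Rightarrow> ('v, 'k) mpoly set \<Rightarrow> ereal" where
  "regularity U V = Sup {ereal (real j - real i) | i j. betti U V i j \<noteq> 0}"

definition betti_quot :: "('v, 'k::field) mpoly set \<Rightarrow> nat \<Rightarrow> nat \<Rightarrow> nat" where
  "betti_quot I = betti UNIV I"

definition reg_ideal :: "('v, 'k::field) mpoly set \<Rightarrow> ereal" where
  "reg_ideal I = regularity I {0}"

definition reg_quotients :: "('v, 'k::field) mpoly set \<Rightarrow> nat \<Rightarrow> ereal" where
  "reg_quotients I m = reg_ideal (symbolic_power mpoly_ring I m) / ereal (real m)"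

definition asymptotic_reg :: "('v, 'k::field) mpoly set \<Rightarrow> ereal" where
  "asymptotic_reg I = lim (reg_quotients I)"

end

theory Submission
  imports Defs
begin

text \<open>
  Let \<open>W\<close> be the vertex set of \<open>H\<close>, and let \<open>\<rho>\<close> be the endomorphism of \<open>S\<close> that kills the variables of
  the other vertices. It suffices to know that \<open>J_H\<^sup>(\<^sup>m\<^sup>) \<subseteq> J_G\<^sup>(\<^sup>m\<^sup>)\<close>, that
  \<open>\<rho>(J_G\<^sup>(\<^sup>m\<^sup>)) \<subseteq> J_H\<^sup>(\<^sup>m\<^sup>)\<close>, and that \<open>J_H\<^sup>(\<^sup>m\<^sup>)\<close> is homogeneous and extended from \<open>K[x_v, y_v | v \<in> W]\<close>:
  then \<open>S/J_H\<^sup>(\<^sup>m\<^sup>)\<close> has a resolution with matrices over this subring, the inclusion induces a map to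
  \<open>Tor(S/J_G\<^sup>(\<^sup>m\<^sup>), K)\<close>, and \<open>\<rho>\<close> induces a left inverse, because the \<open>\<rho>\<close>-semilinear composite is
  homotopic to the application of \<open>\<rho>\<close> to coordinates, which is the identity modulo the variables.
  The same argument applies to the ideals themselves.

  The containments amount to \<open>Q\<^sup>(\<^sup>m\<^sup>) \<subseteq> P\<^sup>(\<^sup>m\<^sup>)\<close> for primes \<open>Q \<subseteq> P\<close> with \<open>P\<close> minimal over a binomial edge
  ideal. A minimal prime is the preimage of an ideal generated by variables under an explicit
  endomorphism \<open>\<Theta>\<close> of \<open>S\<close>, and \<open>f \<in> P\<^sup>(\<^sup>m\<^sup>)\<close> iff \<open>\<Theta> f\<close> has order at least \<open>m\<close> in these variables. All Taylor
  coefficients of order less than \<open>m\<close> of an element of \<open>Q\<^sup>(\<^sup>m\<^sup>)\<close> lie in \<open>Q \<subseteq> P\<close>, so expanding \<open>\<Theta> f\<close>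
  gives the claim over every field.
\<close>

section \<open>Polynomials\<close>

text \<open>The Betti numbers refer to a resolution picked by \<open>SOME\<close>, which may have
  infinite rank in a degree, and \<open>quotient_dim\<close> is 0 on an infinite quotient. So an
  inequality of dimensions is worthless without finiteness: it is transported from a resolution
  finite in every degree to the picked ones, by the same retract argument with no variable killed.

  The subring of the variables of \<open>W\<close> never becomes a ring of its own. Its elements are
  the polynomials fixed by \<rho>, and the way back from G to H is a \<rho>-semilinear map of
  S-modules.

  Taylor coefficients bound symbolic powers from one side only: over an imperfect field a polynomial
  can have all its low order coefficients in a prime P without lying in the symbolic power, for
  example x^p - t over a field of characteristic p in which t has no p-th root. The other inclusion
  comes from the charts, where P is generated by variables once a product g of root coordinates is
  inverted. There are finitely many charts, which also yields minimal primes without chain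
  conditions.\<close>

abbreviation "lookup \<equiv> Poly_Mapping.lookup"
abbreviation "keys \<equiv> Poly_Mapping.keys"
abbreviation "single \<equiv> Poly_Mapping.single"

instance pvar :: (finite) finite
proof
  have "(UNIV :: 'a pvar set) \<subseteq> range Xvar \<union> range Yvar"
    by (metis UNIV_I Un_iff pvar.exhaust rangeI subsetI)
  then show "finite (UNIV :: 'a pvar set)"
    by (rule finite_subset) simp
qed

section \<open>Ring homomorphisms and evaluation of polynomials\<close>

locale rhom =
  fixes h :: "'a::comm_ring_1 \<Rightarrow> 'b::comm_ring_1"
  assumes one: "h 1 = 1" and add: "h (a + b) = h a + h b" and mult: "h (a * b) = h a * h b"
begin

lemma zero: "h 0 = 0"
  using add[of 0 0] by simp

lemma uminus: "h (- a) = - h a"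
  using add[of a "- a"] by (simp add: zero eq_neg_iff_add_eq_0 add.commute)

lemma diff: "h (a - b) = h a - h b"
  using add[of a "- b"] by (simp add: uminus)

lemma sum: "h (sum f A) = (\<Sum>x\<in>A. h (f x))"
  by (induction A rule: infinite_finite_induct) (simp_all add: zero add)

lemma prod: "h (prod f A) = (\<Prod>x\<in>A. h (f x))"
  by (induction A rule: infinite_finite_induct) (simp_all add: one mult)

lemma power: "h (a ^ n) = h a ^ n"
  by (induction n) (simp_all add: one mult)

end

lemma rhom_comp: "rhom g \<Longrightarrow> rhom h \<Longrightarrow> rhom (\<lambda>a. g (h a))"
  by (simp add: rhom_def)

lemma rhom_id: "rhom (\<lambda>a. a)"
  by (simp add: rhom_def)

lemma poly_mapping_sum_monomials:
  fixes f :: "'a \<Rightarrow>\<^sub>0 'b::comm_monoid_add"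
  shows "(\<Sum>t\<in>keys f. single t (lookup f t)) = f"
  by (rule poly_mapping_eqI) (simp add: lookup_sum lookup_single when_def in_keys_iff)

lemma poly_mapping_add_induct [case_names single add]:
  fixes f :: "'a \<Rightarrow>\<^sub>0 'b::comm_monoid_add"
  assumes single: "\<And>t c. P (single t c)" and add: "\<And>f g. P f \<Longrightarrow> P g \<Longrightarrow> P (f + g)"
  shows "P f"
proof -
  have "P (\<Sum>t\<in>A. single t (lookup f t))" if "finite A" for A
    using that
  proof induction
    case empty
    show ?case using single[of undefined 0] by simp
  qed (simp add: single add)
  from this[OF finite_keys[of f]] show ?thesis
    by (simp add: poly_mapping_sum_monomials)
qed

lemma lookup_mult_keys:
  fixes f g :: "'a::comm_monoid_add \<Rightarrow>\<^sub>0 'b::comm_semiring_0"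
  shows "lookup (f * g) k =
    (\<Sum>s\<in>keys f. \<Sum>t\<in>keys g. if s + t = k then lookup f s * lookup g t else 0)"
proof -
  have "f * g = (\<Sum>s\<in>keys f. single s (lookup f s)) * (\<Sum>t\<in>keys g. single t (lookup g t))"
    by (simp add: poly_mapping_sum_monomials)
  also have "\<dots> = (\<Sum>s\<in>keys f. \<Sum>t\<in>keys g. single (s + t) (lookup f s * lookup g t))"
    by (simp add: sum_product mult_single)
  finally show ?thesis
    by (simp add: lookup_sum lookup_single when_def)
qed

text \<open>The coefficients form an arbitrary ring because Taylor expansions and
  \<open>coeffs_in\<close> are polynomials whose coefficients are again polynomials.\<close>

type_synonym ('x, 'a) mp = "('x \<Rightarrow>\<^sub>0 nat) \<Rightarrow>\<^sub>0 'a"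

definition cst :: "'a::comm_ring_1 \<Rightarrow> ('x, 'a) mp" where
  "cst c = single 0 c"

definition vr :: "'x \<Rightarrow> ('x, 'a::comm_ring_1) mp" where
  "vr z = single (single z 1) 1"

lemma Const_eq: "Const c = cst c"
  by (simp add: Const_def cst_def)

lemma Var_eq: "Var z = vr z"
  by (simp add: Var_def vr_def)

lemma rhom_cst: "rhom cst"
  by unfold_locales (simp_all add: cst_def single_add mult_single)

definition mon_val :: "('x::finite \<Rightarrow> 'b::comm_ring_1) \<Rightarrow> ('x \<Rightarrow>\<^sub>0 nat) \<Rightarrow> 'b" where
  "mon_val \<phi> t = (\<Prod>z\<in>UNIV. \<phi> z ^ lookup t z)"

lemma mon_val_0 [simp]: "mon_val \<phi> 0 = 1"
  by (simp add: mon_val_def)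

lemma mon_val_add: "mon_val \<phi> (s + t) = mon_val \<phi> s * mon_val \<phi> t"
  by (simp add: mon_val_def lookup_add power_add prod.distrib)

lemma mon_val_single: "mon_val \<phi> (single z n) = \<phi> z ^ n"
proof -
  have "mon_val \<phi> (single z n) = (\<Prod>y\<in>UNIV. if y = z then \<phi> z ^ n else 1)"
    unfolding mon_val_def by (intro prod.cong) (auto simp: lookup_single when_def)
  then show ?thesis by simp
qed

definition subst :: "('a::comm_ring_1 \<Rightarrow> 'b) \<Rightarrow> ('x::finite \<Rightarrow> 'b::comm_ring_1) \<Rightarrow> ('x, 'a) mp \<Rightarrow> 'b"
  where "subst \<kappa> \<phi> f = (\<Sum>t\<in>keys f. \<kappa> (lookup f t) * mon_val \<phi> t)"

context
  fixes \<kappa> :: "'a::comm_ring_1 \<Rightarrow> 'b::comm_ring_1"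
  assumes rhom: "rhom \<kappa>"
begin

interpretation \<kappa>: rhom \<kappa> by (rule rhom)

lemma subst_superset:
  assumes "finite A" "keys f \<subseteq> A"
  shows "subst \<kappa> \<phi> f = (\<Sum>t\<in>A. \<kappa> (lookup f t) * mon_val \<phi> t)"
  unfolding subst_def
  by (rule sum.mono_neutral_left) (use assms in \<open>auto simp: \<kappa>.zero in_keys_iff\<close>)

lemma subst_add: "subst \<kappa> \<phi> (f + g) = subst \<kappa> \<phi> f + subst \<kappa> \<phi> g"
proof -
  let ?A = "keys f \<union> keys g"
  have "keys (f + g) \<subseteq> ?A" by (rule keys_add)
  then show ?thesis
    by (simp add: subst_superset[of ?A] lookup_add \<kappa>.add distrib_right sum.distrib)
qed

lemma subst_single: "subst \<kappa> \<phi> (single t c) = \<kappa> c * mon_val \<phi> t"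
  by (simp add: subst_superset[of "{t}"])

lemma subst_mult: "subst \<kappa> \<phi> (f * g) = subst \<kappa> \<phi> f * subst \<kappa> \<phi> g"
proof (induction f rule: poly_mapping_add_induct)
  case (single s c)
  show ?case
  proof (induction g rule: poly_mapping_add_induct)
    case (single t d)
    show ?case
      by (simp add: mult_single subst_single \<kappa>.mult mon_val_add)
  next
    case (add f g)
    then show ?case by (simp add: distrib_left subst_add)
  qed
next
  case (add f g)
  then show ?case by (simp add: distrib_right subst_add)
qed

lemma rhom_subst: "rhom (subst \<kappa> \<phi>)"
  by unfold_locales
    (simp_all add: subst_add subst_mult subst_single \<kappa>.one flip: single_one)

lemma subst_cst: "subst \<kappa> \<phi> (cst c) = \<kappa> c"
  by (simp add: cst_def subst_single)

lemma subst_vr: "subst \<kappa> \<phi> (vr z) = \<phi> z"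
  by (simp add: vr_def subst_single mon_val_single \<kappa>.one)

end

lemma mon_val_vr: "mon_val vr t = (single t 1 :: ('x::finite, 'a::comm_ring_1) mp)"
proof -
  have p: "(single (single z 1) 1 :: ('x, 'a) mp) ^ n = single (single z n) 1" for z n
  proof (induction n)
    case (Suc n)
    have "single z (Suc 0) + single z n = single z (Suc n)"
      by (simp flip: single_add)
    with Suc show ?case by (simp add: mult_single)
  qed simp
  have "mon_val vr t = (\<Prod>z\<in>UNIV. single (single z (lookup t z)) (1 :: 'a))"
    by (simp only: mon_val_def vr_def p)
  also have "\<dots> = single (\<Sum>z\<in>UNIV. single z (lookup t z)) (1 :: 'a)"
  proof -
    have "(\<Prod>z\<in>A. single (single z (lookup t z)) 1) =
        single (\<Sum>z\<in>A. single z (lookup t z)) (1 :: 'a)" if "finite A" for A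
      using that by induction (simp_all add: mult_single)
    then show ?thesis by simp
  qed
  also have "(\<Sum>z\<in>UNIV. single z (lookup t z)) = t"
    by (rule poly_mapping_eqI) (simp add: lookup_sum lookup_single when_def)
  finally show ?thesis .
qed

lemma single_eq: "single t c = cst c * mon_val vr t"
  by (simp add: mon_val_vr cst_def mult_single)

lemma mp_induct [case_names cst vr add mult]:
  fixes f :: "('x::finite, 'a::comm_ring_1) mp"
  assumes cst: "\<And>c. P (cst c)" and vr: "\<And>z. P (vr z)"
    and add: "\<And>f g. P f \<Longrightarrow> P g \<Longrightarrow> P (f + g)" and mult: "\<And>f g. P f \<Longrightarrow> P g \<Longrightarrow> P (f * g)"
  shows "P f"
proof (induction f rule: poly_mapping_add_induct)
  case (single t c)
  have 1: "P 1" using cst[of 1] by (simp add: cst_def)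
  have pow: "P (vr z ^ n)" for z n
    by (induction n) (simp_all add: 1 vr mult)
  have "P (\<Prod>z\<in>A. vr z ^ lookup t z)" if "finite A" for A
    using that by induction (simp_all add: 1 pow mult)
  then show ?case
    unfolding single_eq mon_val_def by (intro mult cst) simp
qed (rule add)

lemma rhom_eqI:
  fixes g h :: "('x::finite, 'a::comm_ring_1) mp \<Rightarrow> 'b::comm_ring_1"
  assumes "rhom g" "rhom h" "\<And>c. g (cst c) = h (cst c)" "\<And>z. g (vr z) = h (vr z)"
  shows "g f = h f"
proof -
  interpret g: rhom g by fact
  interpret h: rhom h by fact
  show ?thesis
    by (induction f rule: mp_induct) (simp_all add: assms g.add h.add g.mult h.mult)
qed

text \<open>Serves on two levels: on a polynomial it selects terms, such as a graded part; on an
  exponent vector it selects the part of the monomial in the variables of \<open>A\<close>.\<close>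

definition restr :: "'a set \<Rightarrow> ('a \<Rightarrow>\<^sub>0 'b) \<Rightarrow> 'a \<Rightarrow>\<^sub>0 'b::comm_monoid_add" where
  "restr A f = (\<Sum>t\<in>keys f \<inter> A. single t (lookup f t))"

lemma lookup_restr: "lookup (restr A f) t = (if t \<in> A then lookup f t else 0)"
proof -
  have "lookup (restr A f) t = (\<Sum>s\<in>keys f \<inter> A. if s = t then lookup f t else 0)"
    unfolding restr_def lookup_sum by (intro sum.cong) (auto simp: lookup_single when_def)
  also have "\<dots> = (if t \<in> A then lookup f t else 0)"
    by (simp add: in_keys_iff)
  finally show ?thesis .
qed

lemma keys_restr: "keys (restr A f) = keys f \<inter> A"
  by (auto simp: in_keys_iff lookup_restr split: if_splits)

lemma restr_add: "restr A (f + g) = restr A f + restr A g"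
  by (rule poly_mapping_eqI) (simp add: lookup_restr lookup_add)

lemma restr_single: "restr A (single t c) = (if t \<in> A then single t c else 0)"
  by (rule poly_mapping_eqI) (simp add: lookup_restr lookup_single when_def)

lemma restr_id: "keys f \<subseteq> A \<Longrightarrow> restr A f = f"
  by (rule poly_mapping_eqI) (auto simp: lookup_restr in_keys_iff)

lemma restr_empty: "keys f \<inter> A = {} \<Longrightarrow> restr A f = 0"
  by (rule poly_mapping_eqI) (auto simp: lookup_restr in_keys_iff)

subsection \<open>Weights\<close>

definition wt :: "('x::finite \<Rightarrow> nat) \<Rightarrow> ('x \<Rightarrow>\<^sub>0 nat) \<Rightarrow> nat" where
  "wt w t = (\<Sum>z\<in>UNIV. w z * lookup t z)"

lemma wt_0 [simp]: "wt w 0 = 0"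
  by (simp add: wt_def)

lemma wt_add: "wt w (s + t) = wt w s + wt w t"
  by (simp add: wt_def lookup_add distrib_left sum.distrib)

lemma wt_single: "wt w (single z n) = w z * n"
proof -
  have "wt w (single z n) = (\<Sum>y\<in>UNIV. if y = z then w z * n else 0)"
    unfolding wt_def by (intro sum.cong) (auto simp: lookup_single when_def)
  then show ?thesis by simp
qed

lemma mon_deg_eq_wt: "mon_deg t = wt (\<lambda>_. 1) (t :: 'v::finite pvar \<Rightarrow>\<^sub>0 nat)"
  unfolding mon_deg_def wt_def by (rule sum.mono_neutral_cong_left) (auto simp: in_keys_iff)

definition Hom :: "('x::finite \<Rightarrow> nat) \<Rightarrow> nat \<Rightarrow> ('x, 'a::comm_ring_1) mp set" where
  "Hom w d = {f. \<forall>t\<in>keys f. wt w t = d}"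

text \<open>For weights 0 and 1 this is the \<open>m\<close>-th power of the ideal generated by the
  variables of weight 1, phrased so that membership depends only on the support.\<close>

definition Filt :: "('x::finite \<Rightarrow> nat) \<Rightarrow> nat \<Rightarrow> ('x, 'a::comm_ring_1) mp set" where
  "Filt w m = {f. \<forall>t\<in>keys f. m \<le> wt w t}"

lemma Hom_add: "f \<in> Hom w d \<Longrightarrow> g \<in> Hom w d \<Longrightarrow> f + g \<in> Hom w d"
  using keys_add[of f g] unfolding Hom_def by blast

lemma Hom_mult: "f \<in> Hom w d \<Longrightarrow> g \<in> Hom w e \<Longrightarrow> f * g \<in> Hom w (d + e)"
  using keys_mult[of f g] unfolding Hom_def by (fastforce simp: wt_add)

lemma Hom_1: "1 \<in> Hom w 0"
  by (simp add: Hom_def)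

lemma Hom_mon_val:
  assumes "\<And>z. \<phi> z \<in> Hom w (v z)"
  shows "mon_val \<phi> t \<in> Hom w (wt v t)"
proof -
  have pow: "\<phi> z ^ n \<in> Hom w (v z * n)" for z n
    by (induction n) (use Hom_mult[OF assms] in \<open>simp_all add: Hom_1\<close>)
  have "(\<Prod>z\<in>A. \<phi> z ^ lookup t z) \<in> Hom w (\<Sum>z\<in>A. v z * lookup t z)" if "finite A" for A
    using that by induction (simp_all add: Hom_1 Hom_mult[OF pow])
  then show ?thesis by (simp add: mon_val_def wt_def)
qed

text \<open>Sending constants to weight 0 and each variable to a homogeneous element of its own
  weight makes the substitution a graded homomorphism.\<close>

lemma subst_restr:
  fixes \<kappa> :: "'a::comm_ring_1 \<Rightarrow> ('x::finite, 'b::comm_ring_1) mp"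
  assumes "rhom \<kappa>" "\<And>c. \<kappa> c \<in> Hom w 0" "\<And>z. \<phi> z \<in> Hom w (v z)"
  shows "subst \<kappa> \<phi> (restr {t. wt v t = d} f) = restr {t. wt w t = d} (subst \<kappa> \<phi> f)"
proof (induction f rule: poly_mapping_add_induct)
  case (single t c)
  have "subst \<kappa> \<phi> (single t c) \<in> Hom w (wt v t)"
    using Hom_mult[OF assms(2) Hom_mon_val[OF assms(3)]] by (simp add: subst_single[OF assms(1)])
  then have "keys (subst \<kappa> \<phi> (single t c)) \<subseteq> {s. wt w s = wt v t}"
    by (auto simp: Hom_def)
  then show ?case
    using rhom.zero[OF rhom_subst[OF assms(1)]]
    by (cases "wt v t = d") (simp_all add: restr_single restr_id restr_empty disjoint_iff subset_iff)
qed (simp add: restr_add subst_add[OF assms(1)])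

lemma Filt_0: "f \<in> Filt w 0"
  by (simp add: Filt_def)

lemma zero_in_Filt: "0 \<in> Filt w m"
  by (simp add: Filt_def)

lemma Filt_add: "f \<in> Filt w d \<Longrightarrow> g \<in> Filt w d \<Longrightarrow> f + g \<in> Filt w d"
  using keys_add[of f g] unfolding Filt_def by blast

lemma Filt_sum: "(\<And>i. i \<in> A \<Longrightarrow> f i \<in> Filt w d) \<Longrightarrow> sum f A \<in> Filt w d"
  by (induction A rule: infinite_finite_induct) (simp_all add: zero_in_Filt Filt_add)

lemma Filt_mult: "f \<in> Filt w d \<Longrightarrow> g \<in> Filt w e \<Longrightarrow> f * g \<in> Filt w (d + e)"
  using keys_mult[of f g] unfolding Filt_def by (fastforce simp: wt_add intro: add_mono)

lemma Filt_mult_right: "f \<in> Filt w d \<Longrightarrow> g * f \<in> Filt w d"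
  using Filt_mult[OF Filt_0, of f w d g] by simp

lemma Filt_mon_val:
  assumes "\<And>z. \<phi> z \<in> Filt w (v z)"
  shows "mon_val \<phi> t \<in> Filt w (wt v t)"
proof -
  have pow: "\<phi> z ^ n \<in> Filt w (v z * n)" for z n
    by (induction n) (use Filt_mult[OF assms] in \<open>simp_all add: Filt_0\<close>)
  have "(\<Prod>z\<in>A. \<phi> z ^ lookup t z) \<in> Filt w (\<Sum>z\<in>A. v z * lookup t z)" if "finite A" for A
    using that by induction (simp_all add: Filt_0 Filt_mult[OF pow])
  then show ?thesis by (simp add: mon_val_def wt_def)
qed

lemma Filt_restr: "f \<in> Filt w m \<Longrightarrow> restr A f \<in> Filt w m"
  by (simp add: Filt_def keys_restr)

text \<open>
  The exponent vectors carry no order of class \<^class>\<open>linorder\<close>, so they are embedded into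
  \<^typ>\<open>nat \<Rightarrow>\<^sub>0 nat\<close>; the weight goes to the leading place of the lexicographic order.
\<close>

lemma ex_weighted_order:
  fixes w :: "'x::finite \<Rightarrow> nat"
  obtains \<iota> :: "('x \<Rightarrow>\<^sub>0 nat) \<Rightarrow> (nat \<Rightarrow>\<^sub>0 nat)" where "inj \<iota>" "\<And>s t. \<iota> (s + t) = \<iota> s + \<iota> t"
    "\<And>s t. wt w s < wt w t \<Longrightarrow> \<iota> s < \<iota> t"
proof -
  obtain e :: "'x \<Rightarrow> nat" where e: "inj e"
    using finite_imp_inj_to_nat_seg[of "UNIV :: 'x set"] by auto
  define \<iota> where "\<iota> t = single 0 (wt w t) + (\<Sum>z\<in>UNIV. single (Suc (e z)) (lookup t z))" for t
  have l0: "lookup (\<iota> t) 0 = wt w t" for t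
    by (simp add: \<iota>_def lookup_add lookup_sum lookup_single)
  have lS: "lookup (\<iota> t) (Suc (e y)) = lookup t y" for t y
  proof -
    have "lookup (\<iota> t) (Suc (e y)) = (\<Sum>z\<in>UNIV. if z = y then lookup t y else 0)"
      using inj_eq[OF e]
      by (auto simp: \<iota>_def lookup_add lookup_sum lookup_single when_def intro!: sum.cong)
    then show ?thesis by simp
  qed
  show ?thesis
  proof
    show "inj \<iota>"
      by (rule injI) (metis lS poly_mapping_eqI)
    show "\<iota> (s + t) = \<iota> s + \<iota> t" for s t
      by (simp add: \<iota>_def wt_add lookup_add single_add sum.distrib algebra_simps)
    show "\<iota> s < \<iota> t" if "wt w s < wt w t" for s t
      using that by (auto simp: less_poly_mapping.rep_eq less_fun_def l0 intro!: exI[of _ 0])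
  qed
qed

text \<open>Leading terms: the smallest exponents of \<open>f\<close> and \<open>q\<close> in the
  weighted order add up to an exponent that no other pair produces, so it survives in the product.
  The one of \<open>q\<close> has weight 0, hence the one of \<open>f\<close> must have weight at
  least \<open>m\<close>. In other words, \<open>Filt w m\<close> is primary to the prime
  \<open>Filt w 1\<close>.\<close>

lemma Filt_mult_cancel:
  fixes f q :: "('x::finite, 'a::idom) mp"
  assumes fq: "f * q \<in> Filt w m" and q: "q \<notin> Filt w 1"
  shows "f \<in> Filt w m"
proof (rule ccontr)
  assume "f \<notin> Filt w m"
  then obtain s0 where s0: "s0 \<in> keys f" "wt w s0 < m"
    by (auto simp: Filt_def)
  from q obtain t0 where t0: "t0 \<in> keys q" "wt w t0 = 0"
    by (auto simp: Filt_def)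
  obtain \<iota> :: "('x \<Rightarrow>\<^sub>0 nat) \<Rightarrow> (nat \<Rightarrow>\<^sub>0 nat)" where \<iota>: "inj \<iota>"
    "\<And>s t. \<iota> (s + t) = \<iota> s + \<iota> t" "\<And>s t. wt w s < wt w t \<Longrightarrow> \<iota> s < \<iota> t"
    by (rule ex_weighted_order[of w]) (rule that)
  have "\<exists>s\<in>keys h. \<forall>t\<in>keys h. \<iota> s \<le> \<iota> t" if "t \<in> keys h" for h :: "('x, 'a) mp" and t
  proof -
    have *: "finite (\<iota> ` keys h)" "\<iota> ` keys h \<noteq> {}" using that by auto
    from Min_in[OF *] Min_le[OF *(1)] show ?thesis
      by (metis (no_types, lifting) image_iff)
  qed
  then obtain s t where s: "s \<in> keys f" "\<And>s'. s' \<in> keys f \<Longrightarrow> \<iota> s \<le> \<iota> s'"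
    and t: "t \<in> keys q" "\<And>t'. t' \<in> keys q \<Longrightarrow> \<iota> t \<le> \<iota> t'"
    using s0 t0 by metis
  have uniq: "s' = s \<and> t' = t" if "s' \<in> keys f" "t' \<in> keys q" "s' + t' = s + t" for s' t'
  proof -
    have "\<iota> s' + \<iota> t' = \<iota> s + \<iota> t"
      using that \<iota>(2) by metis
    with s(2)[OF that(1)] t(2)[OF that(2)] have "\<iota> s' = \<iota> s" "\<iota> t' = \<iota> t"
      by (metis add_le_cancel_left add_le_cancel_right antisym)+
    with \<iota>(1) show ?thesis by (simp add: inj_eq)
  qed
  have "lookup (f * q) (s + t) =
      (\<Sum>s'\<in>keys f. \<Sum>t'\<in>keys q. if s' = s then if t' = t then lookup f s * lookup q t else 0 else 0)"
    unfolding lookup_mult_keys by (intro sum.cong refl) (use uniq in auto)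
  also have "\<dots> = (\<Sum>s'\<in>keys f. if s' = s then lookup f s * lookup q t else 0)"
    using t(1) by (intro sum.cong refl) simp
  also have "\<dots> = lookup f s * lookup q t"
    using s(1) by simp
  finally have "s + t \<in> keys (f * q)"
    using s(1) t(1) by (simp add: in_keys_iff)
  with fq have "m \<le> wt w s + wt w t"
    by (auto simp: Filt_def wt_add)
  moreover have "wt w s \<le> wt w s0" "wt w t \<le> wt w t0"
    using s(2)[OF s0(1)] t(2)[OF t0(1)] \<iota>(3) by (meson leD leI)+
  ultimately show False
    using s0(2) t0(2) by simp
qed

subsection \<open>Killing variables and extracting coefficients\<close>

definition rho :: "'x::finite set \<Rightarrow> ('x, 'a::comm_ring_1) mp \<Rightarrow> ('x, 'a) mp" where
  "rho Z = subst cst (\<lambda>z. if z \<in> Z then 0 else vr z)"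

text \<open>
  \<open>coeffs_in Z f\<close> is \<open>f\<close> regarded as a polynomial in the variables of \<open>Z\<close>, so that its value at the
  exponent vector \<open>s\<close> is the coefficient of the monomial \<open>s\<close>, a polynomial in the other variables.
\<close>

definition coeffs_in :: "'x::finite set \<Rightarrow> ('x, 'a::comm_ring_1) mp \<Rightarrow> ('x, ('x, 'a) mp) mp" where
  "coeffs_in Z = subst (\<lambda>c. cst (cst c)) (\<lambda>z. if z \<in> Z then vr z else cst (vr z))"

lemma rhom_cst2: "rhom (\<lambda>c. cst (cst c))"
  by (rule rhom_comp[OF rhom_cst rhom_cst])

lemma rhom_rho: "rhom (rho Z)"
  unfolding rho_def by (rule rhom_subst[OF rhom_cst])

lemma rhom_coeffs: "rhom (coeffs_in Z)"
  unfolding coeffs_in_def by (rule rhom_subst[OF rhom_cst2])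

lemma rho_cst: "rho Z (cst c) = cst c"
  by (simp add: rho_def subst_cst[OF rhom_cst])

lemma rho_vr: "rho Z (vr z) = (if z \<in> Z then 0 else vr z)"
  by (simp add: rho_def subst_vr[OF rhom_cst])

lemma restr_split: "restr Z t + restr (- Z) t = t"
  by (rule poly_mapping_eqI) (simp add: lookup_restr lookup_add)

lemma mon_val_cong: "(\<And>z. z \<in> keys t \<Longrightarrow> \<phi> z = \<psi> z) \<Longrightarrow> mon_val \<phi> t = mon_val \<psi> t"
  unfolding mon_val_def by (intro prod.cong refl) (metis in_keys_iff power_0)

lemma rho_single: "rho Z (single t c) = (if restr Z t = 0 then single t c else 0)"
proof (cases "restr Z t = 0")
  case True
  then have "keys t \<inter> Z = {}" by (metis keys_restr keys_zero)
  then have "mon_val (\<lambda>z. if z \<in> Z then 0 else vr z) t = (mon_val vr t :: ('a, 'b) mp)"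
    by (intro mon_val_cong) auto
  then have "rho Z (single t c) = cst c * mon_val vr t"
    by (simp add: rho_def subst_single[OF rhom_cst])
  with True show ?thesis by (simp flip: single_eq)
next
  case False
  then obtain z where "z \<in> keys t" "z \<in> Z"
    by (metis IntE all_not_in_conv keys_eq_empty keys_restr)
  then have "mon_val (\<lambda>z. if z \<in> Z then 0 else vr z) t = (0 :: ('a, 'b) mp)"
    unfolding mon_val_def by (intro prod_zero) (auto simp: in_keys_iff zero_power intro!: exI[of _ z])
  with False show ?thesis
    by (simp add: rho_def subst_single[OF rhom_cst])
qed

lemma lookup_rho: "lookup (rho Z f) t = (if restr Z t = 0 then lookup f t else 0)"
proof (induction f rule: poly_mapping_add_induct)
  case (single s c)
  show ?case by (simp add: rho_single lookup_single when_def)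
qed (simp add: rhom.add[OF rhom_rho] lookup_add)

lemma keys_rho: "keys (rho Z f) = keys f \<inter> {t. restr Z t = 0}"
  by (auto simp: in_keys_iff lookup_rho split: if_splits)

lemma rho_fixed_iff: "rho Z f = f \<longleftrightarrow> (\<forall>t\<in>keys f. restr Z t = 0)"
  by (auto simp: poly_mapping_eq_iff[of "rho Z f"] fun_eq_iff lookup_rho in_keys_iff)

lemma rho_rho: "rho Z (rho Z f) = rho Z f"
  by (simp add: rho_fixed_iff keys_rho)

lemma rho_empty: "rho {} f = f"
  by (simp add: rho_fixed_iff restr_def)

lemma coeffs_single: "coeffs_in Z (single t c) = single (restr Z t) (single (restr (- Z) t) c)"
proof -
  let ?\<phi> = "\<lambda>z. if z \<in> Z then vr z else cst (vr z :: ('a, 'b) mp)"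
  have "mon_val ?\<phi> (restr Z t) = mon_val vr (restr Z t)"
    by (rule mon_val_cong) (simp add: keys_restr)
  moreover have "mon_val ?\<phi> (restr (- Z) t) = mon_val (\<lambda>z. cst (vr z)) (restr (- Z) t)"
    by (rule mon_val_cong) (simp add: keys_restr)
  moreover have "\<dots> = cst (mon_val vr (restr (- Z) t))"
    by (simp add: mon_val_def rhom.prod[OF rhom_cst] rhom.power[OF rhom_cst])
  ultimately have "mon_val ?\<phi> t = mon_val vr (restr Z t) * cst (mon_val vr (restr (- Z) t))"
    using mon_val_add[of ?\<phi> "restr Z t" "restr (- Z) t"] by (simp add: restr_split)
  then show ?thesis
    by (simp add: coeffs_in_def subst_single[OF rhom_cst2] mon_val_vr) (simp add: cst_def mult_single)
qed

lemma lookup_coeffs_add: "lookup (coeffs_in Z (f + g)) s = lookup (coeffs_in Z f) s + lookup (coeffs_in Z g) s"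
  by (simp add: rhom.add[OF rhom_coeffs] lookup_add)

lemma lookup_cst_mult: "lookup (cst a * u) s = a * lookup u s"
proof (induction u rule: poly_mapping_add_induct)
  case (single t c)
  show ?case by (simp add: cst_def mult_single lookup_single when_def)
qed (simp add: distrib_left lookup_add)

lemma coeffs_rho_fixed:
  assumes "rho Z c = c"
  shows "coeffs_in Z c = cst c"
proof -
  have "coeffs_in Z (single t x) = cst (single t x)" if "restr Z t = 0" for t x
    using that restr_split[of Z t] by (simp add: coeffs_single cst_def)
  moreover have "c = (\<Sum>t\<in>keys c. single t (lookup c t))"
    by (simp add: poly_mapping_sum_monomials)
  moreover have "\<forall>t\<in>keys c. restr Z t = 0"
    using assms by (simp add: rho_fixed_iff)
  ultimately show ?thesis
    by (metis (mono_tags, lifting) rhom.sum[OF rhom_coeffs] rhom.sum[OF rhom_cst] sum.cong)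
qed

text \<open>Polynomials fixed by \<open>rho Z\<close> are constants from the viewpoint of
  \<open>coeffs_in Z\<close>, so extracting a coefficient is linear over the subring they
  form.\<close>

lemma lookup_coeffs_mult:
  assumes "rho Z c = c"
  shows "lookup (coeffs_in Z (a * c)) s = lookup (coeffs_in Z a) s * c"
  by (simp add: rhom.mult[OF rhom_coeffs] coeffs_rho_fixed[OF assms] mult.commute[of _ "cst c"]
      lookup_cst_mult mult.commute)

lemma rho_lookup_coeffs: "rho Z (lookup (coeffs_in Z f) s) = lookup (coeffs_in Z f) s"
proof (induction f rule: poly_mapping_add_induct)
  case (single t c)
  have "restr Z (restr (- Z) t) = 0"
    by (rule restr_empty) (simp add: keys_restr)
  then show ?case
    by (simp add: coeffs_single lookup_single when_def rho_single rhom.zero[OF rhom_rho])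
qed (simp add: lookup_coeffs_add rhom.add[OF rhom_rho])

text \<open>Evaluating the outer variables at the original ones undoes \<open>coeffs_in\<close>.
  This is what later turns closure under coefficients into generation by elements of the
  subring.\<close>

lemma sum_coeffs:
  assumes "finite A" "keys (coeffs_in Z f) \<subseteq> A"
  shows "(\<Sum>s\<in>A. single s 1 * lookup (coeffs_in Z f) s) = f"
proof -
  let ?h = "subst (\<lambda>a. a) vr"
  have "(\<Sum>s\<in>A. single s 1 * lookup (coeffs_in Z f) s) = ?h (coeffs_in Z f)"
    by (simp add: subst_superset[OF rhom_id assms] mon_val_vr mult.commute)
  also have "\<dots> = f"
  proof (induction f rule: poly_mapping_add_induct)
    case (single t c)
    show ?case
      by (simp add: coeffs_single subst_single[OF rhom_id] mon_val_vr mult_single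
          add.commute[of "restr (- Z) t"] restr_split)
  qed (simp add: rhom.add[OF rhom_coeffs] subst_add[OF rhom_id])
  finally show ?thesis .
qed

lemma Filt_lookup_coeffs:
  assumes f: "f \<in> Filt w m" and w: "\<And>z. z \<in> Z \<Longrightarrow> w z = 0"
  shows "lookup (coeffs_in Z f) s \<in> Filt w m"
proof -
  have wt: "wt w (restr (- Z) t) = wt w t" for t
    unfolding wt_def by (rule sum.cong) (auto simp: lookup_restr w)
  have "lookup (coeffs_in Z f) s =
      lookup (coeffs_in Z (\<Sum>t\<in>keys f. single t (lookup f t))) s"
    by (simp add: poly_mapping_sum_monomials)
  also have "\<dots> = (\<Sum>t\<in>keys f. lookup (coeffs_in Z (single t (lookup f t))) s)"
    by (simp add: rhom.sum[OF rhom_coeffs] lookup_sum)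
  also have "\<dots> \<in> Filt w m"
    using f by (intro Filt_sum)
      (auto simp: coeffs_single lookup_single when_def zero_in_Filt Filt_def wt)
  finally show ?thesis .
qed

text \<open>Such a substitution is extended from the subring of the variables outside
  \<open>Z\<close> by adjoining the variables of \<open>Z\<close>, so it acts on the coefficients
  one by one.\<close>

lemma subst_lookup_coeffs:
  assumes out: "\<And>z. z \<in> Z \<Longrightarrow> \<phi> z = vr z" and inn: "\<And>z. z \<notin> Z \<Longrightarrow> rho Z (\<phi> z) = \<phi> z"
  shows "lookup (coeffs_in Z (subst cst \<phi> f)) s = subst cst \<phi> (lookup (coeffs_in Z f) s)"
proof (induction f rule: poly_mapping_add_induct)
  case (single t c)
  have o: "mon_val \<phi> (restr Z t) = single (restr Z t) 1"
    unfolding mon_val_vr[symmetric] by (rule mon_val_cong) (simp add: keys_restr out)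
  have "rho Z (mon_val \<phi> (restr (- Z) t)) = mon_val (\<lambda>z. rho Z (\<phi> z)) (restr (- Z) t)"
    by (simp add: mon_val_def rhom.prod[OF rhom_rho] rhom.power[OF rhom_rho])
  also have "\<dots> = mon_val \<phi> (restr (- Z) t)"
    by (rule mon_val_cong) (simp add: keys_restr inn)
  finally have i: "rho Z (cst c * mon_val \<phi> (restr (- Z) t)) = cst c * mon_val \<phi> (restr (- Z) t)"
    by (simp add: rhom.mult[OF rhom_rho] rho_cst)
  have "mon_val \<phi> t = single (restr Z t) 1 * mon_val \<phi> (restr (- Z) t)"
    using mon_val_add[of \<phi> "restr Z t" "restr (- Z) t"] by (simp add: restr_split o)
  then have "subst cst \<phi> (single t c) = single (restr Z t) 1 * (cst c * mon_val \<phi> (restr (- Z) t))"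
    by (simp add: subst_single[OF rhom_cst] mult_ac)
  moreover have "restr (- Z) (restr Z t) = 0" "restr Z (restr Z t) = restr Z t"
    by (auto intro!: restr_empty restr_id simp: keys_restr)
  ultimately have "lookup (coeffs_in Z (subst cst \<phi> (single t c))) s =
      (if restr Z t = s then cst c * mon_val \<phi> (restr (- Z) t) else 0)"
    by (simp add: lookup_coeffs_mult[OF i] coeffs_single lookup_single when_def)
  then show ?case
    by (simp add: coeffs_single lookup_single when_def subst_single[OF rhom_cst]
        rhom.zero[OF rhom_subst[OF rhom_cst]])
next
  case (add f g)
  then show ?case
    by (simp add: subst_add[OF rhom_cst] lookup_coeffs_add)
qed

lemma restr_eq_0_iff_wt: "restr {z. w z \<noteq> 0} t = 0 \<longleftrightarrow> wt w t = 0"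
  by (auto simp: poly_mapping_eq_iff fun_eq_iff lookup_restr wt_def) (metis less_numeral_extra(3))

lemma rho_eq_0_iff: "rho {z. w z \<noteq> 0} f = 0 \<longleftrightarrow> f \<in> Filt w 1"
proof -
  have "rho {z. w z \<noteq> 0} f = 0 \<longleftrightarrow> keys (rho {z. w z \<noteq> 0} f) = {}"
    by (rule keys_eq_empty[symmetric])
  also have "\<dots> \<longleftrightarrow> keys f \<inter> {t. wt w t = 0} = {}"
    by (simp only: keys_rho restr_eq_0_iff_wt)
  finally have "rho {z. w z \<noteq> 0} f = 0 \<longleftrightarrow> keys f \<inter> {t. wt w t = 0} = {}" .
  then show ?thesis by (auto simp: Filt_def Suc_le_eq)
qed

lemma diff_rho_in_Filt: "f - rho {z. w z \<noteq> 0} f \<in> Filt w 1"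
  unfolding rho_eq_0_iff[symmetric] by (simp add: rhom.diff[OF rhom_rho] rho_rho)

section \<open>Symbolic powers of primes\<close>

text \<open>The ring notions are restated for rings that are types; \<open>ideal_iff\<close>,
  \<open>primeideal_iff\<close> and \<open>symbolic_power_binomial_edge_ideal\<close> link them to
  the notions of the statement.\<close>

definition is_ideal :: "'a::comm_ring_1 set \<Rightarrow> bool" where
  "is_ideal I \<longleftrightarrow> 0 \<in> I \<and> (\<forall>a\<in>I. \<forall>b\<in>I. a + b \<in> I) \<and> (\<forall>a. \<forall>b\<in>I. a * b \<in> I)"

definition is_prime :: "'a::comm_ring_1 set \<Rightarrow> bool" where
  "is_prime P \<longleftrightarrow> is_ideal P \<and> 1 \<notin> P \<and> (\<forall>a b. a * b \<in> P \<longrightarrow> a \<in> P \<or> b \<in> P)"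

lemma is_ideal_sum: "is_ideal I \<Longrightarrow> (\<And>x. x \<in> A \<Longrightarrow> f x \<in> I) \<Longrightarrow> sum f A \<in> I"
  by (induction A rule: infinite_finite_induct) (auto simp: is_ideal_def)

lemma is_ideal_uminus: "is_ideal I \<Longrightarrow> a \<in> I \<Longrightarrow> - a \<in> I"
  unfolding is_ideal_def by (metis mult_minus1)

lemma is_ideal_diff: "is_ideal I \<Longrightarrow> a \<in> I \<Longrightarrow> b \<in> I \<Longrightarrow> a - b \<in> I"
  using is_ideal_uminus[of I b] unfolding is_ideal_def by (metis diff_conv_add_uminus)

text \<open>The base case and the order of the factors copy the power in the monoid
  \<open>ideals_set\<close>, so that \<open>ideals_set_pow\<close> is a matter of unfolding.\<close>

fun ipow :: "'a::comm_ring_1 set \<Rightarrow> nat \<Rightarrow> 'a set" where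
  "ipow I 0 = UNIV"
| "ipow I (Suc m) = ideal_prod ring_of_type_algebra (ipow I m) I"

definition psp :: "'a::comm_ring_1 set \<Rightarrow> nat \<Rightarrow> 'a set" where
  "psp P m = {r. \<exists>q. q \<notin> P \<and> r * q \<in> ipow P m}"

lemma ipow_subset:
  assumes zero: "\<And>a. a \<in> F 0"
    and add: "\<And>m a b. a \<in> F m \<Longrightarrow> b \<in> F m \<Longrightarrow> a + b \<in> F m"
    and mult: "\<And>m a b. a \<in> F m \<Longrightarrow> b \<in> I \<Longrightarrow> a * b \<in> F (Suc m)"
  shows "ipow I m \<subseteq> F m"
proof (induction m)
  case (Suc m)
  have "a \<in> F (Suc m)" if "a \<in> ideal_prod ring_of_type_algebra (ipow I m) I" for a
    using that
  proof induction
    case (prod i j)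
    then show ?case using Suc mult[of i m j] by (auto simp: ring_of_type_algebra_def)
  next
    case (sum a b)
    then show ?case using add by (simp add: ring_of_type_algebra_def)
  qed
  then show ?case by auto
qed (use zero in auto)

lemma is_ideal_ipow:
  assumes "is_ideal I"
  shows "is_ideal (ipow I m)"
proof (cases m)
  case 0
  then show ?thesis by (simp add: is_ideal_def)
next
  case (Suc n)
  let ?J = "ideal_prod ring_of_type_algebra (ipow I n) I"
  have add: "a + b \<in> ?J" if "a \<in> ?J" "b \<in> ?J" for a b
    using ideal_prod.sum[OF that] by (simp add: ring_of_type_algebra_def)
  have m: "a * b \<in> ?J" if "a \<in> ipow I n" "b \<in> I" for a b
    using ideal_prod.prod[OF that, of ring_of_type_algebra] by (simp add: ring_of_type_algebra_def)
  \<comment> \<open>The inductive set \<open>ideal_prod\<close> is generated by products alone, so 0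
    gets into it only as a product of elements of the two factors.\<close>
  have "\<exists>x. x \<in> ipow I n"
  proof (induction n)
    case (Suc k)
    then obtain x where "x \<in> ipow I k" by auto
    with assms ideal_prod.prod[of x "ipow I k" 0 I ring_of_type_algebra] show ?case
      by (auto simp: is_ideal_def)
  qed auto
  then have "0 \<in> ?J" using m[of _ 0] assms by (auto simp: is_ideal_def)
  moreover have "c * a \<in> ?J" if "a \<in> ?J" for a c
    using that
  proof induction
    case (prod i j)
    then have "i * (c * j) \<in> ?J" using m assms by (simp add: is_ideal_def)
    then show ?case by (simp add: ring_of_type_algebra_def mult.left_commute)
  next
    case (sum a b)
    then show ?case using add by (simp add: ring_of_type_algebra_def distrib_left)
  qed
  ultimately show ?thesis
    using Suc add by (simp add: is_ideal_def)
qed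

lemma ipow_SucI: "a \<in> ipow I m \<Longrightarrow> b \<in> I \<Longrightarrow> a * b \<in> ipow I (Suc m)"
  using ideal_prod.prod[of a "ipow I m" b I ring_of_type_algebra] by (simp add: ring_of_type_algebra_def)

subsection \<open>Taylor expansion\<close>

text \<open>The value of \<open>f\<close> at x + h: the increments h are the outer variables, the
  base point x lives in the coefficients.\<close>

definition taylor :: "('x::finite, 'a::comm_ring_1) mp \<Rightarrow> ('x, ('x, 'a) mp) mp" where
  "taylor = subst (\<lambda>c. cst (cst c)) (\<lambda>z. cst (vr z) + vr z)"

lemma rhom_taylor: "rhom taylor"
  unfolding taylor_def by (rule rhom_subst[OF rhom_cst2])

lemma exponent_add_eq_0: "s + t = 0 \<longleftrightarrow> s = 0 \<and> t = (0 :: 'x \<Rightarrow>\<^sub>0 nat)"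
  by (auto simp: poly_mapping_eq_iff lookup_add fun_eq_iff)

lemma rhom_lookup_0: "rhom (\<lambda>u :: ('x, 'a::comm_ring_1) mp. lookup u 0)"
proof
  fix a b :: "('x, 'a) mp"
  show "lookup (a * b) 0 = lookup a 0 * lookup b 0"
  proof (induction a rule: poly_mapping_add_induct)
    case (single s c)
    show ?case
    proof (induction b rule: poly_mapping_add_induct)
      case (single t d)
      show ?case by (simp add: mult_single lookup_single when_def exponent_add_eq_0)
    qed (simp add: distrib_left lookup_add)
  qed (simp add: distrib_right lookup_add)
qed (simp_all add: lookup_add)

lemma lookup_taylor_0: "lookup (taylor f) 0 = f"
proof (rule rhom_eqI[OF rhom_comp[OF rhom_lookup_0 rhom_taylor] rhom_id])
  fix c show "lookup (taylor (cst c)) 0 = cst c"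
    by (simp add: taylor_def subst_cst[OF rhom_cst2]) (simp add: cst_def)
next
  fix z :: 'a
  have "single z (1 :: nat) \<noteq> 0"
    by (metis lookup_single_eq lookup_zero one_neq_zero)
  then show "lookup (taylor (vr z)) 0 = vr z"
    by (simp add: taylor_def subst_vr[OF rhom_cst2] lookup_add)
      (simp add: cst_def vr_def lookup_single when_def)
qed

abbreviation deg :: "('x::finite \<Rightarrow>\<^sub>0 nat) \<Rightarrow> nat" where
  "deg \<equiv> wt (\<lambda>_. 1)"

text \<open>
  The coefficients of \<open>taylor f\<close> are the Hasse derivatives of \<open>f\<close>, which, unlike iterated partial
  derivatives, detect orders of vanishing in every characteristic.
\<close>

definition diff_power :: "('x::finite, 'a::comm_ring_1) mp set \<Rightarrow> nat \<Rightarrow> ('x, ('x, 'a) mp) mp set" where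
  "diff_power I m = {u. \<forall>\<alpha>. deg \<alpha> < m \<longrightarrow> lookup u \<alpha> \<in> I}"

text \<open>If s + t = \<alpha> has order below m + n, then s has order below m or t has order below
  n, so every term of the convolution has a factor in \<open>I\<close>.\<close>

lemma diff_power_mult:
  assumes I: "is_ideal I" and u: "u \<in> diff_power I m" and v: "v \<in> diff_power I n"
  shows "u * v \<in> diff_power I (m + n)"
proof -
  have "lookup (u * v) \<alpha> \<in> I" if \<alpha>: "deg \<alpha> < m + n" for \<alpha>
    unfolding lookup_mult_keys
  proof (intro is_ideal_sum[OF I])
    fix s t
    show "(if s + t = \<alpha> then lookup u s * lookup v t else 0) \<in> I"
    proof (cases "s + t = \<alpha>")
      case True
      then have "deg s < m \<or> deg t < n" using \<alpha> by (auto simp: wt_add)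
      with u v I have "lookup u s * lookup v t \<in> I"
        unfolding diff_power_def is_ideal_def by (metis (mono_tags, lifting) mem_Collect_eq mult.commute)
      with True show ?thesis by simp
    qed (use I in \<open>simp add: is_ideal_def\<close>)
  qed
  then show ?thesis by (simp add: diff_power_def)
qed

text \<open>The coefficient of order 0 of an element of \<open>I\<close> is the element itself, so
  \<open>taylor\<close> maps \<open>I\<close> into \<open>diff_power I 1\<close>; powers follow by
  multiplicativity.\<close>

lemma taylor_ipow:
  assumes I: "is_ideal I" and f: "f \<in> ipow I m"
  shows "taylor f \<in> diff_power I m"
proof -
  have "ipow I m \<subseteq> {f. taylor f \<in> diff_power I m}"
  proof (rule ipow_subset)
    fix m a b assume "a \<in> {f. taylor f \<in> diff_power I m}" "b \<in> {f. taylor f \<in> diff_power I m}"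
    then show "a + b \<in> {f. taylor f \<in> diff_power I m}"
      using I by (simp add: rhom.add[OF rhom_taylor] diff_power_def lookup_add is_ideal_def)
  next
    fix m a b assume a: "a \<in> {f. taylor f \<in> diff_power I m}" and b: "b \<in> I"
    have zero: "\<alpha> = 0" if "deg \<alpha> = 0" for \<alpha> :: "'a \<Rightarrow>\<^sub>0 nat"
      using that by (simp add: wt_def poly_mapping_eq_iff fun_eq_iff)
    then have "taylor b \<in> diff_power I 1"
      using b by (auto simp: diff_power_def lookup_taylor_0 dest!: zero[simplified])
    with diff_power_mult[OF I, of _ m _ 1] a show "a * b \<in> {f. taylor f \<in> diff_power I (Suc m)}"
      by (simp add: rhom.mult[OF rhom_taylor])
  qed (simp add: diff_power_def)
  with f show ?thesis by auto
qed

text \<open>Induction on the order of \<alpha>: the coefficient of \<open>f * q\<close> at \<alpha>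
  is that of \<open>f\<close> times \<open>q\<close>, up to terms containing coefficients of
  \<open>f\<close> of lower order. The former and the latter lie in \<open>P\<close>, and
  \<open>q\<close> does not.\<close>

lemma taylor_psp:
  assumes P: "is_prime P" and f: "f \<in> psp P m"
  shows "taylor f \<in> diff_power P m"
proof -
  have I: "is_ideal P" using P by (simp add: is_prime_def)
  obtain q where q: "q \<notin> P" and fq: "f * q \<in> ipow P m"
    using f by (auto simp: psp_def)
  have fq': "taylor f * taylor q \<in> diff_power P m"
    using taylor_ipow[OF I fq] by (simp add: rhom.mult[OF rhom_taylor])
  have "lookup (taylor f) \<alpha> \<in> P" if "deg \<alpha> < m" for \<alpha>
    using that
  proof (induction "deg \<alpha>" arbitrary: \<alpha> rule: less_induct)
    case less
    let ?u = "taylor f" and ?v = "taylor q"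
    \<comment> \<open>Deleting the coefficient of \<open>f\<close> at \<alpha> isolates the term of
      interest; what remains involves only lower orders or the deleted coefficient 0.\<close>
    have split: "lookup (?u * ?v) \<alpha> =
        lookup ((?u - single \<alpha> (lookup ?u \<alpha>)) * ?v) \<alpha> + lookup (single \<alpha> (lookup ?u \<alpha>) * ?v) \<alpha>"
      by (simp add: algebra_simps lookup_add lookup_minus)
    have "lookup (single \<alpha> a * v) \<alpha> = a * lookup v 0" for a and v :: "('a, ('a, 'b) mp) mp"
    proof (induction v rule: poly_mapping_add_induct)
      case (single t c)
      show ?case by (simp add: mult_single lookup_single when_def)
    qed (simp add: distrib_left lookup_add)
    then have 2: "lookup (single \<alpha> (lookup ?u \<alpha>) * ?v) \<alpha> = lookup ?u \<alpha> * q"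
      by (simp add: lookup_taylor_0)
    have 1: "lookup ((?u - single \<alpha> (lookup ?u \<alpha>)) * ?v) \<alpha> \<in> P"
      unfolding lookup_mult_keys
    proof (intro is_ideal_sum[OF I])
      fix s t
      show "(if s + t = \<alpha> then lookup (?u - single \<alpha> (lookup ?u \<alpha>)) s * lookup ?v t else 0) \<in> P"
      proof (cases "s + t = \<alpha>")
        case True
        have "lookup (?u - single \<alpha> (lookup ?u \<alpha>)) s \<in> P"
        proof (cases "s = \<alpha>")
          case False
          then have "t \<noteq> 0" using True by auto
          then have "deg t \<noteq> 0" by (auto simp: wt_def poly_mapping_eq_iff fun_eq_iff)
          then have "deg s < deg \<alpha>" using True by (auto simp: wt_add)
          then have "lookup ?u s \<in> P" using less by simp
          with False show ?thesis by (simp add: lookup_minus lookup_single_not_eq)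
        qed (use I in \<open>simp add: lookup_minus is_ideal_def\<close>)
        then show ?thesis
          using I True by (simp add: is_ideal_def mult.commute)
      qed (use I in \<open>simp add: is_ideal_def\<close>)
    qed
    have "lookup (?u * ?v) \<alpha> \<in> P"
      using fq' less.prems by (simp add: diff_power_def)
    then have "lookup ?u \<alpha> * q \<in> P"
      using is_ideal_diff[OF I _ 1] split 2 by (metis add_diff_cancel_left')
    with P q show ?case by (auto simp: is_prime_def)
  qed
  then show ?thesis by (simp add: diff_power_def)
qed

text \<open>
  A form of the Zariski-Nagata theorem. Composed with the Taylor expansion, the homomorphism sending
  the increment of \<open>z\<close> to the part of \<open>\<Phi> z\<close> of positive weight gives back \<open>\<Phi>\<close>, so only Taylor
  coefficients of order at least \<open>m\<close> contribute.
\<close>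

lemma psp_in_Filt:
  fixes \<Phi> :: "('x::finite, 'a::comm_ring_1) mp \<Rightarrow> ('x, 'a) mp"
  assumes P: "is_prime P" and f: "f \<in> psp P m"
    and \<Phi>: "rhom \<Phi>" "\<And>c. \<Phi> (cst c) = cst c" and sub: "\<Phi> ` P \<subseteq> Filt w 1"
  shows "\<Phi> f \<in> Filt w m"
proof -
  define \<pi> where "\<pi> a = rho {z. w z \<noteq> 0} (\<Phi> a)" for a
  define \<delta> where "\<delta> z = \<Phi> (vr z) - \<pi> (vr z)" for z
  have \<pi>: "rhom \<pi>"
    unfolding \<pi>_def by (rule rhom_comp[OF rhom_rho \<Phi>(1)])
  interpret ev: rhom "subst \<pi> \<delta>" by (rule rhom_subst[OF \<pi>])
  have "\<Phi> f = subst \<pi> \<delta> (taylor f)"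
  proof (rule rhom_eqI[OF \<Phi>(1) rhom_comp[OF rhom_subst[OF \<pi>] rhom_taylor]])
    fix c show "\<Phi> (cst c) = subst \<pi> \<delta> (taylor (cst c))"
      by (simp add: taylor_def subst_cst[OF rhom_cst2] subst_cst[OF \<pi>])
        (simp add: \<pi>_def \<Phi>(2) rho_cst)
  next
    fix z show "\<Phi> (vr z) = subst \<pi> \<delta> (taylor (vr z))"
      by (simp add: taylor_def subst_vr[OF rhom_cst2] ev.add subst_cst[OF \<pi>] subst_vr[OF \<pi>] \<delta>_def)
  qed
  also have "\<dots> \<in> Filt w m"
    unfolding subst_def
  proof (rule Filt_sum)
    fix \<alpha>
    have \<delta>: "\<delta> z \<in> Filt w 1" for z
      unfolding \<delta>_def \<pi>_def by (rule diff_rho_in_Filt)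
    show "\<pi> (lookup (taylor f) \<alpha>) * mon_val \<delta> \<alpha> \<in> Filt w m"
    proof (cases "deg \<alpha> < m")
      case True
      then have "lookup (taylor f) \<alpha> \<in> P"
        using taylor_psp[OF P f] by (simp add: diff_power_def)
      with sub have "\<pi> (lookup (taylor f) \<alpha>) = 0"
        unfolding \<pi>_def rho_eq_0_iff by auto
      then show ?thesis by (simp add: zero_in_Filt)
    next
      case False
      then have "mon_val \<delta> \<alpha> \<in> Filt w m"
        using Filt_mon_val[of \<delta> w "\<lambda>_. 1" \<alpha>, OF \<delta>] by (auto simp: Filt_def)
      then show ?thesis by (rule Filt_mult_right)
    qed
  qed
  finally show ?thesis .
qed

section \<open>Minimal primes of binomial edge ideals\<close>

text \<open>Weights being at most 1, the weight of \<open>t\<close> is the number of factors, with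
  multiplicity, that are sent into \<open>P\<close>; they are split off one at a time.\<close>

lemma mon_val_ipow:
  assumes P: "is_ideal P" and \<phi>: "\<And>z. w z \<noteq> 0 \<Longrightarrow> \<phi> z \<in> P" and w: "\<And>z. w z \<le> Suc 0"
    and "m \<le> wt w t"
  shows "mon_val \<phi> t \<in> ipow P m"
  using assms(4)
proof (induction m arbitrary: t)
  case (Suc m)
  then have "wt w t \<noteq> 0" by simp
  then obtain z where z: "w z \<noteq> 0" "lookup t z \<noteq> 0"
    unfolding wt_def by (metis (no_types, lifting) mult_eq_0_iff sum.neutral)
  define t' where "t' = t - single z 1"
  have t: "t = t' + single z 1"
    unfolding t'_def using z
    by (intro poly_mapping_eqI) (auto simp: lookup_add lookup_minus lookup_single when_def)
  have "w z = 1" using w[of z] z(1) by simp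
  then have "m \<le> wt w t'"
    using Suc.prems by (simp add: t wt_add wt_single)
  then have "mon_val \<phi> t' * \<phi> z \<in> ipow P (Suc m)"
    by (intro ipow_SucI Suc.IH \<phi> z(1))
  then show ?case
    by (simp add: t mon_val_add mon_val_single)
qed simp

lemma subst_ipow:
  assumes "is_ideal P" "\<And>z. w z \<noteq> 0 \<Longrightarrow> \<phi> z \<in> P" "\<And>z. w z \<le> Suc 0" "f \<in> Filt w m"
  shows "subst \<kappa> \<phi> f \<in> ipow P m"
  unfolding subst_def
proof (rule is_ideal_sum[OF is_ideal_ipow[OF assms(1)]])
  fix t assume "t \<in> keys f"
  then have "mon_val \<phi> t \<in> ipow P m"
    using assms by (intro mon_val_ipow[where w = w]) (auto simp: Filt_def)
  then show "\<kappa> (lookup f t) * mon_val \<phi> t \<in> ipow P m"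
    using is_ideal_ipow[OF assms(1)] by (auto simp: is_ideal_def)
qed

lemma ipow_1_subset: "is_ideal P \<Longrightarrow> ipow P (Suc 0) \<subseteq> P"
  using ipow_subset[of "\<lambda>m. if m = 0 then UNIV else P" P "Suc 0"]
  by (auto simp: is_ideal_def simp del: ipow.simps split: if_splits)

text \<open>Needed for the composite of \<Theta> and \<Psi>, which replaces each variable by a
  monomial: the exponent of the image is a linear function of \<open>t\<close>, written out by
  coordinates.\<close>

lemma mon_val_monomials:
  "\<exists>s. mon_val (\<lambda>z. single (e z) 1) t = (single s 1 :: ('x::finite, 'a::comm_ring_1) mp) \<and>
     (\<forall>y. lookup s y = (\<Sum>z\<in>UNIV. lookup t z * lookup (e z) y))"
proof -
  let ?e = "\<lambda>z. single (e z) (1 :: 'a)"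
  have pow: "\<exists>s. ?e z ^ n = single s 1 \<and> (\<forall>y. lookup s y = n * lookup (e z) y)" for z n
  proof (induction n)
    case (Suc n)
    then obtain s where "?e z ^ n = single s 1" "\<forall>y. lookup s y = n * lookup (e z) y" by blast
    then show ?case by (intro exI[of _ "e z + s"]) (simp add: mult_single lookup_add)
  qed (auto intro!: exI[of _ 0])
  have "\<exists>s. (\<Prod>z\<in>A. ?e z ^ lookup t z) = single s 1 \<and>
      (\<forall>y. lookup s y = (\<Sum>z\<in>A. lookup t z * lookup (e z) y))" if "finite A" for A
    using that
  proof induction
    case (insert z A)
    then obtain s where s: "(\<Prod>z\<in>A. ?e z ^ lookup t z) = single s 1"
      "\<forall>y. lookup s y = (\<Sum>z\<in>A. lookup t z * lookup (e z) y)" by blast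
    obtain s' where "?e z ^ lookup t z = single s' 1" "\<forall>y. lookup s' y = lookup t z * lookup (e z) y"
      using pow by blast
    with s insert show ?case
      by (intro exI[of _ "s' + s"]) (simp add: mult_single lookup_add)
  qed (auto intro!: exI[of _ 0])
  from this[of UNIV] show ?thesis by (simp add: mon_val_def)
qed

section \<open>Charts of binomial edge varieties\<close>

primrec vtx :: "'v pvar \<Rightarrow> 'v" where
  "vtx (Xvar v) = v"
| "vtx (Yvar v) = v"

definition minor :: "'v \<Rightarrow> 'v \<Rightarrow> ('v pvar, 'k::comm_ring_1) mp" where
  "minor u v = vr (Xvar u) * vr (Yvar v) - vr (Xvar v) * vr (Yvar u)"

text \<open>
  Local coordinates of the binomial edge variety. Given a set \<open>T\<close> of vertices at which both coordinates
  vanish and a root \<open>r v\<close> of the component of each other vertex \<open>v\<close>, a point where the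
  \<open>pv\<close>-coordinates of the roots do not vanish is described by all coordinates of the roots and the
  \<open>pv\<close>-coordinates of the other vertices. \<open>\<theta>\<close> rectifies the variety after rescaling: the variables
  of weight 1 are its transversal coordinates. The choice \<open>sw\<close> decides which of \<open>x_v, y_v\<close> is \<open>pv v\<close>.
\<close>

locale chart =
  fixes T :: "'v::finite set" and r :: "'v \<Rightarrow> 'v" and sw :: "'v \<Rightarrow> bool"
  assumes r_T: "v \<notin> T \<Longrightarrow> r v \<notin> T" and r_r: "v \<notin> T \<Longrightarrow> r (r v) = r v"
begin

definition pv :: "'v \<Rightarrow> 'v pvar" where "pv v = (if sw (r v) then Yvar v else Xvar v)"
definition qv :: "'v \<Rightarrow> 'v pvar" where "qv v = (if sw (r v) then Xvar v else Yvar v)"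

definition N :: "'v set" where "N = {v. v \<notin> T \<and> r v \<noteq> v}"

definition w :: "'v pvar \<Rightarrow> nat" where
  "w z = (if vtx z \<in> T \<or> (vtx z \<in> N \<and> z = qv (vtx z)) then 1 else 0)"

text \<open>At a vertex v of \<open>N\<close> the pair of \<open>pv\<close> and \<open>qv\<close>
  goes to \<open>pv v\<close> times the pair at the root, plus the transversal deviation
  \<open>qv v\<close> in the second entry. Putting the deviation to 0 makes the two vectors
  proportional.\<close>

definition \<theta> :: "'v pvar \<Rightarrow> ('v pvar, 'k::field) mp" where
  "\<theta> z = (let v = vtx z in
     if v \<notin> N then vr z
     else if z = pv v then vr (pv v) * vr (pv (r v))
     else vr (pv v) * vr (qv (r v)) + vr (qv v))"

text \<open>An inverse of \<theta> with denominators cleared. The transversal coordinate at v goes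
  to the minor of \<open>r v\<close> and \<open>v\<close> up to sign, hence into every prime under
  consideration.\<close>

definition \<psi> :: "'v pvar \<Rightarrow> ('v pvar, 'k::field) mp" where
  "\<psi> z = (let v = vtx z in
     if v \<notin> N \<or> z = pv v then vr z
     else vr (pv (r v)) * vr (qv v) - vr (pv v) * vr (qv (r v)))"

definition \<Theta> :: "('v pvar, 'k::field) mp \<Rightarrow> ('v pvar, 'k) mp" where "\<Theta> = subst cst \<theta>"
definition \<Psi> :: "('v pvar, 'k::field) mp \<Rightarrow> ('v pvar, 'k) mp" where "\<Psi> = subst cst \<psi>"

definition g :: "('v pvar, 'k::field) mp" where "g = (\<Prod>v\<in>N. vr (pv (r v)))"

definition ideal0 :: "('v pvar, 'k::field) mp set" where
  "ideal0 = {f. \<Theta> f \<in> Filt w 1}"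

lemma vtx_pq [simp]: "vtx (pv v) = v" "vtx (qv v) = v"
  by (simp_all add: pv_def qv_def)

lemma pq_neq [simp]: "pv v \<noteq> qv v" "qv v \<noteq> pv v"
  by (simp_all add: pv_def qv_def)

lemma pq_cases: "z = pv (vtx z) \<or> z = qv (vtx z)"
  by (cases z) (auto simp: pv_def qv_def)

lemma minor_eq:
  assumes "r u = r v"
  shows "minor u v = (if sw (r u) then -1 else 1) * (vr (pv u) * vr (qv v) - vr (pv v) * vr (qv u))"
  using assms by (simp add: minor_def pv_def qv_def mult.commute)

lemma N_root: "v \<in> N \<Longrightarrow> r v \<notin> N \<and> r v \<notin> T \<and> r (r v) = r v"
  using r_T r_r by (auto simp: N_def)

lemma rhom_\<Theta>: "rhom \<Theta>"
  unfolding \<Theta>_def by (rule rhom_subst[OF rhom_cst])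

lemma rhom_\<Psi>: "rhom \<Psi>"
  unfolding \<Psi>_def by (rule rhom_subst[OF rhom_cst])

lemma \<Theta>_vr: "\<Theta> (vr z) = \<theta> z"
  by (simp add: \<Theta>_def subst_vr[OF rhom_cst])

lemma \<Psi>_vr: "\<Psi> (vr z) = \<psi> z"
  by (simp add: \<Psi>_def subst_vr[OF rhom_cst])

lemma \<Theta>_cst: "\<Theta> (cst c) = cst c"
  by (simp add: \<Theta>_def subst_cst[OF rhom_cst])

lemma \<Psi>_cst: "\<Psi> (cst c) = cst c"
  by (simp add: \<Psi>_def subst_cst[OF rhom_cst])

lemma \<theta>_out: "vtx z \<notin> N \<Longrightarrow> \<theta> z = vr z"
  by (simp add: \<theta>_def)

lemma \<psi>_out: "vtx z \<notin> N \<Longrightarrow> \<psi> z = vr z"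
  by (simp add: \<psi>_def)

lemma \<Theta>_g: "\<Theta> g = g"
  using N_root by (simp add: g_def rhom.prod[OF rhom_\<Theta>] \<Theta>_vr \<theta>_out)

lemma \<Psi>_g: "\<Psi> g = g"
  using N_root by (simp add: g_def rhom.prod[OF rhom_\<Psi>] \<Psi>_vr \<psi>_out)

lemma w_le: "w z \<le> Suc 0"
  by (simp add: w_def)

definition ex :: "'v pvar \<Rightarrow> ('v pvar \<Rightarrow>\<^sub>0 nat)" where
  "ex z = single z 1 + (if vtx z \<in> N then single (pv (r (vtx z))) 1 else 0)"

text \<open>Clearing denominators costs one factor, the \<open>pv\<close>-coordinate of the root,
  for each variable at a vertex of \<open>N\<close>; so the composite is a substitution by
  monomials.\<close>

lemma \<Theta>_\<Psi>: "\<Theta> (\<Psi> f) = subst cst (\<lambda>z. single (ex z) 1) (f :: ('v pvar, 'k::field) mp)"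
proof (rule rhom_eqI[OF rhom_comp[OF rhom_\<Theta> rhom_\<Psi>] rhom_subst[OF rhom_cst]])
  fix z :: "'v pvar"
  have "\<Theta> (\<psi> z) = (single (ex z) 1 :: ('v pvar, 'k) mp)"
  proof (cases "vtx z \<in> N")
    case True
    let ?v = "vtx z"
    let ?c = "r ?v"
    have c: "?c \<notin> N" using N_root[OF True] by simp
    have e: "single (ex z) 1 = (vr z * vr (pv ?c) :: ('v pvar, 'k) mp)"
      using True by (simp add: ex_def vr_def mult_single)
    show ?thesis
    proof (cases "z = pv ?v")
      case True
      with \<open>?v \<in> N\<close> show ?thesis
        unfolding e by (simp add: \<psi>_def \<Theta>_vr) (simp add: \<theta>_def)
    next
      case False
      then have q: "z = qv ?v" using pq_cases by blast
      have "\<Theta> (\<psi> z) = \<Theta> (vr (pv ?c)) * \<Theta> (vr (qv ?v)) - \<Theta> (vr (pv ?v)) * \<Theta> (vr (qv ?c))"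
        using True False
        by (simp add: \<psi>_def Let_def rhom.mult[OF rhom_\<Theta>] rhom.diff[OF rhom_\<Theta>])
      also have "\<dots> = vr (pv ?c) * (vr (pv ?v) * vr (qv ?c) + vr (qv ?v)) - vr (pv ?v) * vr (pv ?c) * vr (qv ?c)"
        using True c by (simp add: \<Theta>_vr \<theta>_def Let_def)
      also have "\<dots> = vr (qv ?v) * vr (pv ?c)"
        by (simp add: algebra_simps)
      finally show ?thesis unfolding e using q by simp
    qed
  next
    case False
    then show ?thesis
      by (simp add: \<psi>_out \<Theta>_vr \<theta>_out) (simp add: ex_def vr_def)
  qed
  then show "\<Theta> (\<Psi> (vr z)) = subst cst (\<lambda>z. single (ex z) 1) (vr z :: ('v pvar, 'k) mp)"
    by (simp add: \<Psi>_vr subst_vr[OF rhom_cst])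
qed (simp add: \<Psi>_cst \<Theta>_cst subst_cst[OF rhom_cst])

text \<open>The extra factors are coordinates of roots, which have weight 0 and do not belong to
  \<open>N\<close>. Thus the induced map \<sigma> on exponents preserves weights and is injective,
  and distinct monomials of \<open>u\<close> cannot cancel.\<close>

lemma Filt_of_\<Theta>_\<Psi>:
  fixes u :: "('v pvar, 'k::field) mp"
  assumes "\<Theta> (\<Psi> u) \<in> Filt w m"
  shows "u \<in> Filt w m"
proof -
  obtain \<sigma> where \<sigma>: "\<And>t. mon_val (\<lambda>z. single (ex z) 1) t = (single (\<sigma> t) 1 :: ('v pvar, 'k) mp)"
    "\<And>t y. lookup (\<sigma> t) y = (\<Sum>z\<in>UNIV. lookup t z * lookup (ex z) y)"
    using mon_val_monomials[of ex] by metis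
  have \<sigma>': "lookup (\<sigma> t) y = lookup t y +
      (\<Sum>z\<in>UNIV. if vtx z \<in> N \<and> pv (r (vtx z)) = y then lookup t z else 0)" for t y
  proof -
    have "lookup (\<sigma> t) y = (\<Sum>z\<in>UNIV. (if z = y then lookup t y else 0) +
      (if vtx z \<in> N \<and> pv (r (vtx z)) = y then lookup t z else 0))"
      unfolding \<sigma>(2) by (intro sum.cong refl) (simp add: ex_def lookup_add lookup_single when_def)
    then show ?thesis by (simp add: sum.distrib)
  qed
  have nonroot: "lookup (\<sigma> t) y = lookup t y" if "vtx y \<in> N \<or> vtx y \<in> T \<or> w y \<noteq> 0" for t y
  proof -
    have "\<not> (vtx z \<in> N \<and> pv (r (vtx z)) = y)" for z
      using that N_root[of "vtx z"] by (auto simp: w_def)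
    then show ?thesis unfolding \<sigma>' by (auto intro!: sum.neutral)
  qed
  have inj: "s = t" if "\<sigma> s = \<sigma> t" for s t
  proof (rule poly_mapping_eqI)
    fix y
    have "lookup s z = lookup t z" if "vtx z \<in> N" for z
      using nonroot[of z] that \<open>\<sigma> s = \<sigma> t\<close> by metis
    then have "(\<Sum>z\<in>UNIV. if vtx z \<in> N \<and> pv (r (vtx z)) = y then lookup s z else 0) =
       (\<Sum>z\<in>UNIV. if vtx z \<in> N \<and> pv (r (vtx z)) = y then lookup t z else 0)"
      by (intro sum.cong) auto
    moreover have "lookup (\<sigma> s) y = lookup (\<sigma> t) y" using that by simp
    ultimately show "lookup s y = lookup t y" unfolding \<sigma>' by simp
  qed
  have wt: "wt w (\<sigma> t) = wt w t" for t
    unfolding wt_def using nonroot by (intro sum.cong refl) (metis mult_eq_0_iff)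
  have "m \<le> wt w t" if "t \<in> keys u" for t
  proof -
    have "lookup (\<Theta> (\<Psi> u)) (\<sigma> t) = (\<Sum>s\<in>keys u. if s = t then lookup u t else 0)"
      unfolding \<Theta>_\<Psi> subst_def lookup_sum
      by (intro sum.cong refl) (auto simp: \<sigma>(1) cst_def mult_single lookup_single when_def dest: inj)
    then have "\<sigma> t \<in> keys (\<Theta> (\<Psi> u))"
      using that by (simp add: in_keys_iff)
    with assms show ?thesis by (auto simp: Filt_def wt)
  qed
  then show ?thesis by (simp add: Filt_def)
qed

text \<open>\<Psi> becomes surjective once \<open>g\<close> is inverted. Since \<Psi> fixes
  \<open>g\<close>, it is enough to treat the variables.\<close>

lemma ex_\<Psi>_preimage: "\<exists>n u. g ^ n * f = \<Psi> u"
proof (induction f rule: mp_induct)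
  case (cst c)
  then show ?case by (intro exI[of _ 0] exI[of _ "cst c"]) (simp add: \<Psi>_cst)
next
  case (vr z)
  let ?v = "vtx z"
  show ?case
  proof (cases "?v \<in> N \<and> z \<noteq> pv ?v")
    case False
    then show ?thesis
      by (intro exI[of _ 0] exI[of _ "vr z"]) (auto simp: \<Psi>_vr \<psi>_def Let_def)
  next
    case True
    then have q: "z = qv ?v" using pq_cases by blast
    let ?c = "r ?v"
    \<comment> \<open>This is \<open>g\<close> without its factor at the vertex in question; that
      factor is supplied by \<psi> at the transversal coordinate.\<close>
    let ?g = "\<Prod>v\<in>N - {?v}. vr (pv (r v))"
    have c: "?c \<notin> N" using N_root True by simp
    have "\<Psi> (?g * (vr z + vr (pv ?v) * vr (qv ?c))) = ?g * (\<psi> z + \<psi> (pv ?v) * \<psi> (qv ?c))"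
      using N_root by (simp add: rhom.mult[OF rhom_\<Psi>] rhom.add[OF rhom_\<Psi>] rhom.prod[OF rhom_\<Psi>] \<Psi>_vr \<psi>_out)
    also have "\<dots> = ?g * (vr (pv ?c) * vr z)"
      using True c q by (simp add: \<psi>_def Let_def)
    also have "\<dots> = g * vr z"
      using True by (simp add: g_def prod.remove[of N ?v] mult_ac)
    finally show ?thesis
      by (metis power_one_right)
  qed
next
  case (add f h)
  then obtain n m u v where "g ^ n * f = \<Psi> u" "g ^ m * h = \<Psi> v" by blast
  then have "g ^ (n + m) * (f + h) = \<Psi> (g ^ m * u + g ^ n * v)"
    by (simp add: rhom.mult[OF rhom_\<Psi>] rhom.add[OF rhom_\<Psi>] rhom.power[OF rhom_\<Psi>] \<Psi>_g
        power_add algebra_simps flip: \<open>g ^ n * f = \<Psi> u\<close> \<open>g ^ m * h = \<Psi> v\<close>)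
  then show ?case by blast
next
  case (mult f h)
  then obtain n m u v where "g ^ n * f = \<Psi> u" "g ^ m * h = \<Psi> v" by blast
  then have "g ^ (n + m) * (f * h) = \<Psi> (u * v)"
    by (simp add: rhom.mult[OF rhom_\<Psi>] power_add algebra_simps
        flip: \<open>g ^ n * f = \<Psi> u\<close> \<open>g ^ m * h = \<Psi> v\<close>)
  then show ?case by blast
qed

text \<open>\<open>Filt w 1\<close> is prime by \<open>Filt_mult_cancel\<close> with m = 1, and
  primality passes to preimages under \<Theta>.\<close>

lemma is_prime_ideal0: "is_prime ideal0"
  unfolding is_prime_def is_ideal_def ideal0_def
proof (intro conjI allI ballI impI; (elim CollectE)?; (intro CollectI)?)
  show "\<Theta> 0 \<in> Filt w 1" by (simp add: rhom.zero[OF rhom_\<Theta>] zero_in_Filt)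
  show "1 \<notin> {f. \<Theta> f \<in> Filt w 1}" by (simp add: rhom.one[OF rhom_\<Theta>] Filt_def)
next
  fix a b :: "('v pvar, 'k::field) mp"
  show "\<Theta> a \<in> Filt w 1 \<Longrightarrow> \<Theta> b \<in> Filt w 1 \<Longrightarrow> \<Theta> (a + b) \<in> Filt w 1"
    by (simp add: rhom.add[OF rhom_\<Theta>] Filt_add)
  show "\<Theta> b \<in> Filt w 1 \<Longrightarrow> \<Theta> (a * b) \<in> Filt w 1"
    by (simp add: rhom.mult[OF rhom_\<Theta>] Filt_mult_right)
  show "\<Theta> (a * b) \<in> Filt w 1 \<Longrightarrow> a \<in> {f. \<Theta> f \<in> Filt w 1} \<or> b \<in> {f. \<Theta> f \<in> Filt w 1}"
    using Filt_mult_cancel[of "\<Theta> a" "\<Theta> b" w 1] by (auto simp: rhom.mult[OF rhom_\<Theta>])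
qed

lemma minor_in_ideal0:
  assumes "u \<in> T \<or> v \<in> T \<or> (u \<notin> T \<and> v \<notin> T \<and> r u = r v)"
  shows "minor u v \<in> (ideal0 :: ('v pvar, 'k::field) mp set)"
proof -
  let ?\<Theta> = "\<Theta> :: ('v pvar, 'k) mp \<Rightarrow> _"
  have vr: "vr z \<in> Filt w 1" if "w z = 1" for z
    using that by (simp add: vr_def Filt_def wt_single)
  have T: "?\<Theta> (vr z) \<in> Filt w 1" if "vtx z \<in> T" for z
    using that vr[of z] by (simp add: \<Theta>_vr \<theta>_out N_def w_def)
  note simps = rhom.mult[OF rhom_\<Theta>] rhom.diff[OF rhom_\<Theta>]
  have diff: "a \<in> Filt w 1 \<Longrightarrow> b \<in> Filt w 1 \<Longrightarrow> a - b \<in> Filt w 1" for a b :: "('v pvar, 'k) mp"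
    using keys_diff[of a b] by (auto simp: Filt_def)
  consider "u \<in> T" | "v \<in> T" | "u \<notin> T" "v \<notin> T" "r u = r v"
    using assms by blast
  then show ?thesis
  proof cases
    case 1
    with T[of "Xvar u"] T[of "Yvar u"] show ?thesis
      by (simp add: ideal0_def minor_def simps diff[simplified] Filt_mult_right mult.commute[of "?\<Theta> (vr (Xvar u))"])
  next
    case 2
    with T[of "Xvar v"] T[of "Yvar v"] show ?thesis
      by (simp add: ideal0_def minor_def simps diff[simplified] Filt_mult_right mult.commute[of "?\<Theta> (vr (Xvar v))"])
  next
    case 3
    \<comment> \<open>With a and b, roots and other vertices are treated alike: the vector at x goes
      to \<open>a x\<close> times the vector at its root plus (0, \<open>b x\<close>), so the
      determinant lies in the ideal generated by \<open>b u\<close> and \<open>b v\<close>.\<close>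
    define a where "a x = (if r x = x then 1 else vr (pv x) :: ('v pvar, 'k) mp)" for x
    define b where "b x = (if r x = x then 0 else vr (qv x) :: ('v pvar, 'k) mp)" for x
    have b: "b x \<in> Filt w 1" if "x \<notin> T" for x
      using that vr[of "qv x"] by (auto simp: b_def zero_in_Filt w_def N_def)
    have p: "?\<Theta> (vr (pv x)) = a x * vr (pv (r x))" if "x \<notin> T" for x
      using that by (auto simp: \<Theta>_vr \<theta>_def a_def N_def)
    have q: "?\<Theta> (vr (qv x)) = a x * vr (qv (r x)) + b x" if "x \<notin> T" for x
      using that by (auto simp: \<Theta>_vr \<theta>_def a_def b_def N_def)
    have "?\<Theta> (vr (pv u) * vr (qv v) - vr (pv v) * vr (qv u)) =
        a u * vr (pv (r u)) * b v - a v * vr (pv (r u)) * b u"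
      using 3 by (simp add: simps p q algebra_simps)
    also have "\<dots> \<in> Filt w 1"
      using 3 by (intro diff Filt_mult_right b)
    finally have "vr (pv u) * vr (qv v) - vr (pv v) * vr (qv u) \<in> (ideal0 :: ('v pvar, 'k) mp set)"
      by (simp add: ideal0_def)
    then show ?thesis
      using is_prime_ideal0 unfolding minor_eq[OF 3(3)] is_prime_def is_ideal_def by blast
  qed
qed

text \<open>Write \<open>g ^ n * f\<close> as \<Psi> u. Applying \<Theta> shows that
  \<open>u\<close> has weight at least \<open>m\<close>, and \<Psi> sends each variable of weight 1
  into \<open>P\<close>.\<close>

lemma ipow_of_Filt:
  fixes P :: "('v pvar, 'k::field) mp set"
  assumes P: "is_ideal P" "\<And>z. w z \<noteq> 0 \<Longrightarrow> \<psi> z \<in> P" and f: "\<Theta> f \<in> Filt w m"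
  shows "\<exists>n. g ^ n * f \<in> ipow P m"
proof -
  obtain n u where nu: "g ^ n * f = \<Psi> u"
    using ex_\<Psi>_preimage by blast
  have "\<Theta> (g ^ n * f) = g ^ n * \<Theta> f"
    by (simp add: rhom.mult[OF rhom_\<Theta>] rhom.power[OF rhom_\<Theta>] \<Theta>_g)
  then have "\<Theta> (\<Psi> u) \<in> Filt w m"
    using f nu by (simp add: Filt_mult_right)
  then have "u \<in> Filt w m" by (rule Filt_of_\<Theta>_\<Psi>)
  then have "\<Psi> u \<in> ipow P m"
    unfolding \<Psi>_def using P w_le by (intro subst_ipow[where w = w])
  with nu show ?thesis by metis
qed

lemma prime_not_prod:
  assumes "is_prime P" "finite A" "\<And>x. x \<in> A \<Longrightarrow> f x \<notin> P"
  shows "prod f A \<notin> P"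
  using assms(2,3)
  by induction (use assms(1) in \<open>auto simp: is_prime_def\<close>)

lemma g_power_notin:
  assumes "is_prime P" "\<And>v. v \<in> N \<Longrightarrow> vr (pv (r v)) \<notin> P"
  shows "g ^ n \<notin> P"
  using prime_not_prod[OF assms(1), of "{..<n}" "\<lambda>_. g"]
    prime_not_prod[OF assms(1), of N "\<lambda>v. vr (pv (r v))"] assms(2)
  by (simp add: g_def)

lemma ideal0_subset:
  fixes P :: "('v pvar, 'k::field) mp set"
  assumes "is_prime P" "\<And>v. v \<in> N \<Longrightarrow> vr (pv (r v)) \<notin> P" "\<And>z. w z \<noteq> 0 \<Longrightarrow> \<psi> z \<in> P"
  shows "ideal0 \<subseteq> P"
proof
  fix f :: "('v pvar, 'k) mp"
  assume "f \<in> ideal0"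
  have P: "is_ideal P" using assms(1) by (simp add: is_prime_def)
  obtain n where "g ^ n * f \<in> ipow P 1"
    using ipow_of_Filt[OF P assms(3)] \<open>f \<in> ideal0\<close> unfolding ideal0_def by blast
  then have "g ^ n * f \<in> P" using ipow_1_subset[OF P] by auto
  with assms(1) g_power_notin[OF assms(1,2)] show "f \<in> P"
    unfolding is_prime_def by blast
qed

text \<open>One inclusion is the Taylor argument \<open>psp_in_Filt\<close> applied to \<Theta>; for
  the other, a power of \<open>g\<close> is the multiplier outside \<open>P\<close>.\<close>

lemma psp_ideal0:
  fixes P :: "('v pvar, 'k::field) mp set"
  assumes "is_prime P" "\<And>v. v \<in> N \<Longrightarrow> vr (pv (r v)) \<notin> P" "\<And>z. w z \<noteq> 0 \<Longrightarrow> \<psi> z \<in> P"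
    and "ideal0 = P"
  shows "psp P m = {f. \<Theta> f \<in> Filt w m}"
proof (intro equalityI subsetI CollectI)
  fix f :: "('v pvar, 'k) mp"
  assume "f \<in> psp P m"
  then show "\<Theta> f \<in> Filt w m"
    using assms(1,4) by (intro psp_in_Filt[of P]) (auto simp: rhom_\<Theta> \<Theta>_cst ideal0_def)
next
  fix f :: "('v pvar, 'k) mp"
  assume f: "f \<in> {f. \<Theta> f \<in> Filt w m}"
  have P: "is_ideal P" using assms(1) by (simp add: is_prime_def)
  obtain n where "g ^ n * f \<in> ipow P m"
    using ipow_of_Filt[OF P assms(3)] f by blast
  then have "f * g ^ n \<in> ipow P m" by (simp add: mult.commute)
  with g_power_notin[OF assms(1,2), of n] show "f \<in> psp P m"
    unfolding psp_def by blast
qed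

text \<open>A grading of the target for which \<open>\<theta>\<close> is homogeneous.\<close>

definition w' :: "'v pvar \<Rightarrow> nat" where
  "w' z = (if vtx z \<in> N \<and> z = pv (vtx z) then 0 else 1)"

lemma \<theta>_Hom: "\<theta> z \<in> Hom w' 1"
proof -
  have vr: "vr y \<in> Hom w' (w' y)" for y
    by (simp add: vr_def Hom_def wt_single)
  show ?thesis
  proof (cases "vtx z \<in> N")
    case True
    have "w' (pv (vtx z)) = 0" "w' (qv (vtx z)) = 1"
      "w' (pv (r (vtx z))) = 1" "w' (qv (r (vtx z))) = 1"
      using True N_root[OF True] by (simp_all add: w'_def)
    then have "vr (pv (vtx z)) * vr (pv (r (vtx z))) \<in> Hom w' 1"
      "vr (pv (vtx z)) * vr (qv (r (vtx z))) \<in> Hom w' 1" "vr (qv (vtx z)) \<in> Hom w' 1"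
      using Hom_mult[OF vr vr, of "pv (vtx z)" "pv (r (vtx z))"]
        Hom_mult[OF vr vr, of "pv (vtx z)" "qv (r (vtx z))"] vr[of "qv (vtx z)"]
      by simp_all
    then show ?thesis
      using True by (auto simp: \<theta>_def Let_def intro: Hom_add)
  next
    case False
    then show ?thesis using vr[of z] by (simp add: \<theta>_out w'_def)
  qed
qed

text \<open>\<Theta> is graded from the standard grading to \<open>w'\<close>, and
  \<open>Filt\<close>, being determined by monomials, is stable under parts for any grading.\<close>

lemma \<Theta>_restr: "\<Theta> f \<in> Filt w m \<Longrightarrow> \<Theta> (restr {t. mon_deg t = d} f) \<in> Filt w m"
proof -
  assume f: "\<Theta> f \<in> Filt w m"
  have "\<Theta> (restr {t. deg t = d} f) = restr {t. wt w' t = d} (\<Theta> f)"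
    unfolding \<Theta>_def
    by (rule subst_restr[OF rhom_cst _ \<theta>_Hom]) (simp add: cst_def Hom_def)
  with f show ?thesis by (simp add: mon_deg_eq_wt Filt_restr)
qed

text \<open>The chart only touches vertices of \<open>W\<close>; the other variables are fixed by
  \<Theta> and have weight 0.\<close>

lemma \<Theta>_coeffs:
  assumes W: "T \<subseteq> W" "\<And>v. v \<in> N \<Longrightarrow> v \<in> W \<and> r v \<in> W" and f: "\<Theta> f \<in> Filt w m"
  shows "\<Theta> (lookup (coeffs_in {z. vtx z \<notin> W} f) s) \<in> Filt w m"
proof -
  let ?Z = "{z. vtx z \<notin> W}"
  have "lookup (coeffs_in ?Z (\<Theta> f)) s = \<Theta> (lookup (coeffs_in ?Z f) s)"
    unfolding \<Theta>_def
  proof (rule subst_lookup_coeffs)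
    fix z assume z: "z \<notin> ?Z"
    have v: "rho ?Z (vr y) = vr y" if "vtx y \<in> W" for y
      using that by (simp add: rho_vr)
    show "rho ?Z (\<theta> z) = \<theta> z"
      using z W(2)[of "vtx z"]
      by (auto simp: \<theta>_def Let_def v rhom.mult[OF rhom_rho] rhom.add[OF rhom_rho])
  qed (use W in \<open>auto intro: \<theta>_out\<close>)
  moreover have "lookup (coeffs_in ?Z (\<Theta> f)) s \<in> Filt w m"
    by (rule Filt_lookup_coeffs[OF f]) (use W in \<open>auto simp: w_def\<close>)
  ultimately show ?thesis by simp
qed

end

section \<open>Minimal primes over the minors of the edges\<close>

definition minimal_edge_primes :: "('v \<times> 'v) set \<Rightarrow> ('v pvar, 'k::field) mp set set" where
  "minimal_edge_primes E = {P. is_prime P \<and> (\<forall>(u, v)\<in>E. minor u v \<in> P) \<and>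
     (\<forall>Q. is_prime Q \<longrightarrow> (\<forall>(u, v)\<in>E. minor u v \<in> Q) \<longrightarrow> Q \<subseteq> P \<longrightarrow> Q = P)}"

definition chart_on :: "'v set \<Rightarrow> 'v::finite set \<Rightarrow> ('v \<Rightarrow> 'v) \<Rightarrow> bool" where
  "chart_on W T r \<longleftrightarrow> chart T r \<and> T \<subseteq> W \<and> (\<forall>v. v \<notin> T \<longrightarrow> r v \<noteq> v \<longrightarrow> v \<in> W \<and> r v \<in> W)"

text \<open>\<open>P\<close> dictates the chart: \<open>T\<close> collects the vertices with both
  coordinates in \<open>P\<close>, and r picks a vertex in each component of the remaining graph.
  For a minimal \<open>P\<close> the inclusion is an equality, and the last clause then describes
  the symbolic powers.\<close>

lemma ex_chart:
  fixes P :: "('v::finite pvar, 'k::field) mp set"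
  assumes E: "sym E" "E \<subseteq> W \<times> W" and P: "is_prime P" and EP: "\<And>u v. (u, v) \<in> E \<Longrightarrow> minor u v \<in> P"
  shows "\<exists>T r sw. chart_on W T r \<and> (\<forall>(u, v)\<in>E. minor u v \<in> (chart.ideal0 T r sw :: ('v pvar, 'k) mp set)) \<and>
    chart.ideal0 T r sw \<subseteq> P \<and>
    (chart.ideal0 T r sw = P \<longrightarrow> (\<forall>m. psp P m = {f. chart.\<Theta> T r sw f \<in> Filt (chart.w T r sw) m}))"
proof -
  have I: "is_ideal P" using P by (simp add: is_prime_def)
  \<comment> \<open>\<open>P\<close> may also contain variables of vertices outside
    \<open>W\<close>; those must not enter a chart on \<open>W\<close>.\<close>
  define T where "T = {v \<in> W. vr (Xvar v) \<in> P \<and> vr (Yvar v) \<in> P}"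
  define R where "R = {(u, v) \<in> E. u \<notin> T \<and> v \<notin> T}"
  define r where "r v = (SOME u. (v, u) \<in> R\<^sup>*)" for v
  \<comment> \<open>If x at a root lies in \<open>P\<close>, then y does not, because the root of a
    vertex of \<open>N\<close> is in \<open>W\<close> but not in \<open>T\<close>; so
    \<open>pv\<close> of such a root is never in \<open>P\<close>.\<close>
  define sw where "sw c \<longleftrightarrow> vr (Xvar c) \<in> P" for c
  have "sym R" using E(1) by (auto simp: R_def sym_def)
  then have symR: "sym (R\<^sup>*)" by (rule sym_rtrancl)
  have r: "(v, r v) \<in> R\<^sup>*" for v
    unfolding r_def by (rule someI[of _ v]) simp
  have r_eq: "r u = r v" if "(u, v) \<in> R\<^sup>*" for u v
  proof -
    have "(u, x) \<in> R\<^sup>* \<longleftrightarrow> (v, x) \<in> R\<^sup>*" for x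
      using that symR by (meson rtrancl_trans symD)
    then show ?thesis by (simp add: r_def)
  qed
  have step: "u = v \<or> (u \<in> W - T \<and> v \<in> W - T)" if "(u, v) \<in> R\<^sup>*" for u v
    using that E(2) by induction (auto simp: R_def)
  interpret chart T r sw
  proof
    show "r v \<notin> T" if "v \<notin> T" for v using step[OF r[of v]] that by auto
    show "r (r v) = r v" for v using r_eq[OF r[of v]] by simp
  qed
  have NW: "v \<in> W - T \<and> r v \<in> W - T" if "v \<in> N" for v
    using step[OF r[of v]] that by (auto simp: N_def)
  have p: "vr (pv (r v)) \<notin> P" if "v \<in> N" for v
    using NW[OF that] N_root[OF that] by (auto simp: T_def pv_def sw_def)
  have minor: "minor u v \<in> P" if "(u, v) \<in> R\<^sup>*" for u v
    using that
  proof induction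
    case base
    then show ?case using I by (simp add: minor_def mult.commute is_ideal_def)
  next
    case (step v x)
    have vx: "minor v x \<in> P" and v: "v \<in> W - T"
      using step(2) EP E(2) by (auto simp: R_def)
    \<comment> \<open>Pluecker relations for u, v, x. They carry membership along a path, as one of
      the two coordinates of the middle vertex v is outside \<open>P\<close>.\<close>
    have "vr (Xvar v) * minor u x = (vr (Xvar u) :: ('v pvar, 'k) mp) * minor v x + vr (Xvar x) * minor u v"
      "vr (Yvar v) * minor u x = (vr (Yvar u) :: ('v pvar, 'k) mp) * minor v x + vr (Yvar x) * minor u v"
      by (simp_all add: minor_def algebra_simps)
    then have "vr (Xvar v) * minor u x \<in> P" "vr (Yvar v) * minor u x \<in> P"
      using vx step.IH I by (simp_all add: is_ideal_def)
    with v P show ?case by (auto simp: T_def is_prime_def)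
  qed
  have \<psi>P: "\<psi> z \<in> P" if "w z \<noteq> 0" for z
  proof (cases "vtx z \<in> T")
    case True
    then have "vr z \<in> P" by (cases z) (auto simp: T_def)
    with True show ?thesis by (simp add: \<psi>_out N_def)
  next
    case False
    then have v: "vtx z \<in> N" "z = qv (vtx z)" using that by (auto simp: w_def split: if_splits)
    have "z \<noteq> pv (vtx z)" using v(2) pq_neq(2) by metis
    with v(1) have "\<psi> z = (vr (pv (r (vtx z))) * vr (qv (vtx z)) -
        vr (pv (vtx z)) * vr (qv (r (vtx z))) :: ('v pvar, 'k) mp)"
      by (simp add: \<psi>_def Let_def)
    moreover have "minor (r (vtx z)) (vtx z) \<in> P"
      using minor r symR by (meson symD)
    moreover have "minor (r (vtx z)) (vtx z) = (if sw (r (r (vtx z))) then -1 else 1) *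
        (vr (pv (r (vtx z))) * vr (qv (vtx z)) - vr (pv (vtx z)) * vr (qv (r (vtx z))) :: ('v pvar, 'k) mp)"
      using N_root[OF v(1)] by (intro minor_eq) simp
    ultimately show ?thesis
      using is_ideal_uminus[OF I, of "- \<psi> z"] by (simp split: if_splits)
  qed
  have "chart_on W T r"
    unfolding chart_on_def
  proof (intro conjI allI impI)
    show "T \<subseteq> W" by (auto simp: T_def)
    show "v \<in> W" "r v \<in> W" if "v \<notin> T" "r v \<noteq> v" for v
      using NW[of v] that by (simp_all add: N_def)
  qed (rule chart_axioms)
  moreover have "minor u v \<in> (ideal0 :: ('v pvar, 'k) mp set)" if "(u, v) \<in> E" for u v
  proof -
    have "(u, v) \<in> R" if "u \<notin> T" "v \<notin> T" using that \<open>(u, v) \<in> E\<close> by (simp add: R_def)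
    then show ?thesis by (intro minor_in_ideal0) (metis r_eq r_into_rtrancl)
  qed
  moreover note ideal0_subset[OF P p \<psi>P] psp_ideal0[OF P p \<psi>P]
  ultimately show ?thesis
    by (intro exI[of _ T] exI[of _ r] exI[of _ sw]) auto
qed

text \<open>Every prime over the minors contains one of the primes \<open>ideal0\<close>, of which
  there are finitely many because the data (T, r, sw) range over a finite type. A minimal one among
  those inside \<open>P\<close> is minimal among all primes.\<close>

lemma ex_minimal_edge_prime:
  fixes P :: "('v::finite pvar, 'k::field) mp set"
  assumes E: "sym E" "E \<subseteq> W \<times> W" and P: "is_prime P" and EP: "\<And>u v. (u, v) \<in> E \<Longrightarrow> minor u v \<in> P"
  shows "\<exists>Q\<in>minimal_edge_primes E. Q \<subseteq> P"
proof -
  let ?I = "\<lambda>(T, r, sw). chart.ideal0 T r sw :: ('v pvar, 'k) mp set"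
  define M where "M = {Q \<in> range ?I. is_prime Q \<and> (\<forall>(u, v)\<in>E. minor u v \<in> Q)}"
  have ex: "\<exists>Q\<in>M. Q \<subseteq> P" if P: "is_prime P" and EP: "\<And>u v. (u, v) \<in> E \<Longrightarrow> minor u v \<in> P"
    for P :: "('v pvar, 'k) mp set"
  proof -
    obtain T r sw where *: "chart_on W T r"
      "\<forall>(u, v)\<in>E. minor u v \<in> (chart.ideal0 T r sw :: ('v pvar, 'k) mp set)"
      "chart.ideal0 T r sw \<subseteq> P"
      using ex_chart[OF E P EP] by blast
    then have "is_prime (chart.ideal0 T r sw :: ('v pvar, 'k) mp set)"
      by (intro chart.is_prime_ideal0) (simp add: chart_on_def)
    moreover have "chart.ideal0 T r sw \<in> range ?I"
      by (rule image_eqI[of _ _ "(T, r, sw)"]) simp_all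
    ultimately show ?thesis using * by (auto simp: M_def)
  qed
  have "finite M" by (simp add: M_def)
  then have "finite {Q \<in> M. Q \<subseteq> P}" by simp
  moreover have "{Q \<in> M. Q \<subseteq> P} \<noteq> {}" using ex[OF P EP] by blast
  ultimately obtain Q where Q: "Q \<in> M" "Q \<subseteq> P"
    and min: "\<And>Q'. Q' \<in> M \<Longrightarrow> Q' \<subseteq> P \<Longrightarrow> Q' \<subseteq> Q \<Longrightarrow> Q = Q'"
    using finite_has_minimal[of "{Q \<in> M. Q \<subseteq> P}"] by auto
  have "Q \<in> minimal_edge_primes E"
    unfolding minimal_edge_primes_def
  proof (intro CollectI conjI allI impI)
    fix Q' :: "('v pvar, 'k) mp set"
    assume Q': "is_prime Q'" "\<forall>(u, v)\<in>E. minor u v \<in> Q'" "Q' \<subseteq> Q"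
    then obtain Q'' where "Q'' \<in> M" "Q'' \<subseteq> Q'" using ex[of Q'] by auto
    with min[of Q''] Q Q' show "Q' = Q" by auto
  qed (use Q in \<open>auto simp: M_def\<close>)
  with Q show ?thesis by blast
qed

lemma minimal_edge_prime_chart:
  fixes P :: "('v::finite pvar, 'k::field) mp set"
  assumes E: "sym E" "E \<subseteq> W \<times> W" and P: "P \<in> minimal_edge_primes E"
  shows "\<exists>T r sw. chart_on W T r \<and> (\<forall>m. psp P m = {f. chart.\<Theta> T r sw f \<in> Filt (chart.w T r sw) m}) \<and>
     P = chart.ideal0 T r sw"
proof -
  have P': "is_prime P" "\<And>u v. (u, v) \<in> E \<Longrightarrow> minor u v \<in> P"
    using P by (auto simp: minimal_edge_primes_def)
  obtain T r sw where *: "chart_on W T r"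
    "\<forall>(u, v)\<in>E. minor u v \<in> (chart.ideal0 T r sw :: ('v pvar, 'k) mp set)"
    "chart.ideal0 T r sw \<subseteq> P"
    "chart.ideal0 T r sw = P \<longrightarrow> (\<forall>m. psp P m = {f. chart.\<Theta> T r sw f \<in> Filt (chart.w T r sw) m})"
    using ex_chart[OF E P'] by blast
  have "chart T r" using *(1) by (simp add: chart_on_def)
  then have "chart.ideal0 T r sw = P"
    using P *(2,3) chart.is_prime_ideal0[of T r sw] unfolding minimal_edge_primes_def by blast
  with * show ?thesis by blast
qed

subsection \<open>Symbolic powers under passage to an induced subgraph\<close>

definition edge_symbolic :: "('v \<times> 'v) set \<Rightarrow> nat \<Rightarrow> ('v pvar, 'k::field) mp set" where
  "edge_symbolic E m = (\<Inter>P\<in>minimal_edge_primes E. psp P m)"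

lemma minimal_edge_primeD: "P \<in> minimal_edge_primes E \<Longrightarrow> is_prime P"
  by (simp add: minimal_edge_primes_def)

text \<open>Each minimal prime has a chart on any \<open>W\<close> that contains the ends of the
  edges, so closure properties of the symbolic power can be tested chart by chart.\<close>

lemma edge_symbolic_closed:
  fixes f h :: "('v::finite pvar, 'k::field) mp"
  assumes E: "sym E" "E \<subseteq> W \<times> W" and f: "f \<in> edge_symbolic E m"
    and closed: "\<And>T r sw. chart_on W T r \<Longrightarrow> chart.\<Theta> T r sw f \<in> Filt (chart.w T r sw) m \<Longrightarrow>
      chart.\<Theta> T r sw h \<in> Filt (chart.w T r sw) m"
  shows "h \<in> edge_symbolic E m"
  unfolding edge_symbolic_def
proof
  fix P :: "('v pvar, 'k) mp set"
  assume P: "P \<in> minimal_edge_primes E"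
  obtain T r sw where *: "chart_on W T r" "\<forall>m. psp P m = {f. chart.\<Theta> T r sw f \<in> Filt (chart.w T r sw) m}"
    using minimal_edge_prime_chart[OF E P] by blast
  have "f \<in> psp P m" using f P by (auto simp: edge_symbolic_def)
  with * closed[OF *(1)] show "h \<in> psp P m" by auto
qed

lemma edge_symbolic_homogeneous:
  fixes f :: "('v::finite pvar, 'k::field) mp"
  assumes "sym E" "f \<in> edge_symbolic E m"
  shows "restr {t. mon_deg t = d} f \<in> edge_symbolic E m"
  by (rule edge_symbolic_closed[of E UNIV f])
    (use assms in \<open>auto simp: chart_on_def intro: chart.\<Theta>_restr\<close>)

lemma edge_symbolic_coeffs:
  fixes f :: "('v::finite pvar, 'k::field) mp"
  assumes "sym E" "E \<subseteq> W \<times> W" "f \<in> edge_symbolic E m"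
  shows "lookup (coeffs_in {z. vtx z \<notin> W} f) s \<in> edge_symbolic E m"
  by (rule edge_symbolic_closed[OF assms])
    (auto simp: chart_on_def chart.N_def intro!: chart.\<Theta>_coeffs)

lemma is_ideal_edge_symbolic:
  fixes E :: "('v::finite \<times> 'v) set"
  assumes "sym E"
  shows "is_ideal (edge_symbolic E m :: ('v pvar, 'k::field) mp set)"
proof -
  have "is_ideal (psp P m)" if P: "P \<in> minimal_edge_primes E" for P :: "('v pvar, 'k) mp set"
  proof -
    obtain T r sw where *: "chart_on UNIV T r"
      "\<forall>m. psp P m = {f. chart.\<Theta> T r sw f \<in> Filt (chart.w T r sw) m}"
      using minimal_edge_prime_chart[OF assms _ P, of UNIV] by auto
    then interpret chart T r sw by (simp add: chart_on_def)
    show ?thesis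
      using * by (auto simp: is_ideal_def rhom.zero[OF rhom_\<Theta>] rhom.add[OF rhom_\<Theta>]
          rhom.mult[OF rhom_\<Theta>] zero_in_Filt Filt_add Filt_mult_right)
  qed
  then show ?thesis by (auto simp: edge_symbolic_def is_ideal_def)
qed

text \<open>A minimal prime of the larger edge set is a prime over the smaller one, hence contains a
  minimal prime Q of it; the Taylor argument for Q and the chart of \<open>P\<close>
  concludes.\<close>

lemma edge_symbolic_mono:
  fixes E E' :: "('v::finite \<times> 'v) set"
  assumes E: "sym E" "sym E'" "E' \<subseteq> E"
  shows "(edge_symbolic E' m :: ('v pvar, 'k::field) mp set) \<subseteq> edge_symbolic E m"
proof
  fix f :: "('v pvar, 'k) mp"
  assume f: "f \<in> edge_symbolic E' m"
  show "f \<in> edge_symbolic E m"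
    unfolding edge_symbolic_def
  proof
    fix P :: "('v pvar, 'k) mp set"
    assume P: "P \<in> minimal_edge_primes E"
    obtain T r sw where *: "chart_on UNIV T r"
      "\<forall>m. psp P m = {f. chart.\<Theta> T r sw f \<in> Filt (chart.w T r sw) m}" "P = chart.ideal0 T r sw"
      using minimal_edge_prime_chart[OF E(1) _ P, of UNIV] by auto
    then interpret chart T r sw by (simp add: chart_on_def)
    obtain Q where Q: "Q \<in> minimal_edge_primes E'" "Q \<subseteq> P"
      using ex_minimal_edge_prime[OF E(2), of UNIV P] P E(3) by (fastforce simp: minimal_edge_primes_def)
    have "f \<in> psp Q m" using f Q(1) by (auto simp: edge_symbolic_def)
    then have "\<Theta> f \<in> Filt w m"
      by (rule psp_in_Filt[OF minimal_edge_primeD[OF Q(1)] _ rhom_\<Theta> \<Theta>_cst])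
        (use Q(2) *(3) in \<open>auto simp: ideal0_def\<close>)
    with * show "f \<in> psp P m" by simp
  qed
qed

text \<open>The preimage of \<open>P\<close> under \<rho> is a prime over all edges of
  \<open>E\<close>, since \<rho> kills every minor with an end outside \<open>W\<close>. A minimal
  prime Q below it is compared with \<open>P\<close> through the homomorphism \<Theta> after
  \<rho>.\<close>

lemma edge_symbolic_rho:
  fixes E E' :: "('v::finite \<times> 'v) set" and f :: "('v pvar, 'k::field) mp"
  assumes E: "sym E" and E': "E' = E \<inter> W \<times> W" and f: "f \<in> edge_symbolic E m"
  shows "rho {z. vtx z \<notin> W} f \<in> edge_symbolic E' m"
  unfolding edge_symbolic_def
proof
  let ?\<rho> = "rho {z. vtx z \<notin> W} :: ('v pvar, 'k) mp \<Rightarrow> _"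
  have sym: "sym E'" using E unfolding E' sym_def by blast
  fix P :: "('v pvar, 'k) mp set"
  assume P: "P \<in> minimal_edge_primes E'"
  obtain T r sw where *: "chart_on UNIV T r"
    "\<forall>m. psp P m = {f. chart.\<Theta> T r sw f \<in> Filt (chart.w T r sw) m}" "P = chart.ideal0 T r sw"
    using minimal_edge_prime_chart[OF sym _ P, of UNIV] by auto
  then interpret chart T r sw by (simp add: chart_on_def)
  let ?P = "{a. ?\<rho> a \<in> P}"
  have "is_prime P" using P by (rule minimal_edge_primeD)
  then have "is_prime ?P"
    by (auto simp: is_prime_def is_ideal_def rhom.zero[OF rhom_rho] rhom.one[OF rhom_rho]
        rhom.add[OF rhom_rho] rhom.mult[OF rhom_rho])
  moreover have "minor u v \<in> ?P" if "(u, v) \<in> E" for u v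
  proof (cases "u \<in> W \<and> v \<in> W")
    case True
    then have "minor u v \<in> P" using P that by (auto simp: minimal_edge_primes_def E')
    with True show ?thesis
      by (simp add: minor_def rhom.diff[OF rhom_rho] rhom.mult[OF rhom_rho] rho_vr)
  next
    case False
    then have "?\<rho> (minor u v) = 0"
      by (auto simp: minor_def rhom.diff[OF rhom_rho] rhom.mult[OF rhom_rho] rho_vr)
    with \<open>is_prime P\<close> show ?thesis by (simp add: is_prime_def is_ideal_def)
  qed
  ultimately obtain Q where Q: "Q \<in> minimal_edge_primes E" "Q \<subseteq> ?P"
    using ex_minimal_edge_prime[OF E, of UNIV ?P] by auto
  have "f \<in> psp Q m" using f Q(1) by (auto simp: edge_symbolic_def)
  then have "\<Theta> (?\<rho> f) \<in> Filt w m"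
    by (rule psp_in_Filt[OF minimal_edge_primeD[OF Q(1)] _ rhom_comp[OF rhom_\<Theta> rhom_rho]])
      (use Q(2) *(3) in \<open>auto simp: ideal0_def \<Theta>_cst rho_cst\<close>)
  with * show "?\<rho> f \<in> psp P m" by simp
qed

section \<open>Translation to the ring records of the statement\<close>

lemma ideal_iff: "ideal I ring_of_type_algebra \<longleftrightarrow> is_ideal (I :: 'a::comm_ring_1 set)"
proof
  assume "ideal I ring_of_type_algebra"
  then interpret ideal I "ring_of_type_algebra :: 'a ring" .
  have R: "\<zero>\<^bsub>ring_of_type_algebra\<^esub> = (0 :: 'a)" "a \<oplus>\<^bsub>ring_of_type_algebra\<^esub> b = a + b"
    "a \<otimes>\<^bsub>ring_of_type_algebra\<^esub> b = a * b" "a \<in> carrier ring_of_type_algebra" for a b :: 'a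
    by (simp_all add: ring_of_type_algebra_def)
  show "is_ideal I"
    unfolding is_ideal_def
    using additive_subgroup.zero_closed[OF is_additive_subgroup]
      additive_subgroup.a_closed[OF is_additive_subgroup] I_l_closed R by metis
next
  assume I: "is_ideal I"
  interpret cring "ring_of_type_algebra :: 'a ring" by (rule cring_from_type_algebra)
  show "ideal I ring_of_type_algebra"
  proof (rule idealI)
    show "subgroup I (add_monoid (ring_of_type_algebra :: 'a ring))"
    proof (rule add.subgroupI)
      fix a assume "a \<in> I"
      then have "- a \<in> I" by (rule is_ideal_uminus[OF I])
      moreover have "\<ominus>\<^bsub>ring_of_type_algebra\<^esub> a = - a"
        by (rule minus_equality) (simp_all add: ring_of_type_algebra_def)
      ultimately show "\<ominus>\<^bsub>ring_of_type_algebra\<^esub> a \<in> I" by simp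
    qed (use I in \<open>auto simp: is_ideal_def ring_of_type_algebra_def\<close>)
    have "a * x \<in> I" "x * a \<in> I" if "a \<in> I" for a x
      using I that unfolding is_ideal_def by (metis mult.commute)+
    then show "a \<otimes>\<^bsub>ring_of_type_algebra\<^esub> x \<in> I" "x \<otimes>\<^bsub>ring_of_type_algebra\<^esub> a \<in> I" if "a \<in> I" for a x
      using that by (simp_all add: ring_of_type_algebra_def)
  qed (rule ring_axioms)
qed

lemma primeideal_iff: "primeideal P ring_of_type_algebra \<longleftrightarrow> is_prime (P :: 'a::comm_ring_1 set)"
proof
  assume "primeideal P ring_of_type_algebra"
  then interpret primeideal P "ring_of_type_algebra :: 'a ring" .
  have I: "is_ideal P" using is_ideal ideal_iff by blast
  have "a \<in> P \<or> b \<in> P" if "a * b \<in> P" for a b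
    using I_prime[of a b] that by (simp add: ring_of_type_algebra_def)
  moreover have "1 \<notin> P"
  proof
    assume "1 \<in> P"
    then have "a \<in> P" for a using I unfolding is_ideal_def by (metis mult.right_neutral)
    then show False using I_notcarr by (auto simp: ring_of_type_algebra_def)
  qed
  ultimately show "is_prime P" using I by (simp add: is_prime_def)
next
  assume P: "is_prime P"
  show "primeideal P ring_of_type_algebra"
  proof (rule primeidealI)
    show "ideal P ring_of_type_algebra" using P by (simp add: ideal_iff is_prime_def)
    show "cring (ring_of_type_algebra :: 'a ring)" by (rule cring_from_type_algebra)
  qed (use P in \<open>auto simp: is_prime_def ring_of_type_algebra_def\<close>)
qed

lemma binomial_edge_ideal_subset_iff:
  assumes "is_ideal P"
  shows "binomial_edge_ideal H \<subseteq> P \<longleftrightarrow> (\<forall>(u, v)\<in>parcs H. minor u v \<in> P)"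
proof -
  have "binomial_edge_ideal H \<subseteq> P \<longleftrightarrow>
      {Var (Xvar u) * Var (Yvar v) - Var (Xvar v) * Var (Yvar u) |u v. (u, v) \<in> parcs H} \<subseteq> P"
    using assms unfolding binomial_edge_ideal_def genideal_def ideal_iff by blast
  then show ?thesis by (auto simp: minor_def Var_eq)
qed

lemma minimal_primes_binomial_edge_ideal:
  "minimal_primes mpoly_ring (binomial_edge_ideal H) = minimal_edge_primes (parcs H)"
proof -
  let ?A = "\<lambda>P :: ('a, 'b) mpoly set. is_prime P \<and> binomial_edge_ideal H \<subseteq> P"
  let ?B = "\<lambda>P :: ('a, 'b) mpoly set. is_prime P \<and> (\<forall>(u, v)\<in>parcs H. minor u v \<in> P)"
  have "?A P = ?B P" for P
    using binomial_edge_ideal_subset_iff[of P H] by (auto simp: is_prime_def)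
  then have AB: "?A = ?B" by (rule ext)
  have "minimal_primes mpoly_ring (binomial_edge_ideal H) = {P. ?A P \<and> (\<forall>Q. ?A Q \<longrightarrow> Q \<subseteq> P \<longrightarrow> Q = P)}"
    unfolding minimal_primes_def primeideal_iff by blast
  also have "\<dots> = {P. ?B P \<and> (\<forall>Q. ?B Q \<longrightarrow> Q \<subseteq> P \<longrightarrow> Q = P)}"
    using AB by metis
  also have "\<dots> = minimal_edge_primes (parcs H)"
    unfolding minimal_edge_primes_def by blast
  finally show ?thesis .
qed

lemma ideals_set_pow:
  "P [^]\<^bsub>ideals_set ring_of_type_algebra\<^esub> (m :: nat) = ipow P m"
  by (induction m) (simp_all add: nat_pow_def ideals_set_def ring_of_type_algebra_def)

lemma symbolic_power_binomial_edge_ideal: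
  "symbolic_power mpoly_ring (binomial_edge_ideal H) m = edge_symbolic (parcs H) m"
proof -
  have "prime_symbolic_power mpoly_ring P m = psp P m" for P :: "('a, 'b) mpoly set"
    unfolding prime_symbolic_power_def psp_def ideals_set_pow by (auto simp: ring_of_type_algebra_def)
  then show ?thesis
    by (simp add: symbolic_power_def edge_symbolic_def minimal_primes_binomial_edge_ideal)
      (simp add: ring_of_type_algebra_def)
qed

section \<open>Semilinear maps of graded free modules\<close>

text \<open>For empty \<open>Z\<close> this is linearity over S, so that one notion covers both
  directions of the comparison.\<close>

definition semilin :: "'v::finite pvar set \<Rightarrow> (('v, 'k::field) fvec \<Rightarrow> ('v, 'k) fvec) \<Rightarrow> bool" where
  "semilin Z f \<longleftrightarrow> (\<forall>x y. f (x + y) = f x + f y) \<and> (\<forall>a x. f (fscale a x) = fscale (rho Z a) (f x))"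

definition flin ::
  "'v::finite pvar set \<Rightarrow> (nat \<Rightarrow> ('v, 'k::field) fvec) \<Rightarrow> ('v, 'k) fvec \<Rightarrow> ('v, 'k) fvec" where
  "flin Z c w = (\<Sum>b\<in>keys w. fscale (rho Z (lookup w b)) (c b))"

lemma semilinD:
  assumes "semilin Z f"
  shows "f (x + y) = f x + f y" "f (fscale a x) = fscale (rho Z a) (f x)"
  using assms by (simp_all add: semilin_def)

lemma semilin_0: "semilin Z f \<Longrightarrow> f 0 = 0"
  using semilinD(1)[of Z f 0 0] by simp

lemma semilin_uminus: "semilin Z f \<Longrightarrow> f (- x) = - f x"
  using semilinD(1)[of Z f x "- x"] semilin_0[of Z f] by (simp add: eq_neg_iff_add_eq_0 add.commute)

lemma semilin_diff: "semilin Z f \<Longrightarrow> f (x - y) = f x - f y"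
  using semilinD(1)[of Z f x "- y"] semilin_uminus[of Z f y] by simp

lemma semilin_sum: "semilin Z f \<Longrightarrow> f (sum x A) = (\<Sum>i\<in>A. f (x i))"
  by (induction A rule: infinite_finite_induct) (simp_all add: semilin_0 semilinD)

lemma semilin_kscale: "semilin Z f \<Longrightarrow> f (kscale c x) = kscale c (f x)"
  by (simp add: kscale_def semilinD Const_eq rho_cst)

lemma semilin_comp_right: "semilin Z f \<Longrightarrow> semilin {} g \<Longrightarrow> semilin Z (\<lambda>w. f (g w))"
  by (simp add: semilin_def rho_empty)

lemma semilin_comp_left: "semilin Z f \<Longrightarrow> semilin {} g \<Longrightarrow> semilin Z (\<lambda>w. g (f w))"
  by (simp add: semilin_def rho_empty)

lemma semilin_minus: "semilin Z f \<Longrightarrow> semilin Z g \<Longrightarrow> semilin Z (\<lambda>w. f w - g w)"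
  by (simp add: semilin_def fmod.scale_right_diff_distrib)

lemma lookup_basis_vec: "lookup (basis_vec b) e = (if e = b then 1 else 0)"
  by (simp add: basis_vec_def lookup_single when_def)

lemma keys_basis_vec: "keys (basis_vec b :: ('v, 'k::field) fvec) = {b}"
  by (simp add: basis_vec_def)

lemma fvec_expand: "(\<Sum>b\<in>keys w. fscale (lookup w b) (basis_vec b)) = w"
  by (rule poly_mapping_eqI)
    (simp add: lookup_sum lookup_fscale lookup_basis_vec if_distrib[of "(*) _"] in_keys_iff cong: if_cong)

lemma semilin_expand: "semilin Z f \<Longrightarrow> f w = flin Z (\<lambda>b. f (basis_vec b)) w"
  by (subst fvec_expand[of w, symmetric]) (simp add: semilin_sum semilinD flin_def)

lemma semilin_ext:
  assumes "semilin Z f" "semilin Z g" "\<And>b. b \<in> B \<Longrightarrow> f (basis_vec b) = g (basis_vec b)"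
    and "w \<in> free_on B"
  shows "f w = g w"
  unfolding semilin_expand[OF assms(1), of w] semilin_expand[OF assms(2), of w] flin_def
  using assms(3,4) by (intro sum.cong refl) (auto simp: free_on_def)

lemma flin_superset:
  assumes "finite A" "keys w \<subseteq> A"
  shows "flin Z c w = (\<Sum>b\<in>A. fscale (rho Z (lookup w b)) (c b))"
  unfolding flin_def
  by (rule sum.mono_neutral_left) (use assms in \<open>auto simp: in_keys_iff rhom.zero[OF rhom_rho]\<close>)

lemma semilin_flin: "semilin Z (flin Z c)"
  unfolding semilin_def
proof (intro conjI allI)
  fix x y :: "('a, 'b) fvec" and a
  let ?A = "keys x \<union> keys y"
  have "keys (x + y) \<subseteq> ?A" by (rule keys_add)
  then show "flin Z c (x + y) = flin Z c x + flin Z c y"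
    by (simp add: flin_superset[of ?A] lookup_add rhom.add[OF rhom_rho] fmod.scale_left_distrib
        sum.distrib)
  have "keys (fscale a x) \<subseteq> keys x"
    by (auto simp: in_keys_iff lookup_fscale)
  then show "flin Z c (fscale a x) = fscale (rho Z a) (flin Z c x)"
    by (simp add: flin_superset[of "keys x"] lookup_fscale rhom.mult[OF rhom_rho]
        fmod.scale_sum_right)
qed

lemma flin_basis_vec: "flin Z c (basis_vec b) = c b"
  by (simp add: flin_def keys_basis_vec lookup_basis_vec rhom.one[OF rhom_rho])

lemma lookup_flin: "lookup (flin Z c w) e = (\<Sum>b\<in>keys w. rho Z (lookup w b) * lookup (c b) e)"
  by (simp add: flin_def lookup_sum lookup_fscale)

lemma free_on_0: "0 \<in> free_on B"
  by (simp add: free_on_def)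

lemma free_on_add: "x \<in> free_on B \<Longrightarrow> y \<in> free_on B \<Longrightarrow> x + y \<in> free_on B"
  using keys_add[of x y] by (auto simp: free_on_def)

lemma free_on_diff: "x \<in> free_on B \<Longrightarrow> y \<in> free_on B \<Longrightarrow> x - y \<in> free_on B"
  using keys_diff[of x y] by (auto simp: free_on_def)

lemma keys_fscale: "keys (fscale a x) \<subseteq> keys x"
  by (auto simp: in_keys_iff lookup_fscale)

lemma free_on_fscale: "x \<in> free_on B \<Longrightarrow> fscale a x \<in> free_on B"
  using keys_fscale[of a x] by (auto simp: free_on_def)

lemma free_on_sum: "(\<And>i. i \<in> A \<Longrightarrow> f i \<in> free_on B) \<Longrightarrow> sum f A \<in> free_on B"
  by (induction A rule: infinite_finite_induct) (auto simp: free_on_0 free_on_add)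

lemma basis_vec_free_on: "b \<in> B \<Longrightarrow> basis_vec b \<in> free_on B"
  by (simp add: free_on_def keys_basis_vec)

lemma flin_free_on:
  assumes "\<And>b. b \<in> B \<Longrightarrow> c b \<in> free_on B'" "w \<in> free_on B"
  shows "flin Z c w \<in> free_on B'"
  unfolding flin_def using assms
  by (intro free_on_sum free_on_fscale) (auto simp: free_on_def)

lemma max_times_add: "x \<in> max_times B \<Longrightarrow> y \<in> max_times B \<Longrightarrow> x + y \<in> max_times B"
  by (simp add: max_times_def free_on_add lookup_add)

lemma max_times_0: "0 \<in> max_times B"
  by (simp add: max_times_def free_on_0)

lemma max_times_kscale: "x \<in> max_times B \<Longrightarrow> kscale c x \<in> max_times B"
  by (simp add: max_times_def free_on_fscale kscale_def lookup_fscale rhom.mult[OF rhom_lookup_0])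

text \<open>Killing variables does not change constant terms, so coordinates without constant term
  stay so.\<close>

lemma max_times_flin:
  assumes "\<And>b. b \<in> B \<Longrightarrow> c b \<in> free_on B'" "w \<in> max_times B"
  shows "flin Z c w \<in> max_times B'"
proof -
  have "lookup (rho Z (lookup w b)) 0 = 0" for b
    using assms(2) by (simp add: max_times_def lookup_rho)
  then show ?thesis
    using flin_free_on[of B c B' w Z, OF assms(1)] assms(2)
    by (simp add: max_times_def lookup_flin lookup_sum rhom.mult[OF rhom_lookup_0])
qed

subsection \<open>Homogeneous parts\<close>

lemma mon_deg_add: "mon_deg (s + t) = mon_deg s + mon_deg (t :: 'v::finite pvar \<Rightarrow>\<^sub>0 nat)"
  by (simp add: mon_deg_eq_wt wt_add)

lemma fhomogeneous_0: "fhomogeneous s j 0"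
  by (simp add: fhomogeneous_def)

lemma fhomogeneous_add:
  assumes "fhomogeneous s j x" "fhomogeneous s j y"
  shows "fhomogeneous s j (x + y)"
  unfolding fhomogeneous_def
proof (intro ballI)
  fix b t assume "t \<in> keys (lookup (x + y) b)"
  then have "t \<in> keys (lookup x b) \<or> t \<in> keys (lookup y b)"
    using keys_add[of "lookup x b" "lookup y b"] by (auto simp: lookup_add)
  then show "mon_deg t + s b = j"
    using assms unfolding fhomogeneous_def by (metis in_keys_iff keys_zero empty_iff)
qed

lemma fhomogeneous_sum:
  "(\<And>i. i \<in> A \<Longrightarrow> fhomogeneous s j (f i)) \<Longrightarrow> fhomogeneous s j (sum f A)"
  by (induction A rule: infinite_finite_induct) (auto simp: fhomogeneous_0 fhomogeneous_add)

lemma fhomogeneous_fscale: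
  fixes w :: "('v::finite, 'k::field) fvec"
  assumes "\<And>t. t \<in> keys p \<Longrightarrow> mon_deg t + k = j" "fhomogeneous s k w"
  shows "fhomogeneous s j (fscale p w)"
  unfolding fhomogeneous_def
proof (intro ballI)
  fix b t assume "t \<in> keys (lookup (fscale p w) b)"
  then obtain t1 t2 where t: "t1 \<in> keys p" "t2 \<in> keys (lookup w b)" "t = t1 + t2"
    using keys_mult[of p "lookup w b"] by (auto simp: lookup_fscale)
  then have "b \<in> keys w" by (auto simp: in_keys_iff)
  then have "mon_deg t2 + s b = k" using assms(2) t by (auto simp: fhomogeneous_def)
  with assms(1)[OF t(1)] show "mon_deg t + s b = j" by (simp add: t mon_deg_add)
qed

lemma fhomogeneous_uminus: "fhomogeneous s j x \<Longrightarrow> fhomogeneous s j (- x)"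
  by (simp add: fhomogeneous_def)

lemma fhomogeneous_diff: "fhomogeneous s j x \<Longrightarrow> fhomogeneous s j y \<Longrightarrow> fhomogeneous s j (x - y)"
  using fhomogeneous_add[of s j x "- y"] fhomogeneous_uminus[of s j y] by simp

lemma fhomogeneous_kscale:
  fixes w :: "('v::finite, 'k::field) fvec"
  shows "fhomogeneous s j w \<Longrightarrow> fhomogeneous s j (kscale c w)"
  unfolding kscale_def
  by (rule fhomogeneous_fscale) (auto simp: Const_def mon_deg_def split: if_splits)

lemma fhomogeneous_flin:
  fixes c :: "nat \<Rightarrow> ('v::finite, 'k::field) fvec"
  assumes "\<And>b. b \<in> B \<Longrightarrow> fhomogeneous s' (s b) (c b)" "w \<in> free_on B" "fhomogeneous s j w"
  shows "fhomogeneous s' j (flin Z c w)"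
  unfolding flin_def
proof (intro fhomogeneous_sum fhomogeneous_fscale)
  fix b assume b: "b \<in> keys w"
  then show "fhomogeneous s' (s b) (c b)" using assms by (auto simp: free_on_def)
  fix t assume "t \<in> keys (rho Z (lookup w b))"
  then show "mon_deg t + s b = j" using assms(3) b by (auto simp: keys_rho fhomogeneous_def)
qed

text \<open>The cut depends on the degree of the basis vector, hence \<open>mapp\<close>; the
  condition is additive in order to avoid truncated subtraction.\<close>

definition hpart :: "(nat \<Rightarrow> nat) \<Rightarrow> nat \<Rightarrow> ('v::finite, 'k::field) fvec \<Rightarrow> ('v, 'k) fvec" where
  "hpart s j w = Poly_Mapping.mapp (\<lambda>b. restr {t. mon_deg t + s b = j}) w"

lemma lookup_hpart: "lookup (hpart s j w) b = restr {t. mon_deg t + s b = j} (lookup w b)"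
  by (simp add: hpart_def lookup_mapp when_def in_keys_iff restr_def)

lemma hpart_free_on: "w \<in> free_on B \<Longrightarrow> hpart s j w \<in> free_on B"
  using keys_mapp_subset[of "\<lambda>b. restr {t. mon_deg t + s b = j}" w]
  by (auto simp: hpart_def free_on_def)

lemma fhomogeneous_hpart: "fhomogeneous s j (hpart s j w)"
  by (simp add: fhomogeneous_def lookup_hpart keys_restr)

lemma hpart_add: "hpart s j (x + y) = hpart s j x + hpart s j y"
  by (rule poly_mapping_eqI) (simp add: lookup_hpart lookup_add restr_add)

lemma hpart_0: "hpart s j 0 = 0"
  by (rule poly_mapping_eqI) (simp add: lookup_hpart restr_def)

lemma hpart_sum: "hpart s j (sum f A) = (\<Sum>i\<in>A. hpart s j (f i))"
  by (induction A rule: infinite_finite_induct) (simp_all add: hpart_0 hpart_add)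

lemma hpart_id: "fhomogeneous s j w \<Longrightarrow> hpart s j w = w"
proof (rule poly_mapping_eqI)
  fix b assume w: "fhomogeneous s j w"
  show "lookup (hpart s j w) b = lookup w b"
    unfolding lookup_hpart
  proof (rule restr_id)
    show "keys (lookup w b) \<subseteq> {t. mon_deg t + s b = j}"
    proof (cases "b \<in> keys w")
      case False
      then show ?thesis by (simp add: in_keys_iff)
    qed (use w in \<open>auto simp: fhomogeneous_def\<close>)
  qed
qed

lemma hpart_other: "fhomogeneous s k w \<Longrightarrow> k \<noteq> j \<Longrightarrow> hpart s j w = 0"
proof (rule poly_mapping_eqI)
  fix b assume w: "fhomogeneous s k w" "k \<noteq> j"
  have "keys (lookup w b) \<inter> {t. mon_deg t + s b = j} = {}"
  proof (cases "b \<in> keys w")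
    case False
    then show ?thesis by (simp add: in_keys_iff)
  qed (use w in \<open>auto simp: fhomogeneous_def\<close>)
  then show "lookup (hpart s j w) b = lookup 0 b"
    unfolding lookup_hpart by (simp add: restr_empty)
qed

lemma hpart_fscale:
  fixes w :: "('v::finite, 'k::field) fvec"
  assumes "fhomogeneous s k w"
  shows "hpart s j (fscale p w) = fscale (restr {t. mon_deg t + k = j} p) w"
proof (induction p rule: poly_mapping_add_induct)
  case (single t x)
  have "fhomogeneous s (mon_deg t + k) (fscale (single t x) w)"
    by (rule fhomogeneous_fscale[OF _ assms]) (simp split: if_splits)
  then show ?case
    by (cases "mon_deg t + k = j") (simp_all add: restr_single hpart_id hpart_other)
next
  case (add p q)
  then show ?case by (simp add: fmod.scale_left_distrib hpart_add restr_add)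
qed

lemma hpart_graded:
  fixes f :: "('v::finite, 'k::field) fvec \<Rightarrow> ('v, 'k) fvec"
  assumes f: "semilin {} f" and w: "w \<in> free_on B"
    and hom: "\<And>b. b \<in> B \<Longrightarrow> fhomogeneous s' (s b) (f (basis_vec b))"
  shows "hpart s' j (f w) = f (hpart s j w)"
proof -
  have keys: "keys (hpart s j w) \<subseteq> keys w"
    unfolding hpart_def by (rule keys_mapp_subset)
  have "hpart s' j (f w) = (\<Sum>b\<in>keys w. hpart s' j (fscale (lookup w b) (f (basis_vec b))))"
    by (subst semilin_expand[OF f]) (simp add: flin_def rho_empty hpart_sum)
  also have "\<dots> = (\<Sum>b\<in>keys w. fscale (lookup (hpart s j w) b) (f (basis_vec b)))"
    using w by (intro sum.cong refl)
      (auto simp: lookup_hpart free_on_def intro!: hpart_fscale hom)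
  also have "\<dots> = flin {} (\<lambda>b. f (basis_vec b)) (hpart s j w)"
    by (simp add: flin_superset[OF finite_keys keys] rho_empty)
  also have "\<dots> = f (hpart s j w)"
    by (rule semilin_expand[OF f, symmetric])
  finally show ?thesis .
qed

section \<open>Comparison of resolutions\<close>

text \<open>\<open>aug\<close> takes values in S and not in the quotient, so in degree 0 a cycle is
  an element sent into \<open>V\<close>.\<close>

definition cyc :: "('v, 'k::field) free_complex \<Rightarrow> ('v, 'k) mpoly set \<Rightarrow> nat \<Rightarrow> ('v, 'k) fvec set" where
  "cyc F V i = {w \<in> free_on (gens F i). case i of 0 \<Rightarrow> aug F w \<in> V | Suc l \<Rightarrow> bdry F l w = 0}"

definition homogeneous_ideal :: "('v::finite, 'k::field) mpoly set \<Rightarrow> bool" where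
  "homogeneous_ideal I \<longleftrightarrow> is_ideal I \<and> (\<forall>f\<in>I. \<forall>d. restr {t. mon_deg t = d} f \<in> I)"

locale resolution =
  fixes U V :: "('v::finite, 'k::field) mpoly set" and F :: "('v, 'k) free_complex"
  assumes res: "graded_free_resolution U V F" and V: "homogeneous_ideal V"
begin

lemma aug_module_hom: "module_hom fscale (*) (aug F)"
  and bdry_module_hom: "module_hom fscale fscale (bdry F i)"
  using res by (simp_all add: graded_free_resolution_def)

lemmas aug_add = module_hom.add[OF aug_module_hom]
  and aug_fscale = module_hom.scale[OF aug_module_hom]

lemma aug_0: "aug F 0 = 0"
  using aug_fscale[of 0 0] by simp

lemma aug_diff: "aug F (x - y) = aug F x - aug F y"
  using aug_add[of "x - y" y] by simp

lemma bdry_semilin: "semilin {} (bdry F i)"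
  by (simp add: semilin_def module_hom.add[OF bdry_module_hom] module_hom.scale[OF bdry_module_hom] rho_empty)

lemma bdry_hom: "b \<in> gens F (Suc i) \<Longrightarrow> fhomogeneous (shift F i) (shift F (Suc i) b) (bdry F i (basis_vec b))"
  and aug_hom: "b \<in> gens F 0 \<Longrightarrow> homogeneous (shift F 0 b) (aug F (basis_vec b))"
  using res by (simp_all add: graded_free_resolution_def)

lemma V_ideal: "is_ideal V"
  using V by (simp add: homogeneous_ideal_def)

lemma U_eq: "{aug F w + v |w v. w \<in> free_on (gens F 0) \<and> v \<in> V} = U"
  using res by (simp add: graded_free_resolution_def)

lemma aug_in: "w \<in> free_on (gens F 0) \<Longrightarrow> aug F w \<in> U"
proof -
  assume "w \<in> free_on (gens F 0)"
  moreover have "0 \<in> V" using V_ideal by (simp add: is_ideal_def)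
  ultimately have "aug F w + 0 \<in> {aug F w + v |w v. w \<in> free_on (gens F 0) \<and> v \<in> V}" by blast
  then show ?thesis unfolding U_eq by simp
qed

lemma aug_onto: "u \<in> U \<Longrightarrow> \<exists>w\<in>free_on (gens F 0). u - aug F w \<in> V"
proof -
  assume "u \<in> U"
  then have "u \<in> {aug F w + v |w v. w \<in> free_on (gens F 0) \<and> v \<in> V}"
    unfolding U_eq .
  then show ?thesis by force
qed

lemma exact: "bdry F i ` free_on (gens F (Suc i)) = cyc F V i"
  using res by (cases i) (simp_all add: graded_free_resolution_def cyc_def)

lemma bdry_cyc: "w \<in> free_on (gens F (Suc i)) \<Longrightarrow> bdry F i w \<in> cyc F V i"
  using exact by blast

lemma bdry_free: "w \<in> free_on (gens F (Suc i)) \<Longrightarrow> bdry F i w \<in> free_on (gens F i)"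
  using bdry_cyc by (auto simp: cyc_def)

lemma bdry_max_times:
  assumes "w \<in> max_times (gens F (Suc i))"
  shows "bdry F i w \<in> max_times (gens F i)"
  unfolding semilin_expand[OF bdry_semilin, of i w]
  by (rule max_times_flin[OF _ assms]) (simp add: bdry_free basis_vec_free_on)

text \<open>As the boundary is graded, any preimage can be replaced by its component of degree
  \<open>j\<close>.\<close>

lemma homogeneous_preimage:
  assumes "w \<in> cyc F V i" "fhomogeneous (shift F i) j w"
  shows "\<exists>u\<in>free_on (gens F (Suc i)). bdry F i u = w \<and> fhomogeneous (shift F (Suc i)) j u"
proof -
  obtain u where u: "u \<in> free_on (gens F (Suc i))" "bdry F i u = w"
    using assms(1) exact by (metis imageE)
  have "bdry F i (hpart (shift F (Suc i)) j u) = hpart (shift F i) j w"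
    using hpart_graded[OF bdry_semilin u(1) bdry_hom, of i j] u(2) by simp
  also have "\<dots> = w" by (rule hpart_id[OF assms(2)])
  finally show ?thesis
    using hpart_free_on[OF u(1)] fhomogeneous_hpart by blast
qed

lemma homogeneous_lift:
  assumes "u \<in> U" "homogeneous j u"
  shows "\<exists>w\<in>free_on (gens F 0). u - aug F w \<in> V \<and> fhomogeneous (shift F 0) j w"
proof -
  obtain w where w: "w \<in> free_on (gens F 0)" "u - aug F w \<in> V"
    using aug_onto[OF assms(1)] by blast
  \<comment> \<open>S is viewed as the free module on the index 0 in degree 0, so that
    \<open>hpart_graded\<close> applies to the augmentation.\<close>
  define f where "f w = single (0 :: nat) (aug F w)" for w
  have f: "semilin {} f"
    by (auto simp: semilin_def f_def aug_add aug_fscale rho_empty single_add lookup_fscale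
        lookup_single when_def intro!: poly_mapping_eqI)
  have "hpart (\<lambda>_. 0) j (f w) = f (hpart (shift F 0) j w)"
    by (rule hpart_graded[OF f w(1)])
      (use aug_hom in \<open>auto simp: f_def fhomogeneous_def homogeneous_def lookup_single when_def\<close>)
  from arg_cong[OF this, of "\<lambda>x. lookup x 0"]
  have "restr {t. mon_deg t = j} (aug F w) = aug F (hpart (shift F 0) j w)"
    by (simp add: lookup_hpart f_def)
  moreover have "restr {t. mon_deg t = j} u = u"
    using assms(2) by (intro restr_id) (auto simp: homogeneous_def)
  moreover have "restr {t. mon_deg t = j} (u - aug F w) =
      restr {t. mon_deg t = j} u - restr {t. mon_deg t = j} (aug F w)"
    by (rule poly_mapping_eqI) (simp add: lookup_restr lookup_minus)
  moreover have "restr {t. mon_deg t = j} (u - aug F w) \<in> V"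
    using V w(2) by (simp add: homogeneous_ideal_def)
  ultimately show ?thesis
    using hpart_free_on[OF w(1)] fhomogeneous_hpart by metis
qed

lemma aug_expand: "aug F w = (\<Sum>b\<in>keys w. lookup w b * aug F (basis_vec b))"
proof -
  have "aug F (sum f A) = (\<Sum>b\<in>A. aug F (f b))" for f :: "nat \<Rightarrow> _" and A
    by (induction A rule: infinite_finite_induct) (simp_all add: aug_0 aug_add)
  then show ?thesis
    by (subst fvec_expand[of w, symmetric]) (simp add: aug_fscale)
qed

lemma solve:
  assumes R: "semilin Z R" "\<And>b. b \<in> B \<Longrightarrow> R (basis_vec b) \<in> cyc F V i"
  obtains h where "\<And>b. b \<in> B \<Longrightarrow> h b \<in> free_on (gens F (Suc i))"
    "\<And>w. w \<in> free_on B \<Longrightarrow> bdry F i (flin Z h w) = R w"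
proof -
  have "\<forall>b\<in>B. \<exists>u\<in>free_on (gens F (Suc i)). bdry F i u = R (basis_vec b)"
    using R(2) exact by (metis imageE)
  then obtain h where h: "\<And>b. b \<in> B \<Longrightarrow> h b \<in> free_on (gens F (Suc i)) \<and> bdry F i (h b) = R (basis_vec b)"
    by metis
  have "bdry F i (flin Z h w) = R w" if "w \<in> free_on B" for w
    by (rule semilin_ext[OF semilin_comp_left[OF semilin_flin bdry_semilin] R(1) _ that])
      (simp add: flin_basis_vec h)
  with h that show ?thesis by blast
qed

lemma solve_homogeneous:
  assumes R: "semilin Z R" "\<And>b. b \<in> B \<Longrightarrow> R (basis_vec b) \<in> cyc F V i"
    "\<And>b. b \<in> B \<Longrightarrow> fhomogeneous (shift F i) (s b) (R (basis_vec b))"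
  obtains h where "\<And>b. b \<in> B \<Longrightarrow> h b \<in> free_on (gens F (Suc i))"
    "\<And>b. b \<in> B \<Longrightarrow> fhomogeneous (shift F (Suc i)) (s b) (h b)"
    "\<And>w. w \<in> free_on B \<Longrightarrow> bdry F i (flin Z h w) = R w"
proof -
  have "\<forall>b\<in>B. \<exists>u. u \<in> free_on (gens F (Suc i)) \<and> bdry F i u = R (basis_vec b) \<and>
      fhomogeneous (shift F (Suc i)) (s b) u"
    using homogeneous_preimage[OF R(2,3)] by blast
  then obtain h where h: "\<forall>b\<in>B. h b \<in> free_on (gens F (Suc i)) \<and> bdry F i (h b) = R (basis_vec b) \<and>
      fhomogeneous (shift F (Suc i)) (s b) (h b)"
    by metis
  have "bdry F i (flin Z h w) = R w" if "w \<in> free_on B" for w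
    by (rule semilin_ext[OF semilin_comp_left[OF semilin_flin bdry_semilin] R(1) _ that])
      (simp add: flin_basis_vec h)
  with h that show ?thesis by blast
qed

text \<open>The usual induction, for semilinear maps. Degrees are not tracked, since
  \<open>tor_boundaries\<close> asks for an arbitrary element \<open>u\<close>.\<close>

lemma null_homotopy:
  assumes \<theta>: "\<And>i. semilin Z (\<theta> i)" "\<And>i w. w \<in> free_on (gens F i) \<Longrightarrow> \<theta> i w \<in> free_on (gens F i)"
    and chain: "\<And>i w. w \<in> free_on (gens F (Suc i)) \<Longrightarrow> bdry F i (\<theta> (Suc i) w) = \<theta> i (bdry F i w)"
    and base: "\<And>w. w \<in> free_on (gens F 0) \<Longrightarrow> aug F (\<theta> 0 w) \<in> V"
  obtains h where "\<And>i b. b \<in> gens F i \<Longrightarrow> h i b \<in> free_on (gens F (Suc i))"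
    "\<And>w. w \<in> free_on (gens F 0) \<Longrightarrow> \<theta> 0 w = bdry F 0 (flin Z (h 0) w)"
    "\<And>i w. w \<in> free_on (gens F (Suc i)) \<Longrightarrow>
      \<theta> (Suc i) w = bdry F (Suc i) (flin Z (h (Suc i)) w) + flin Z (h i) (bdry F i w)"
proof -
  define P where "P i h \<longleftrightarrow> (\<forall>b\<in>gens F i. h b \<in> free_on (gens F (Suc i))) \<and>
    (\<forall>x\<in>cyc F V i. bdry F i (flin Z h x) = \<theta> i x) \<and>
    (i = 0 \<longrightarrow> (\<forall>w\<in>free_on (gens F 0). bdry F 0 (flin Z h w) = \<theta> 0 w))" for i h
  \<comment> \<open>R is what the next homotopy component has to bound; the clause of P about cycles
    is what makes it a cycle.\<close>
  define R where "R i h w = \<theta> (Suc i) w - flin Z h (bdry F i w)" for i h w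
  define Q where "Q i h h' \<longleftrightarrow>
    (\<forall>w\<in>free_on (gens F (Suc i)). bdry F (Suc i) (flin Z h' w) = R i h w)" for i h h'
  have "\<exists>h. \<forall>i. P i (h i) \<and> Q i (h i) (h (Suc i))"
  proof (rule dependent_nat_choice)
    have "\<theta> 0 (basis_vec b) \<in> cyc F V 0" if "b \<in> gens F 0" for b
      using that \<theta>(2) base by (simp add: cyc_def basis_vec_free_on)
    from solve[OF \<theta>(1)[of 0] this] obtain h where
      "\<And>b. b \<in> gens F 0 \<Longrightarrow> h b \<in> free_on (gens F (Suc 0))"
      "\<And>w. w \<in> free_on (gens F 0) \<Longrightarrow> bdry F 0 (flin Z h w) = \<theta> 0 w" by blast
    then show "\<exists>h. P 0 h" unfolding P_def by (auto simp: cyc_def)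
  next
    fix h i assume h: "P i h"
    have R: "semilin Z (R i h)"
      unfolding R_def[abs_def]
      by (rule semilin_minus[OF \<theta>(1) semilin_comp_right[OF semilin_flin bdry_semilin]])
    have "R i h w \<in> cyc F V (Suc i)" if w: "w \<in> free_on (gens F (Suc i))" for w
    proof -
      have "flin Z h (bdry F i w) \<in> free_on (gens F (Suc i))"
        using h by (intro flin_free_on[OF _ bdry_free[OF w]]) (simp add: P_def)
      moreover have "bdry F i (flin Z h (bdry F i w)) = \<theta> i (bdry F i w)"
        using h bdry_cyc[OF w] by (simp add: P_def)
      ultimately show ?thesis
        using w \<theta>(2)[OF w] chain[OF w]
        by (simp add: cyc_def R_def free_on_diff semilin_diff[OF bdry_semilin])
    qed
    then have "R i h (basis_vec b) \<in> cyc F V (Suc i)" if "b \<in> gens F (Suc i)" for b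
      using that by (simp add: basis_vec_free_on)
    from solve[OF R this] obtain h' where h':
      "\<And>b. b \<in> gens F (Suc i) \<Longrightarrow> h' b \<in> free_on (gens F (Suc (Suc i)))"
      "\<And>w. w \<in> free_on (gens F (Suc i)) \<Longrightarrow> bdry F (Suc i) (flin Z h' w) = R i h w" by blast
    have "R i h x = \<theta> (Suc i) x" if "x \<in> cyc F V (Suc i)" for x
      using that by (simp add: R_def cyc_def semilin_0[OF semilin_flin])
    with h' have "P (Suc i) h'" unfolding P_def by (auto simp: cyc_def)
    with h' show "\<exists>h'. P (Suc i) h' \<and> Q i h h'" unfolding Q_def by blast
  qed
  then obtain h where h: "\<And>i. P i (h i)" "\<And>i. Q i (h i) (h (Suc i))" by blast
  show ?thesis
  proof
    show "h i b \<in> free_on (gens F (Suc i))" if "b \<in> gens F i" for i b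
      using h(1)[of i] that by (simp add: P_def)
    show "\<theta> 0 w = bdry F 0 (flin Z (h 0) w)" if "w \<in> free_on (gens F 0)" for w
      using h(1)[of 0] that by (simp add: P_def)
    show "\<theta> (Suc i) w = bdry F (Suc i) (flin Z (h (Suc i)) w) + flin Z (h i) (bdry F i w)"
      if "w \<in> free_on (gens F (Suc i))" for i w
      using h(2)[of i] that by (simp add: Q_def R_def)
  qed
qed

end

text \<open>Lifts the map induced by \<open>rho Z\<close> to resolutions; with empty
  \<open>Z\<close> this is the inclusion. The induction carries along that cycles go to cycles,
  which makes the next lifting problem solvable.\<close>

lemma chain_lift:
  assumes F: "resolution U V F" and F': "resolution U' V' F'"
    and U: "rho Z ` U \<subseteq> U'" and V: "rho Z ` V \<subseteq> V'"
  obtains c where "\<And>i b. b \<in> gens F i \<Longrightarrow> c i b \<in> free_on (gens F' i)"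
    "\<And>i b. b \<in> gens F i \<Longrightarrow> fhomogeneous (shift F' i) (shift F i b) (c i b)"
    "\<And>w. w \<in> free_on (gens F 0) \<Longrightarrow> aug F' (flin Z (c 0) w) - rho Z (aug F w) \<in> V'"
    "\<And>i w. w \<in> free_on (gens F (Suc i)) \<Longrightarrow>
      bdry F' i (flin Z (c (Suc i)) w) = flin Z (c i) (bdry F i w)"
proof -
  interpret F: resolution U V F by (rule F)
  interpret F': resolution U' V' F' by (rule F')
  define P where "P i c \<longleftrightarrow> (\<forall>b\<in>gens F i. c b \<in> free_on (gens F' i) \<and>
      fhomogeneous (shift F' i) (shift F i b) (c b)) \<and>
    (\<forall>x\<in>cyc F V i. flin Z c x \<in> cyc F' V' i) \<and>
    (i = 0 \<longrightarrow> (\<forall>w\<in>free_on (gens F 0). aug F' (flin Z c w) - rho Z (aug F w) \<in> V'))" for i c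
  define Q where "Q i c c' \<longleftrightarrow> (\<forall>w\<in>free_on (gens F (Suc i)).
    bdry F' i (flin Z c' w) = flin Z c (bdry F i w))" for i c c'
  have "\<exists>c. \<forall>i. P i (c i) \<and> Q i (c i) (c (Suc i))"
  proof (rule dependent_nat_choice)
    have "\<exists>w. w \<in> free_on (gens F' 0) \<and> rho Z (aug F (basis_vec b)) - aug F' w \<in> V' \<and>
        fhomogeneous (shift F' 0) (shift F 0 b) w" if b: "b \<in> gens F 0" for b
    proof -
      have "rho Z (aug F (basis_vec b)) \<in> U'"
        using F.aug_in[OF basis_vec_free_on[OF b]] U by blast
      moreover have "homogeneous (shift F 0 b) (rho Z (aug F (basis_vec b)))"
        using F.aug_hom[OF b] by (auto simp: homogeneous_def keys_rho)
      ultimately show ?thesis using F'.homogeneous_lift by blast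
    qed
    then obtain c where c: "\<And>b. b \<in> gens F 0 \<Longrightarrow> c b \<in> free_on (gens F' 0) \<and>
        rho Z (aug F (basis_vec b)) - aug F' (c b) \<in> V' \<and> fhomogeneous (shift F' 0) (shift F 0 b) (c b)"
      by metis
    have aug: "aug F' (flin Z c w) - rho Z (aug F w) \<in> V'" if w: "w \<in> free_on (gens F 0)" for w
    proof -
      have sum: "aug F' (sum f A) = (\<Sum>b\<in>A. aug F' (f b))" for f :: "nat \<Rightarrow> _" and A
        by (induction A rule: infinite_finite_induct) (simp_all add: F'.aug_0 F'.aug_add)
      \<comment> \<open>By semilinearity the error at \<open>w\<close> is a combination of the
        errors at basis vectors.\<close>
      have "aug F' (flin Z c w) - rho Z (aug F w) =
          (\<Sum>b\<in>keys w. - rho Z (lookup w b) * (rho Z (aug F (basis_vec b)) - aug F' (c b)))"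
        by (subst F.aug_expand) (simp add: flin_def sum F'.aug_fscale rhom.sum[OF rhom_rho]
            rhom.mult[OF rhom_rho] algebra_simps flip: sum_subtractf)
      also have "\<dots> \<in> V'"
      proof (rule is_ideal_sum[OF F'.V_ideal])
        fix b assume "b \<in> keys w"
        then have "b \<in> gens F 0" using w by (auto simp: free_on_def)
        with c F'.V_ideal show "- rho Z (lookup w b) * (rho Z (aug F (basis_vec b)) - aug F' (c b)) \<in> V'"
          unfolding is_ideal_def by blast
      qed
      finally show ?thesis .
    qed
    have "flin Z c x \<in> cyc F' V' 0" if x: "x \<in> cyc F V 0" for x
    proof -
      have "x \<in> free_on (gens F 0)" "rho Z (aug F x) \<in> V'"
        using x V by (auto simp: cyc_def)
      moreover from this have "(aug F' (flin Z c x) - rho Z (aug F x)) + rho Z (aug F x) \<in> V'"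
        using F'.V_ideal aug unfolding is_ideal_def by blast
      moreover have "flin Z c x \<in> free_on (gens F' 0)"
        using c \<open>x \<in> free_on (gens F 0)\<close> by (intro flin_free_on) auto
      ultimately show ?thesis by (simp add: cyc_def)
    qed
    then show "\<exists>c. P 0 c" unfolding P_def using c aug by blast
  next
    fix c i assume c: "P i c"
    let ?R = "\<lambda>w. flin Z c (bdry F i w)"
    have R: "semilin Z ?R" by (rule semilin_comp_right[OF semilin_flin F.bdry_semilin])
    have R1: "?R (basis_vec b) \<in> cyc F' V' i" if "b \<in> gens F (Suc i)" for b
      using F.bdry_cyc[OF basis_vec_free_on[OF that]] c by (simp add: P_def)
    have R2: "fhomogeneous (shift F' i) (shift F (Suc i) b) (?R (basis_vec b))" if b: "b \<in> gens F (Suc i)" for b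
      by (rule fhomogeneous_flin[OF _ F.bdry_free[OF basis_vec_free_on[OF b]] F.bdry_hom[OF b]])
        (use c in \<open>simp add: P_def\<close>)
    obtain c' where c': "\<And>b. b \<in> gens F (Suc i) \<Longrightarrow> c' b \<in> free_on (gens F' (Suc i))"
      "\<And>b. b \<in> gens F (Suc i) \<Longrightarrow> fhomogeneous (shift F' (Suc i)) (shift F (Suc i) b) (c' b)"
      "\<And>w. w \<in> free_on (gens F (Suc i)) \<Longrightarrow> bdry F' i (flin Z c' w) = ?R w"
      using F'.solve_homogeneous[OF R R1 R2] by blast
    have "flin Z c' x \<in> cyc F' V' (Suc i)" if x: "x \<in> cyc F V (Suc i)" for x
      using c'(3)[of x] x flin_free_on[of "gens F (Suc i)" c', OF c'(1), of x Z]
      by (simp add: cyc_def semilin_0[OF semilin_flin])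
    with c' show "\<exists>c'. P (Suc i) c' \<and> Q i c c'" unfolding P_def Q_def by blast
  qed
  then obtain c where c: "\<And>i. P i (c i)" "\<And>i. Q i (c i) (c (Suc i))" by blast
  show ?thesis
    by (rule that[of c]) (use c in \<open>auto simp: P_def Q_def\<close>)
qed

text \<open>The matrices of the augmentation and of the boundaries have entries in the polynomial
  ring on the variables outside \<open>Z\<close>.\<close>

definition rational :: "'v::finite pvar set \<Rightarrow> ('v, 'k::field) free_complex \<Rightarrow> bool" where
  "rational Z F \<longleftrightarrow> (\<forall>b\<in>gens F 0. rho Z (aug F (basis_vec b)) = aug F (basis_vec b)) \<and>
     (\<forall>i. \<forall>b\<in>gens F (Suc i). flin Z basis_vec (bdry F i (basis_vec b)) = bdry F i (basis_vec b))"

text \<open>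
  Over a \<open>Z\<close>-rational resolution the endomorphism \<open>rho Z\<close> of the module lifts to its application to
  coordinates, which is the identity on \<open>Tor\<close>.
\<close>

lemma tor_retract:
  assumes F: "resolution U V F" and F': "resolution U' V' F'" and rat: "rational Z F"
    and U: "U \<subseteq> U'" "rho Z ` U' \<subseteq> U" and V: "V \<subseteq> V'" "rho Z ` V' \<subseteq> V"
  obtains \<alpha> \<beta> where "semilin {} \<alpha>" "semilin Z \<beta>"
    "\<alpha> ` tor_cycles F i j \<subseteq> tor_cycles F' i j" "\<beta> ` tor_boundaries F' i j \<subseteq> tor_boundaries F i j"
    "\<And>z. z \<in> tor_cycles F i j \<Longrightarrow> \<beta> (\<alpha> z) - z \<in> tor_boundaries F i j"
proof -
  interpret F: resolution U V F by (rule F)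
  interpret F': resolution U' V' F' by (rule F')
  have *: "rho {} ` U \<subseteq> U'" "rho {} ` V \<subseteq> V'" using U V by (auto simp: rho_empty)
  obtain c where c: "\<And>i b. b \<in> gens F i \<Longrightarrow> c i b \<in> free_on (gens F' i)"
    "\<And>i b. b \<in> gens F i \<Longrightarrow> fhomogeneous (shift F' i) (shift F i b) (c i b)"
    "\<And>w. w \<in> free_on (gens F 0) \<Longrightarrow> aug F' (flin {} (c 0) w) - rho {} (aug F w) \<in> V'"
    "\<And>i w. w \<in> free_on (gens F (Suc i)) \<Longrightarrow> bdry F' i (flin {} (c (Suc i)) w) = flin {} (c i) (bdry F i w)"
    using chain_lift[OF F F' *] by blast
  obtain d where d: "\<And>i b. b \<in> gens F' i \<Longrightarrow> d i b \<in> free_on (gens F i)"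
    "\<And>i b. b \<in> gens F' i \<Longrightarrow> fhomogeneous (shift F i) (shift F' i b) (d i b)"
    "\<And>w. w \<in> free_on (gens F' 0) \<Longrightarrow> aug F (flin Z (d 0) w) - rho Z (aug F' w) \<in> V"
    "\<And>i w. w \<in> free_on (gens F' (Suc i)) \<Longrightarrow> bdry F i (flin Z (d (Suc i)) w) = flin Z (d i) (bdry F' i w)"
    using chain_lift[OF F' F U(2) V(2)] by blast
  define \<alpha> where "\<alpha> i = flin {} (c i)" for i
  define \<beta> where "\<beta> i = flin Z (d i)" for i
  define \<rho> where "\<rho> = (flin Z basis_vec :: ('a, 'b) fvec \<Rightarrow> _)"
  \<comment> \<open>Both terms lift the same semilinear endomorphism of the module, so their
    difference will be null-homotopic.\<close>
  define \<theta> where "\<theta> i w = \<beta> i (\<alpha> i w) - \<rho> w" for i w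
  have \<alpha>: "semilin {} (\<alpha> i)" and \<beta>: "semilin Z (\<beta> i)" and \<rho>: "semilin Z \<rho>" for i
    by (simp_all add: \<alpha>_def \<beta>_def \<rho>_def semilin_flin)
  have \<alpha>_free: "\<alpha> i w \<in> free_on (gens F' i)" if "w \<in> free_on (gens F i)" for i w
    unfolding \<alpha>_def by (rule flin_free_on[OF c(1) that])
  have \<beta>_free: "\<beta> i w \<in> free_on (gens F i)" if "w \<in> free_on (gens F' i)" for i w
    unfolding \<beta>_def by (rule flin_free_on[OF d(1) that])
  have \<rho>_free: "\<rho> w \<in> free_on B" if "w \<in> free_on B" for w B
    unfolding \<rho>_def by (rule flin_free_on[OF basis_vec_free_on that])
  have \<rho>_lookup: "lookup (\<rho> w) b = rho Z (lookup w b)" for w b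
    by (simp add: \<rho>_def lookup_flin lookup_basis_vec if_distrib[of "(*) _"] in_keys_iff
        rhom.zero[OF rhom_rho] cong: if_cong)
  have \<rho>_bdry: "bdry F i (\<rho> w) = \<rho> (bdry F i w)" if w: "w \<in> free_on (gens F (Suc i))" for i w
    by (rule semilin_ext[OF semilin_comp_left[OF \<rho> F.bdry_semilin] semilin_comp_right[OF \<rho> F.bdry_semilin] _ w])
      (use rat in \<open>simp add: \<rho>_def flin_basis_vec rational_def\<close>)
  have \<rho>_aug: "aug F (\<rho> w) = rho Z (aug F w)" if w: "w \<in> free_on (gens F 0)" for w
  proof -
    have k: "keys (\<rho> w) \<subseteq> keys w"
      by (auto simp: in_keys_iff \<rho>_lookup rhom.zero[OF rhom_rho])
    have "aug F (\<rho> w) = (\<Sum>b\<in>keys (\<rho> w). lookup (\<rho> w) b * aug F (basis_vec b))"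
      by (rule F.aug_expand)
    also have "\<dots> = (\<Sum>b\<in>keys w. lookup (\<rho> w) b * aug F (basis_vec b))"
      using k by (intro sum.mono_neutral_left) (auto simp: in_keys_iff)
    also have "\<dots> = (\<Sum>b\<in>keys w. rho Z (lookup w b * aug F (basis_vec b)))"
      using rat w by (intro sum.cong refl)
        (auto simp: \<rho>_lookup rhom.mult[OF rhom_rho] rational_def free_on_def)
    also have "\<dots> = rho Z (aug F w)"
      by (subst F.aug_expand) (simp add: rhom.sum[OF rhom_rho])
    finally show ?thesis .
  qed
  obtain h where h: "\<And>i b. b \<in> gens F i \<Longrightarrow> h i b \<in> free_on (gens F (Suc i))"
    "\<And>w. w \<in> free_on (gens F 0) \<Longrightarrow> \<theta> 0 w = bdry F 0 (flin Z (h 0) w)"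
    "\<And>i w. w \<in> free_on (gens F (Suc i)) \<Longrightarrow>
      \<theta> (Suc i) w = bdry F (Suc i) (flin Z (h (Suc i)) w) + flin Z (h i) (bdry F i w)"
  proof (rule F.null_homotopy[of Z \<theta>])
    show "semilin Z (\<theta> i)" for i
      unfolding \<theta>_def[abs_def] by (rule semilin_minus[OF semilin_comp_right[OF \<beta> \<alpha>] \<rho>])
    show "\<theta> i w \<in> free_on (gens F i)" if "w \<in> free_on (gens F i)" for i w
      unfolding \<theta>_def by (intro free_on_diff \<rho>_free \<beta>_free \<alpha>_free that)
    show "bdry F i (\<theta> (Suc i) w) = \<theta> i (bdry F i w)" if w: "w \<in> free_on (gens F (Suc i))" for i w
      using d(4)[OF \<alpha>_free[OF w]] c(4)[OF w]
      by (simp add: \<theta>_def semilin_diff[OF F.bdry_semilin] \<rho>_bdry[OF w]) (simp add: \<alpha>_def \<beta>_def)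
    show "aug F (\<theta> 0 w) \<in> V" if w: "w \<in> free_on (gens F 0)" for w
    proof -
      have "rho Z (aug F' (\<alpha> 0 w) - aug F w) \<in> V"
        using c(3)[OF w] V(2) by (auto simp: \<alpha>_def rho_empty)
      then have "rho Z (aug F' (\<alpha> 0 w)) - rho Z (aug F w) \<in> V"
        by (simp add: rhom.diff[OF rhom_rho])
      moreover have "aug F (\<beta> 0 (\<alpha> 0 w)) - rho Z (aug F' (\<alpha> 0 w)) \<in> V"
        using d(3)[OF \<alpha>_free[OF w]] by (simp add: \<beta>_def)
      ultimately have "(aug F (\<beta> 0 (\<alpha> 0 w)) - rho Z (aug F' (\<alpha> 0 w))) +
          (rho Z (aug F' (\<alpha> 0 w)) - rho Z (aug F w)) \<in> V"
        using F.V_ideal unfolding is_ideal_def by blast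
      then show ?thesis by (simp add: \<theta>_def F.aug_diff \<rho>_aug[OF w])
    qed
  qed blast
  have \<alpha>_max: "\<alpha> i w \<in> max_times (gens F' i)" if "w \<in> max_times (gens F i)" for i w
    unfolding \<alpha>_def by (rule max_times_flin[OF c(1) that])
  have \<beta>_max: "\<beta> i w \<in> max_times (gens F i)" if "w \<in> max_times (gens F' i)" for i w
    unfolding \<beta>_def by (rule max_times_flin[OF d(1) that])
  have \<alpha>_hom: "fhomogeneous (shift F' i) j (\<alpha> i w)"
    if "w \<in> free_on (gens F i)" "fhomogeneous (shift F i) j w" for i w
    unfolding \<alpha>_def by (rule fhomogeneous_flin[OF c(2) that])
  have \<beta>_hom: "fhomogeneous (shift F i) j (\<beta> i w)"
    if "w \<in> free_on (gens F' i)" "fhomogeneous (shift F' i) j w" for i w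
    unfolding \<beta>_def by (rule fhomogeneous_flin[OF d(2) that])
  show ?thesis
  proof (rule that[OF \<alpha>[of i] \<beta>[of i]])
    show "\<alpha> i ` tor_cycles F i j \<subseteq> tor_cycles F' i j"
    proof (rule image_subsetI)
      fix z assume z: "z \<in> tor_cycles F i j"
      have "bdry F' l (\<alpha> i z) \<in> max_times (gens F' l)" if "i = Suc l" for l
        using z c(4)[of z l] \<alpha>_max[of "bdry F l z" l] by (simp add: tor_cycles_def that \<alpha>_def)
      with z \<alpha>_free[of z i] \<alpha>_hom[of z i] show "\<alpha> i z \<in> tor_cycles F' i j"
        by (simp add: tor_cycles_def split: nat.split)
    qed
    show "\<beta> i ` tor_boundaries F' i j \<subseteq> tor_boundaries F i j"
    proof (rule image_subsetI)
      fix w assume w: "w \<in> tor_boundaries F' i j"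
      then obtain u where u: "u \<in> free_on (gens F' (Suc i))" "w - bdry F' i u \<in> max_times (gens F' i)"
        by (auto simp: tor_boundaries_def)
      then have "\<beta> i w - bdry F i (\<beta> (Suc i) u) \<in> max_times (gens F i)"
        using \<beta>_max[OF u(2)] d(4)[OF u(1)] by (simp add: semilin_diff[OF \<beta>]) (simp add: \<beta>_def)
      with w \<beta>_free[of w i] \<beta>_hom[of w i] \<beta>_free[OF u(1)] show "\<beta> i w \<in> tor_boundaries F i j"
        by (auto simp: tor_boundaries_def)
    qed
    fix z assume z: "z \<in> tor_cycles F i j"
    then have zf: "z \<in> free_on (gens F i)" and zh: "fhomogeneous (shift F i) j z"
      by (simp_all add: tor_cycles_def)
    have "\<theta> i z - bdry F i (flin Z (h i) z) \<in> max_times (gens F i)"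
    proof (cases i)
      case 0
      with h(2) zf show ?thesis by (simp add: max_times_0)
    next
      case (Suc l)
      then have "bdry F l z \<in> max_times (gens F l)" using z by (simp add: tor_cycles_def)
      \<comment> \<open>The second term of the homotopy drops out of Tor because the boundary of a
        Tor cycle has no constant terms.\<close>
      from max_times_flin[OF h(1) this] h(3)[of z l] zf Suc show ?thesis by simp
    qed
    moreover have "\<rho> z - z \<in> max_times (gens F i)"
      using zf \<rho>_free[OF zf]
      by (simp add: max_times_def free_on_diff lookup_minus \<rho>_lookup lookup_rho restr_def)
    ultimately have "(\<theta> i z - bdry F i (flin Z (h i) z)) + (\<rho> z - z) \<in> max_times (gens F i)"
      by (rule max_times_add)
    then have "(\<beta> i (\<alpha> i z) - z) - bdry F i (flin Z (h i) z) \<in> max_times (gens F i)"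
      by (simp add: \<theta>_def algebra_simps)
    moreover have "flin Z (h i) z \<in> free_on (gens F (Suc i))"
      by (rule flin_free_on[OF h(1) zf])
    moreover have "\<beta> i (\<alpha> i z) - z \<in> free_on (gens F i)"
      by (intro free_on_diff \<beta>_free \<alpha>_free zf)
    moreover have "fhomogeneous (shift F i) j (\<beta> i (\<alpha> i z) - z)"
      by (intro fhomogeneous_diff \<beta>_hom \<alpha>_hom \<alpha>_free zf zh)
    ultimately show "\<beta> i (\<alpha> i z) - z \<in> tor_boundaries F i j"
      by (auto simp: tor_boundaries_def)
  qed
qed

section \<open>Dimension of quotients\<close>

context vector_space
begin

lemma ex_quotient_basis:
  assumes W: "subspace W" and Z: "subspace Z" and WZ: "W \<subseteq> Z"
  shows "\<exists>C. independent C \<and> span C \<inter> W = {0} \<and> span (C \<union> W) = Z"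
proof -
  obtain B where B: "B \<subseteq> W" "independent B" "W \<subseteq> span B"
    by (rule maximal_independent_subset[of W])
  obtain B' where B': "B \<subseteq> B'" "B' \<subseteq> Z" "independent B'" "Z \<subseteq> span B'"
    using maximal_independent_subset_extend[of B Z] B(1,2) WZ by blast
  have sB: "span B = W" using span_subspace[OF B(1,3) W] .
  let ?C = "B' - B"
  have C: "independent ?C" using independent_mono[OF B'(3)] by blast
  \<comment> \<open>The coordinates of x in the basis \<open>B'\<close> are supported both on
    \<open>B\<close> and on its complement.\<close>
  have "x = 0" if x: "x \<in> span ?C" "x \<in> span B" for x
  proof -
    have "representation B' x = representation ?C x" "representation B' x = representation B x"
      using representation_extend[OF B'(3) x(1)] representation_extend[OF B'(3) x(2)] B'(1) by auto
    then have "representation B' x b = 0" for b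
      using representation_ne_zero[of ?C x b] representation_ne_zero[of B x b] by auto
    moreover have "(\<Sum>b | representation B' x b \<noteq> 0. representation B' x b *s b) = x"
      using x(1) span_mono[of ?C B'] by (intro sum_nonzero_representation_eq[OF B'(3)]) auto
    ultimately show "x = 0" by simp
  qed
  then have "span ?C \<inter> W = {0}"
    using sB span_zero by auto
  moreover have "span (?C \<union> W) = Z"
  proof (rule span_subspace)
    show "?C \<union> W \<subseteq> Z" using B'(2) WZ by blast
    have "B' \<subseteq> ?C \<union> W" using B(1) by blast
    then show "Z \<subseteq> span (?C \<union> W)" using B'(4) span_mono by blast
  qed (rule Z)
  ultimately show ?thesis using C by blast
qed

text \<open>\<alpha> induces an injection of Z/W into Z'/W', because \<beta> undoes it modulo W;
  hence the representatives \<gamma> of the images of \<open>C\<close> are independent in the span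
  of \<open>C'\<close>. Finiteness of \<open>C\<close> is asserted too, as \<open>card\<close>
  vanishes on infinite sets.\<close>

lemma quotient_basis_retract:
  assumes W: "subspace W" and W': "subspace W'"
    and C: "independent C \<and> span C \<inter> W = {0} \<and> span (C \<union> W) = Z" and C': "independent C' \<and> span C' \<inter> W' = {0} \<and> span (C' \<union> W') = Z'" and fin: "finite C'"
    and \<alpha>: "\<And>x y. \<alpha> (x + y) = \<alpha> x + \<alpha> y" "\<And>c x. \<alpha> (c *s x) = c *s \<alpha> x" "\<alpha> ` Z \<subseteq> Z'"
    and \<beta>: "\<beta> ` W' \<subseteq> W" "\<And>z. z \<in> Z \<Longrightarrow> \<beta> (\<alpha> z) - z \<in> W"
  shows "finite C \<and> card C \<le> card C'"
proof -
  have CZ: "C \<subseteq> Z" "span C \<subseteq> Z" using C span_superset[of "C \<union> W"] span_mono[of C "C \<union> W"]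
    by auto
  have \<alpha>_sum: "\<alpha> (sum f A) = (\<Sum>a\<in>A. \<alpha> (f a))" if "finite A" for f :: "'b \<Rightarrow> 'b" and A
    using that
  proof induction
    case empty
    show ?case using \<alpha>(2)[of 0 0] by simp
  qed (simp add: \<alpha>(1))
  have "\<exists>y\<in>span C'. \<alpha> c - y \<in> W'" if "c \<in> C" for c
  proof -
    have "\<alpha> c \<in> span (C' \<union> W')"
      using that CZ \<alpha>(3) C' by auto
    then obtain x y where "x \<in> span C'" "y \<in> span W'" "\<alpha> c = x + y"
      by (auto simp: span_Un)
    moreover have "span W' = W'" using W' by simp
    ultimately show ?thesis by (intro bexI[of _ x]) auto
  qed
  then obtain \<gamma> where \<gamma>: "\<And>c. c \<in> C \<Longrightarrow> \<gamma> c \<in> span C'" "\<And>c. c \<in> C \<Longrightarrow> \<alpha> c - \<gamma> c \<in> W'"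
    by metis
  have key: "k a = 0" if A: "finite A" "A \<subseteq> C" "(\<Sum>a\<in>A. k a *s \<gamma> a) = 0" and a: "a \<in> A" for A k a
  proof -
    let ?x = "\<Sum>a\<in>A. k a *s a"
    have x: "?x \<in> span C" using A(2) by (intro span_sum span_scale span_base) auto
    \<comment> \<open>Subtracting the vanishing combination of the \<gamma> exhibits the image of x
      as an element of W'.\<close>
    have "\<alpha> ?x = (\<Sum>a\<in>A. k a *s (\<alpha> a - \<gamma> a))"
      using A(3) by (simp add: \<alpha>_sum[OF A(1)] \<alpha>(2) scale_right_diff_distrib sum_subtractf)
    also have "\<dots> \<in> W'"
      using A(2) \<gamma>(2) by (intro subspace_sum[OF W'] subspace_scale[OF W']) auto
    finally have "\<beta> (\<alpha> ?x) \<in> W" using \<beta>(1) by blast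
    moreover have "\<beta> (\<alpha> ?x) - ?x \<in> W" using \<beta>(2) x CZ(2) by blast
    ultimately have "\<beta> (\<alpha> ?x) - (\<beta> (\<alpha> ?x) - ?x) \<in> W" by (rule subspace_diff[OF W])
    then have "?x = 0" using x C by auto
    then show "k a = 0"
      using C independentD[of C A k a] A a by auto
  qed
  have inj: "inj_on \<gamma> C"
  proof (rule inj_onI, rule ccontr)
    fix c d assume "c \<in> C" "d \<in> C" "\<gamma> c = \<gamma> d" "c \<noteq> d"
    then show False using key[of "{c, d}" "\<lambda>a. if a = c then 1 else -1" c] by simp
  qed
  have "independent (\<gamma> ` C)"
    unfolding independent_explicit_module
  proof (intro allI impI)
    fix t u v assume t: "finite t" "t \<subseteq> \<gamma> ` C" "(\<Sum>v\<in>t. u v *s v) = 0" "v \<in> t"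
    define A where "A = {a \<in> C. \<gamma> a \<in> t}"
    have injA: "inj_on \<gamma> A" by (rule inj_on_subset[OF inj]) (auto simp: A_def)
    have tA: "t = \<gamma> ` A" using t(2) by (auto simp: A_def)
    have "finite A" using t(1) injA unfolding tA by (rule finite_imageD)
    moreover have "(\<Sum>a\<in>A. u (\<gamma> a) *s \<gamma> a) = 0"
      using t(3) unfolding tA by (simp add: sum.reindex[OF injA])
    moreover obtain a where "a \<in> A" "v = \<gamma> a" using t(4) tA by blast
    ultimately show "u v = 0" using key[of A "\<lambda>a. u (\<gamma> a)" a] by (auto simp: A_def)
  qed
  moreover have "\<gamma> ` C \<subseteq> span C'" using \<gamma>(1) by blast
  ultimately have "finite (\<gamma> ` C) \<and> card (\<gamma> ` C) \<le> card C'"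
    by (rule independent_span_bound[OF fin])
  then show ?thesis using inj by (simp add: card_image finite_image_iff)
qed

end

definition quotient_basis ::
  "('v, 'k::field) fvec set \<Rightarrow> ('v, 'k) fvec set \<Rightarrow> ('v, 'k) fvec set \<Rightarrow> bool" where
  "quotient_basis Z W C \<longleftrightarrow>
     kmod.independent C \<and> kmod.span C \<inter> W = {0} \<and> kmod.span (C \<union> W) = Z"

lemma quotient_dim_eq_card:
  assumes "kmod.subspace W" "kmod.subspace Z" "W \<subseteq> Z"
  obtains C where "quotient_basis Z W C" "kmod.quotient_dim Z W = card C"
proof
  let ?C = "SOME C. kmod.independent C \<and> kmod.span C \<inter> W = {0} \<and> kmod.span (C \<union> W) = Z"
  show "quotient_basis Z W ?C"
    unfolding quotient_basis_def using kmod.ex_quotient_basis[OF assms] by (rule someI_ex)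
  show "kmod.quotient_dim Z W = card ?C" by (simp add: kmod.quotient_dim_def)
qed

section \<open>Existence of resolutions\<close>

text \<open>Degreewise finiteness takes the place of finite generation: it makes each Tor piece
  finite-dimensional and needs no basis theorem.\<close>

definition finite_in_degrees :: "nat set \<Rightarrow> (nat \<Rightarrow> nat) \<Rightarrow> bool" where
  "finite_in_degrees B s \<longleftrightarrow> (\<forall>d. finite {b \<in> B. s b \<le> d})"

lemma finite_mon_deg_le: "finite {t :: 'v::finite pvar \<Rightarrow>\<^sub>0 nat. mon_deg t \<le> d}"
proof (rule finite_imageD)
  have "lookup t z \<le> mon_deg t" for t :: "'v pvar \<Rightarrow>\<^sub>0 nat" and z
    unfolding mon_deg_eq_wt wt_def by (simp add: member_le_sum)
  then have "lookup ` {t :: 'v pvar \<Rightarrow>\<^sub>0 nat. mon_deg t \<le> d} \<subseteq> PiE UNIV (\<lambda>_. {..d})"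
    by (auto simp: PiE_UNIV_domain intro: order_trans)
  then show "finite (lookup ` {t :: 'v pvar \<Rightarrow>\<^sub>0 nat. mon_deg t \<le> d})"
    by (rule finite_subset) (intro finite_PiE; simp)
  show "inj_on lookup {t :: 'v pvar \<Rightarrow>\<^sub>0 nat. mon_deg t \<le> d}"
    by (rule inj_onI) (simp add: poly_mapping_eqI)
qed

lemma finite_homogeneous_span:
  assumes "finite_in_degrees B s"
  obtains T :: "('v::finite, 'k::field) fvec set" where "finite T"
    "{w \<in> free_on B. fhomogeneous s d w} \<subseteq> kmod.span T"
proof
  let ?e = "\<lambda>(b, t). single b (single t 1) :: ('v, 'k) fvec"
  let ?T = "?e ` ({b \<in> B. s b \<le> d} \<times> {t. mon_deg t \<le> d})"
  show "finite ?T"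
    using assms finite_mon_deg_le by (auto simp: finite_in_degrees_def)
  show "{w \<in> free_on B. fhomogeneous s d w} \<subseteq> kmod.span ?T"
  proof safe
    fix w :: "('v, 'k) fvec"
    assume w: "w \<in> free_on B" "fhomogeneous s d w"
    have "single b (lookup w b) =
        (\<Sum>t\<in>keys (lookup w b). kscale (lookup (lookup w b) t) (single b (single t 1)))" for b
    proof (rule poly_mapping_eqI)
      fix e
      show "lookup (single b (lookup w b)) e =
        lookup (\<Sum>t\<in>keys (lookup w b). kscale (lookup (lookup w b) t) (single b (single t 1))) e"
        by (cases "e = b") (simp_all add: lookup_sum kscale_def lookup_fscale Const_def mult_single
            lookup_single when_def poly_mapping_sum_monomials)
    qed
    moreover have "w = (\<Sum>b\<in>keys w. single b (lookup w b))"
      by (simp add: poly_mapping_sum_monomials)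
    ultimately have "w = (\<Sum>b\<in>keys w. \<Sum>t\<in>keys (lookup w b).
        kscale (lookup (lookup w b) t) (single b (single t 1)))" by simp
    also have "\<dots> \<in> kmod.span ?T"
    proof (intro kmod.span_sum kmod.span_scale kmod.span_base)
      fix b t assume bt: "b \<in> keys w" "t \<in> keys (lookup w b)"
      then have "mon_deg t + s b = d" using w(2) by (auto simp: fhomogeneous_def)
      moreover have "b \<in> B" using w(1) bt by (auto simp: free_on_def)
      ultimately show "single b (single t 1) \<in> ?T"
        by (intro image_eqI[of _ _ "(b, t)"]) auto
    qed
    finally show "w \<in> kmod.span ?T" .
  qed
qed

section \<open>Submodules extended from a polynomial subring\<close>

definition fcoeff :: "'v::finite pvar set \<Rightarrow> ('v pvar \<Rightarrow>\<^sub>0 nat) \<Rightarrow> ('v, 'k::field) fvec \<Rightarrow> ('v, 'k) fvec"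
  where "fcoeff Z t w = Poly_Mapping.mapp (\<lambda>_ p. lookup (coeffs_in Z p) t) w"

lemma lookup_fcoeff: "lookup (fcoeff Z t w) b = lookup (coeffs_in Z (lookup w b)) t"
  by (simp add: fcoeff_def lookup_mapp when_def in_keys_iff rhom.zero[OF rhom_coeffs])

lemma keys_fcoeff: "keys (fcoeff Z t w) \<subseteq> keys w"
  unfolding fcoeff_def by (rule keys_mapp_subset)

text \<open>Submodules spanned by homogeneous elements with coordinates free of the variables in \<open>Z\<close>.\<close>

definition good_submodule ::
  "'v::finite pvar set \<Rightarrow> nat set \<Rightarrow> (nat \<Rightarrow> nat) \<Rightarrow> ('v, 'k::field) fvec set \<Rightarrow> bool" where
  "good_submodule Z B s M \<longleftrightarrow> M \<subseteq> free_on B \<and> 0 \<in> M \<and> (\<forall>x\<in>M. \<forall>y\<in>M. x + y \<in> M) \<and>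
     (\<forall>a. \<forall>x\<in>M. fscale a x \<in> M) \<and> (\<forall>x\<in>M. \<forall>j. hpart s j x \<in> M) \<and> (\<forall>x\<in>M. \<forall>t. fcoeff Z t x \<in> M)"

definition fixed :: "'v::finite pvar set \<Rightarrow> ('v, 'k::field) fvec \<Rightarrow> bool" where
  "fixed Z w \<longleftrightarrow> (\<forall>b. rho Z (lookup w b) = lookup w b)"

lemma lookup_flin_basis_vec: "lookup (flin Z basis_vec w) b = rho Z (lookup w b)"
  by (simp add: lookup_flin lookup_basis_vec if_distrib[of "(*) _"] in_keys_iff
      rhom.zero[OF rhom_rho] cong: if_cong)

lemma fixed_iff: "fixed Z w \<longleftrightarrow> flin Z basis_vec w = w"
  by (simp add: fixed_def poly_mapping_eq_iff[of _ w] fun_eq_iff lookup_flin_basis_vec)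

lemma fixed_hpart: "fixed Z w \<Longrightarrow> fixed Z (hpart s j w)"
  by (auto simp: fixed_def rho_fixed_iff lookup_hpart keys_restr)

lemma fixed_fcoeff: "fixed Z (fcoeff Z t w)"
  by (simp add: fixed_def lookup_fcoeff rho_lookup_coeffs)

lemma sum_hpart:
  assumes "finite D" "\<And>b t. b \<in> keys w \<Longrightarrow> t \<in> keys (lookup w b) \<Longrightarrow> mon_deg t + s b \<in> D"
  shows "(\<Sum>d\<in>D. hpart s d w) = w"
proof (intro poly_mapping_eqI)
  fix b t
  have "lookup (lookup (\<Sum>d\<in>D. hpart s d w) b) t =
      (\<Sum>d\<in>D. if mon_deg t + s b = d then lookup (lookup w b) t else 0)"
    by (simp add: lookup_sum lookup_hpart lookup_restr)
  also have "\<dots> = lookup (lookup w b) t"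
    using assms(2)[of b t] \<open>finite D\<close> by (cases "lookup w b = 0") (auto simp: in_keys_iff)
  finally show "lookup (lookup (\<Sum>d\<in>D. hpart s d w) b) t = lookup (lookup w b) t" .
qed

lemma sum_fcoeff:
  assumes "finite A" "\<And>b. b \<in> keys w \<Longrightarrow> keys (coeffs_in Z (lookup w b)) \<subseteq> A"
  shows "(\<Sum>t\<in>A. fscale (single t 1) (fcoeff Z t w)) = w"
proof (intro poly_mapping_eqI[of "\<Sum>t\<in>A. fscale (single t 1) (fcoeff Z t w)"])
  fix b
  have "keys (coeffs_in Z (lookup w b)) \<subseteq> A"
    using assms(2)[of b] by (cases "b \<in> keys w") (auto simp: in_keys_iff rhom.zero[OF rhom_coeffs])
  from sum_coeffs[OF assms(1) this]
  show "lookup (\<Sum>t\<in>A. fscale (single t 1) (fcoeff Z t w)) b = lookup w b"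
    by (simp add: lookup_sum lookup_fscale lookup_fcoeff)
qed

text \<open>In each degree the fixed elements of \<open>M\<close> have a finite spanning set over
  the field, and all these sets together generate: any element is a combination of monomials with
  fixed coefficients, whose homogeneous parts are again fixed and in \<open>M\<close>.\<close>

lemma ex_generators:
  fixes M :: "('v::finite, 'k::field) fvec set"
  assumes B: "finite_in_degrees B s" and M: "good_submodule Z B s M"
  shows "\<exists>B' s' c. finite_in_degrees B' s' \<and>
    (\<forall>b\<in>B'. c b \<in> M \<and> fhomogeneous s (s' b) (c b) \<and> fixed Z (c b)) \<and> flin {} c ` free_on B' = M"
proof -
  define Md where "Md d = {w \<in> M. fhomogeneous s d w \<and> fixed Z w}" for d
  have "\<exists>C. C \<subseteq> Md d \<and> finite C \<and> Md d \<subseteq> kmod.span C" for d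
  proof -
    obtain C where C: "C \<subseteq> Md d" "kmod.independent C" "Md d \<subseteq> kmod.span C"
      by (rule kmod.maximal_independent_subset[of "Md d"])
    obtain T :: "('v, 'k) fvec set" where "finite T" "{w \<in> free_on B. fhomogeneous s d w} \<subseteq> kmod.span T"
      by (rule finite_homogeneous_span[OF B])
    moreover have "C \<subseteq> {w \<in> free_on B. fhomogeneous s d w}"
      using C(1) M by (auto simp: Md_def good_submodule_def)
    ultimately have "finite C" using kmod.independent_span_bound[OF _ C(2)] by blast
    with C show ?thesis by blast
  qed
  then obtain C where C: "\<And>d. C d \<subseteq> Md d" "\<And>d. finite (C d)" "\<And>d. Md d \<subseteq> kmod.span (C d)"
    by metis
  have "\<exists>h. bij_betw h {0..<card (C d)} (C d)" for d
    using C(2) by (rule ex_bij_betw_nat_finite)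
  then obtain h where h: "\<And>d. bij_betw (h d) {0..<card (C d)} (C d)" by metis
  \<comment> \<open>The code of (d, k) stands for the k-th chosen element of degree d.\<close>
  define B' where "B' = prod_encode ` (SIGMA d:UNIV. {0..<card (C d)})"
  define s' where "s' n = fst (prod_decode n)" for n
  define c where "c n = (case prod_decode n of (d, k) \<Rightarrow> h d k)" for n
  have "finite_in_degrees B' s'"
    unfolding finite_in_degrees_def
  proof
    fix d
    have "{b \<in> B'. s' b \<le> d} \<subseteq> prod_encode ` (SIGMA e:{..d}. {0..<card (C e)})"
      by (auto simp: B'_def s'_def)
    then show "finite {b \<in> B'. s' b \<le> d}" by (rule finite_subset) auto
  qed
  moreover have c: "c b \<in> M \<and> fhomogeneous s (s' b) (c b) \<and> fixed Z (c b)" if "b \<in> B'" for b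
  proof -
    from that obtain d k where "b = prod_encode (d, k)" "k < card (C d)" by (auto simp: B'_def)
    moreover from this have "h d k \<in> C d" using h[of d] by (auto simp: bij_betw_def)
    ultimately show ?thesis using C(1)[of d] by (auto simp: c_def s'_def Md_def)
  qed
  moreover have "flin {} c ` free_on B' = M"
  proof (intro equalityI subsetI)
    fix x assume "x \<in> flin {} c ` free_on B'"
    then obtain w where w: "w \<in> free_on B'" "x = flin {} c w" by blast
    have sum: "sum f A \<in> M" if "\<And>i. i \<in> A \<Longrightarrow> f i \<in> M" for f :: "nat \<Rightarrow> _" and A
      using that M by (induction A rule: infinite_finite_induct) (auto simp: good_submodule_def)
    show "x \<in> M"
      unfolding w(2) flin_def
      using w(1) c M by (intro sum) (auto simp: free_on_def good_submodule_def)
  next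
    fix w assume w: "w \<in> M"
    let ?I = "flin {} c ` free_on B'"
    have lin: "semilin {} (flin {} c)" by (rule semilin_flin)
    have I0: "0 \<in> ?I" using semilin_0[OF lin] free_on_0 by (metis image_eqI)
    have Iadd: "x + y \<in> ?I" if "x \<in> ?I" "y \<in> ?I" for x y
      using that free_on_add semilinD(1)[OF lin] by (smt (verit) imageE image_eqI)
    have Iscale: "fscale a x \<in> ?I" if "x \<in> ?I" for a x
      using that free_on_fscale semilinD(2)[OF lin] by (smt (verit) imageE image_eqI rho_empty)
    have Isum: "sum f A \<in> ?I" if "\<And>i. i \<in> A \<Longrightarrow> f i \<in> ?I" for f :: "'z \<Rightarrow> _" and A
      using that by (induction A rule: infinite_finite_induct) (auto simp: I0 Iadd)
    have "C d \<subseteq> ?I" for d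
    proof
      fix x assume "x \<in> C d"
      then have "x \<in> h d ` {0..<card (C d)}" using h[of d] by (simp add: bij_betw_def)
      then obtain k where k: "k < card (C d)" "x = h d k" by auto
      then have "prod_encode (d, k) \<in> B'" "c (prod_encode (d, k)) = x"
        by (auto simp: B'_def c_def)
      then show "x \<in> ?I"
        by (intro image_eqI[of _ _ "basis_vec (prod_encode (d, k))"])
          (simp_all add: flin_basis_vec basis_vec_free_on)
    qed
    moreover have "kmod.subspace ?I"
      using I0 Iadd Iscale by (auto simp: kmod.subspace_def kscale_def)
    ultimately have Md: "Md d \<subseteq> ?I" for d
      using C(3) kmod.span_minimal by blast
    have fc: "fcoeff Z t w \<in> ?I" for t
    proof -
      let ?v = "fcoeff Z t w"
      let ?D = "\<Union>b\<in>keys ?v. (\<lambda>t. mon_deg t + s b) ` keys (lookup ?v b)"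
      have "hpart s d ?v \<in> ?I" for d
      proof -
        have "hpart s d ?v \<in> Md d"
          using w M by (simp add: Md_def good_submodule_def fhomogeneous_hpart fixed_hpart fixed_fcoeff)
        then show ?thesis using Md by blast
      qed
      then have "(\<Sum>d\<in>?D. hpart s d ?v) \<in> ?I" by (intro Isum)
      also have "(\<Sum>d\<in>?D. hpart s d ?v) = ?v" by (rule sum_hpart) auto
      finally show ?thesis .
    qed
    let ?A = "\<Union>b\<in>keys w. keys (coeffs_in Z (lookup w b))"
    have "(\<Sum>t\<in>?A. fscale (single t 1) (fcoeff Z t w)) \<in> ?I"
      using fc by (intro Isum Iscale)
    also have "(\<Sum>t\<in>?A. fscale (single t 1) (fcoeff Z t w)) = w"
      by (rule sum_fcoeff) auto
    finally show "w \<in> ?I" .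
  qed
  ultimately show ?thesis by blast
qed

lemma fcoeff_flin:
  assumes "\<And>b. b \<in> keys w \<Longrightarrow> fixed Z (c b)"
  shows "fcoeff Z t (flin {} c w) = flin {} c (fcoeff Z t w)"
proof (rule poly_mapping_eqI)
  fix e
  have "lookup (fcoeff Z t (flin {} c w)) e =
      (\<Sum>b\<in>keys w. lookup (coeffs_in Z (lookup w b * lookup (c b) e)) t)"
    by (simp add: lookup_fcoeff lookup_flin rho_empty rhom.sum[OF rhom_coeffs] lookup_sum)
  also have "\<dots> = (\<Sum>b\<in>keys w. lookup (fcoeff Z t w) b * lookup (c b) e)"
    using assms by (intro sum.cong refl) (simp add: fixed_def lookup_coeffs_mult lookup_fcoeff)
  also have "\<dots> = lookup (flin {} c (fcoeff Z t w)) e"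
    by (simp add: flin_superset[OF finite_keys keys_fcoeff] lookup_sum lookup_fscale rho_empty)
  finally show "lookup (fcoeff Z t (flin {} c w)) e = lookup (flin {} c (fcoeff Z t w)) e" .
qed

lemma hpart_flin:
  fixes c :: "nat \<Rightarrow> ('v::finite, 'k::field) fvec"
  assumes "w \<in> free_on B" "\<And>b. b \<in> B \<Longrightarrow> fhomogeneous s (s' b) (c b)"
  shows "hpart s j (flin {} c w) = flin {} c (hpart s' j w)"
  by (rule hpart_graded[OF semilin_flin assms(1)]) (simp add: flin_basis_vec assms(2))

text \<open>Homogeneous matrices over the subring commute with taking homogeneous parts and
  coefficients. With \<open>M\<close> = 0 this covers syzygies, so generators can be chosen again
  and again.\<close>

lemma good_submodule_preimage:
  fixes c :: "nat \<Rightarrow> ('v::finite, 'k::field) fvec"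
  assumes c: "\<And>b. b \<in> B' \<Longrightarrow> fhomogeneous s (s' b) (c b)" "\<And>b. b \<in> B' \<Longrightarrow> fixed Z (c b)"
    and M: "good_submodule Z B s M"
  shows "good_submodule Z B' s' {w \<in> free_on B'. flin {} c w \<in> M}"
  unfolding good_submodule_def
proof (intro conjI ballI allI; (elim CollectE conjE)?; (intro CollectI conjI)?)
  show "{w \<in> free_on B'. flin {} c w \<in> M} \<subseteq> free_on B'" by blast
  show "0 \<in> free_on B'" "flin {} c 0 \<in> M"
    using M by (simp_all add: free_on_0 semilin_0[OF semilin_flin] good_submodule_def)
next
  fix x y :: "('v, 'k) fvec"
  assume "x \<in> free_on B'" "flin {} c x \<in> M" "y \<in> free_on B'" "flin {} c y \<in> M"
  then show "x + y \<in> free_on B'" "flin {} c (x + y) \<in> M"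
    using M by (simp_all add: free_on_add semilinD[OF semilin_flin] good_submodule_def)
next
  fix x :: "('v, 'k) fvec" and a and j :: nat and t :: "'v pvar \<Rightarrow>\<^sub>0 nat"
  assume x: "x \<in> free_on B'" "flin {} c x \<in> M"
  then show "fscale a x \<in> free_on B'" "flin {} c (fscale a x) \<in> M"
    using M by (simp_all add: free_on_fscale semilinD[OF semilin_flin] good_submodule_def rho_empty)
  show "hpart s' j x \<in> free_on B'" using x by (simp add: hpart_free_on)
  show "flin {} c (hpart s' j x) \<in> M"
    using x M hpart_flin[where s = s and s' = s' and c = c, OF x(1) c(1)]
    by (metis good_submodule_def)
  show "fcoeff Z t x \<in> free_on B'"
    using x keys_fcoeff[of Z t x] by (auto simp: free_on_def)
  have "fcoeff Z t (flin {} c x) = flin {} c (fcoeff Z t x)"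
    using x(1) c(2) by (intro fcoeff_flin) (auto simp: free_on_def)
  with x M show "flin {} c (fcoeff Z t x) \<in> M"
    by (metis good_submodule_def)
qed

text \<open>By \<open>sum_coeffs\<close>, for an ideal this means being generated by its elements in
  the variables outside \<open>Z\<close>.\<close>

definition coeff_closed :: "'v::finite pvar set \<Rightarrow> ('v, 'k::field) mpoly set \<Rightarrow> bool" where
  "coeff_closed Z I \<longleftrightarrow> (\<forall>f\<in>I. \<forall>t. lookup (coeffs_in Z f) t \<in> I)"

lemma good_submodule_of_ideal:
  assumes "homogeneous_ideal I" "coeff_closed Z I"
  shows "good_submodule Z {0} (\<lambda>_. 0) (single 0 ` I)"
proof -
  have h: "hpart (\<lambda>_. 0) j (single 0 f) = single 0 (restr {t. mon_deg t = j} f)" for j f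
    by (rule poly_mapping_eqI) (auto simp: lookup_hpart lookup_single when_def restr_def)
  have c: "fcoeff Z t (single 0 f) = single 0 (lookup (coeffs_in Z f) t)" for t f
    by (rule poly_mapping_eqI) (auto simp: lookup_fcoeff lookup_single when_def rhom.zero[OF rhom_coeffs])
  have s: "fscale a (single 0 f) = single 0 (a * f)" for a f
    by (rule poly_mapping_eqI) (auto simp: lookup_fscale lookup_single when_def)
  show ?thesis
    unfolding good_submodule_def
    using assms
    by (auto simp: h c s homogeneous_ideal_def coeff_closed_def is_ideal_def free_on_def
        simp flip: single_add intro: image_eqI[of 0 _ 0] split: if_splits)
qed

lemma ex_resolution:
  fixes U V :: "('v::finite, 'k::field) mpoly set"
  assumes U: "homogeneous_ideal U" "coeff_closed Z U" and V: "homogeneous_ideal V" "coeff_closed Z V"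
    and VU: "V \<subseteq> U"
  obtains F where "graded_free_resolution U V F" "rational Z F"
    "\<And>i. finite_in_degrees (gens F i) (shift F i)"
proof -
  have "finite_in_degrees {0} (\<lambda>_. 0)" by (simp add: finite_in_degrees_def)
  from ex_generators[OF this good_submodule_of_ideal[OF U]]
  obtain B0 s0 and c0 :: "nat \<Rightarrow> ('v, 'k) fvec" where 0: "finite_in_degrees B0 s0"
    "\<And>b. b \<in> B0 \<Longrightarrow> c0 b \<in> single 0 ` U" "\<And>b. b \<in> B0 \<Longrightarrow> fhomogeneous (\<lambda>_. 0) (s0 b) (c0 b)"
    "\<And>b. b \<in> B0 \<Longrightarrow> fixed Z (c0 b)" and im0: "flin {} c0 ` free_on B0 = single 0 ` U"
    by blast
  \<comment> \<open>A stage consists of a basis, its degrees, the relations \<open>M\<close> to be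
    covered next, and the matrix leading to the previous stage. The matrix at stage
    \<open>Suc n\<close> becomes the boundary of index n; the augmentation matrix \<open>c0\<close>
    stays outside the sequence.\<close>
  define P where "P n x \<longleftrightarrow> (case x of (B, s, M :: ('v, 'k) fvec set, c :: nat \<Rightarrow> ('v, 'k) fvec) \<Rightarrow>
      finite_in_degrees B s \<and> good_submodule Z B s M \<and>
      (n = 0 \<longrightarrow> B = B0 \<and> s = s0 \<and> M = {w \<in> free_on B0. flin {} c0 w \<in> single 0 ` V}))" for n :: nat and x
  define Q where "Q x y \<longleftrightarrow> (case x of (B :: nat set, s, M :: ('v, 'k) fvec set, c :: nat \<Rightarrow> ('v, 'k) fvec) \<Rightarrow>
      case y of (B', s', M', c' :: nat \<Rightarrow> ('v, 'k) fvec) \<Rightarrow>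
      (\<forall>b\<in>B'. fhomogeneous s (s' b) (c' b) \<and> fixed Z (c' b)) \<and> flin {} c' ` free_on B' = M \<and>
      M' = {w \<in> free_on B'. flin {} c' w = 0})" for x y
  have "\<exists>x. \<forall>n. P n (x n) \<and> Q (x n) (x (Suc n))"
  proof (rule dependent_nat_choice)
    have "P 0 (B0, s0, {w \<in> free_on B0. flin {} c0 w \<in> single 0 ` V}, c0)"
      unfolding P_def using good_submodule_preimage[OF 0(3,4) good_submodule_of_ideal[OF V]] 0(1) by simp
    then show "\<exists>x. P 0 x" ..
  next
    fix x n assume x: "P n x"
    obtain B s M c where xe: "x = (B, s, M, c)" by (cases x)
    then have B: "finite_in_degrees B s" "good_submodule Z B s M" using x by (simp_all add: P_def)
    obtain B' s' c' where *: "finite_in_degrees B' s'"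
      "\<forall>b\<in>B'. c' b \<in> M \<and> fhomogeneous s (s' b) (c' b) \<and> fixed Z (c' b)" "flin {} c' ` free_on B' = M"
      using ex_generators[OF B] by blast
    have "good_submodule Z B s ({0} :: ('v, 'k) fvec set)"
    proof -
      have "fcoeff Z t 0 = (0 :: ('v, 'k) fvec)" for t
        by (rule poly_mapping_eqI) (simp add: lookup_fcoeff rhom.zero[OF rhom_coeffs])
      then show ?thesis by (simp add: good_submodule_def free_on_0 hpart_0)
    qed
    with * have "good_submodule Z B' s' {w \<in> free_on B'. flin {} c' w \<in> {0}}"
      by (intro good_submodule_preimage) auto
    with * have "P (Suc n) (B', s', {w \<in> free_on B'. flin {} c' w = 0}, c')"
      "Q x (B', s', {w \<in> free_on B'. flin {} c' w = 0}, c')"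
      by (simp_all add: P_def Q_def xe)
    then show "\<exists>y. P (Suc n) y \<and> Q x y" by blast
  qed
  then obtain x where x: "\<And>n. P n (x n)" "\<And>n. Q (x n) (x (Suc n))" by blast
  define B where "B n = fst (x n)" for n
  define s where "s n = fst (snd (x n))" for n
  define M where "M n = fst (snd (snd (x n)))" for n
  define c where "c n = snd (snd (snd (x n)))" for n
  have xe: "x n = (B n, s n, M n, c n)" for n by (simp add: B_def s_def M_def c_def)
  have fin: "finite_in_degrees (B n) (s n)" for n using x(1)[of n] by (simp add: P_def xe)
  have base: "B 0 = B0" "s 0 = s0" "M 0 = {w \<in> free_on B0. flin {} c0 w \<in> single 0 ` V}"
    using x(1)[of 0] by (simp_all add: P_def xe)
  have step: "b \<in> B (Suc n) \<Longrightarrow> fhomogeneous (s n) (s (Suc n) b) (c (Suc n) b)"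
    "b \<in> B (Suc n) \<Longrightarrow> fixed Z (c (Suc n) b)" "flin {} (c (Suc n)) ` free_on (B (Suc n)) = M n"
    "M (Suc n) = {w \<in> free_on (B (Suc n)). flin {} (c (Suc n)) w = 0}" for b n
    using x(2)[of n] by (simp_all add: Q_def xe)
  define F where "F = \<lparr>gens = B, shift = s, aug = (\<lambda>w. lookup (flin {} c0 w) 0),
    bdry = (\<lambda>n. flin {} (c (Suc n)))\<rparr>"
  have F: "gens F = B" "shift F = s" "aug F = (\<lambda>w. lookup (flin {} c0 w) 0)"
    "bdry F = (\<lambda>n. flin {} (c (Suc n)))" by (simp_all add: F_def)
  have c0: "flin {} c0 w = single 0 (aug F w)" if w: "w \<in> free_on B0" for w
  proof -
    have "flin {} c0 w \<in> single 0 ` U" using im0 w by blast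
    then show ?thesis by (auto simp: F)
  qed
  have aug_image: "aug F ` free_on B0 = U"
  proof -
    have "single 0 ` (aug F ` free_on B0) = (single 0 ` U :: ('v, 'k) fvec set)"
      unfolding im0[symmetric] image_image by (intro image_cong refl) (simp add: c0)
    then show ?thesis by (subst (asm) inj_image_eq_iff) (auto intro: injI)
  qed
  have "graded_free_resolution U V F"
    unfolding graded_free_resolution_def
  proof (intro conjI allI ballI)
    have "Modules.module ((*) :: ('v, 'k) mpoly \<Rightarrow> _)" by unfold_locales (simp_all add: algebra_simps)
    then show "module_hom fscale (*) (aug F)"
      by (simp add: module_hom_iff fmod.module_axioms F semilinD[OF semilin_flin] lookup_add
          lookup_fscale rho_empty)
    show "module_hom fscale fscale (bdry F i)" for i
      by (simp add: module_hom_iff fmod.module_axioms F semilinD[OF semilin_flin] rho_empty)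
    show "homogeneous (shift F 0 b) (aug F (basis_vec b))" if "b \<in> gens F 0" for b
    proof -
      have b: "b \<in> B0" using that by (simp add: F base)
      have "keys (lookup (c0 b) 0) = {} \<or> 0 \<in> keys (c0 b)" by (auto simp: in_keys_iff)
      with 0(3)[OF b] show ?thesis
        by (auto simp: F base flin_basis_vec homogeneous_def fhomogeneous_def)
    qed
    show "fhomogeneous (shift F i) (shift F (Suc i) b) (bdry F i (basis_vec b))"
      if "b \<in> gens F (Suc i)" for i b
      using that step(1) by (simp add: F flin_basis_vec)
    show "{aug F w + v |w v. w \<in> free_on (gens F 0) \<and> v \<in> V} = U" (is "?L = U")
    proof
      show "?L \<subseteq> U"
        using aug_image VU U(1) by (auto simp: F(1) base homogeneous_ideal_def is_ideal_def)
      show "U \<subseteq> ?L"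
      proof
        fix u assume "u \<in> U"
        then obtain w where "w \<in> free_on B0" "u = aug F w + 0" using aug_image by auto
        moreover have "0 \<in> V" using V(1) by (simp add: homogeneous_ideal_def is_ideal_def)
        ultimately show "u \<in> ?L" unfolding F(1) base(1) by blast
      qed
    qed
    have "bdry F 0 ` free_on (gens F 1) = M 0" using step(3)[of 0] by (simp add: F)
    also have "\<dots> = {w \<in> free_on (gens F 0). aug F w \<in> V}"
      unfolding base(3) F(1) base(1) using c0 by (auto dest: injD[OF inj_single])
    finally show "bdry F 0 ` free_on (gens F 1) = {w \<in> free_on (gens F 0). aug F w \<in> V}" .
    show "bdry F (Suc i) ` free_on (gens F (Suc (Suc i))) =
        {w \<in> free_on (gens F (Suc i)). bdry F i w = 0}" for i
      using step(3)[of "Suc i"] step(4)[of i] by (simp add: F)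
  qed
  moreover have "rational Z F"
    unfolding rational_def
  proof (intro conjI allI ballI)
    show "rho Z (aug F (basis_vec b)) = aug F (basis_vec b)" if "b \<in> gens F 0" for b
      using that 0(4)[of b] by (simp add: F base flin_basis_vec fixed_def)
    show "flin Z basis_vec (bdry F i (basis_vec b)) = bdry F i (basis_vec b)" if "b \<in> gens F (Suc i)" for i b
      using that step(2)[of b i] by (simp add: F flin_basis_vec fixed_iff)
  qed
  ultimately show ?thesis using that[of F] fin by (simp add: F)
qed

section \<open>Betti numbers\<close>

lemma (in resolution) subspace_tor_cycles: "kmod.subspace (tor_cycles F i j)"
  by (cases i) (auto simp: kmod.subspace_def tor_cycles_def free_on_0 free_on_add kscale_def free_on_fscale
      fhomogeneous_0 fhomogeneous_add semilin_0[OF bdry_semilin] semilinD(1)[OF bdry_semilin]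
      max_times_0 max_times_add semilin_kscale[OF bdry_semilin, unfolded kscale_def]
      fhomogeneous_kscale[unfolded kscale_def] max_times_kscale[unfolded kscale_def])

lemma (in resolution) subspace_tor_boundaries: "kmod.subspace (tor_boundaries F i j)"
proof (rule kmod.subspaceI)
  show "0 \<in> tor_boundaries F i j"
    by (auto simp: tor_boundaries_def free_on_0 fhomogeneous_0 max_times_0 semilin_0[OF bdry_semilin]
        intro!: bexI[of _ 0])
next
  fix x y assume "x \<in> tor_boundaries F i j" "y \<in> tor_boundaries F i j"
  moreover from this obtain u v where "u \<in> free_on (gens F (Suc i))" "x - bdry F i u \<in> max_times (gens F i)"
    "v \<in> free_on (gens F (Suc i))" "y - bdry F i v \<in> max_times (gens F i)"
    by (auto simp: tor_boundaries_def)
  moreover from this have "(x + y) - bdry F i (u + v) \<in> max_times (gens F i)"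
    using max_times_add[of "x - bdry F i u" "gens F i" "y - bdry F i v"]
    by (simp add: semilinD[OF bdry_semilin] algebra_simps)
  ultimately show "x + y \<in> tor_boundaries F i j"
    by (auto simp: tor_boundaries_def free_on_add fhomogeneous_add)
next
  fix k x assume x: "x \<in> tor_boundaries F i j"
  then obtain u where "u \<in> free_on (gens F (Suc i))" "x - bdry F i u \<in> max_times (gens F i)"
    by (auto simp: tor_boundaries_def)
  moreover from this have "kscale k x - bdry F i (kscale k u) \<in> max_times (gens F i)"
    using max_times_kscale[of "x - bdry F i u" "gens F i" k]
    by (simp add: semilin_kscale[OF bdry_semilin] kmod.scale_right_diff_distrib)
  ultimately show "kscale k x \<in> tor_boundaries F i j"
    using x by (auto simp: tor_boundaries_def fhomogeneous_kscale)
      (auto simp: kscale_def free_on_fscale)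
qed

lemma (in resolution) tor_boundaries_subset: "tor_boundaries F i j \<subseteq> tor_cycles F i j"
proof
  fix w assume w: "w \<in> tor_boundaries F i j"
  then obtain u where u: "u \<in> free_on (gens F (Suc i))" "w - bdry F i u \<in> max_times (gens F i)"
    by (auto simp: tor_boundaries_def)
  have "bdry F l w \<in> max_times (gens F l)" if i: "i = Suc l" for l
  proof -
    have "bdry F l (bdry F i u) = 0" using bdry_cyc[OF u(1)] by (simp add: cyc_def i)
    then have "bdry F l w = bdry F l (w - bdry F i u)" by (simp add: semilin_diff[OF bdry_semilin])
    also have "\<dots> \<in> max_times (gens F l)" using u(2) by (intro bdry_max_times) (simp add: i)
    finally show ?thesis .
  qed
  with w show "w \<in> tor_cycles F i j"
    by (simp add: tor_boundaries_def tor_cycles_def split: nat.split)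
qed

lemma tor_basis_retract:
  assumes F: "resolution U V F" and F': "resolution U' V' F'" and "rational Z F"
    and "U \<subseteq> U'" "rho Z ` U' \<subseteq> U" "V \<subseteq> V'" "rho Z ` V' \<subseteq> V"
    and C: "quotient_basis (tor_cycles F i j) (tor_boundaries F i j) C"
    and C': "quotient_basis (tor_cycles F' i j) (tor_boundaries F' i j) C'" "finite C'"
  shows "finite C \<and> card C \<le> card C'"
proof -
  obtain \<alpha> \<beta> where \<alpha>: "semilin {} \<alpha>" and "semilin Z \<beta>"
    "\<alpha> ` tor_cycles F i j \<subseteq> tor_cycles F' i j" "\<beta> ` tor_boundaries F' i j \<subseteq> tor_boundaries F i j"
    "\<And>z. z \<in> tor_cycles F i j \<Longrightarrow> \<beta> (\<alpha> z) - z \<in> tor_boundaries F i j"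
    using tor_retract[OF assms(1-7)] by metis
  then show ?thesis
    by (intro kmod.quotient_basis_retract[OF resolution.subspace_tor_boundaries[OF F]
          resolution.subspace_tor_boundaries[OF F'] C[unfolded quotient_basis_def]
          C'(1)[unfolded quotient_basis_def] C'(2)])
      (auto simp: semilinD(1)[OF \<alpha>] semilin_kscale[OF \<alpha>])
qed

text \<open>Makes the retract argument with \<open>Z = {}\<close> available for any two resolutions
  of the same module, which gives independence of the choice.\<close>

lemma rational_empty: "rational {} F"
proof -
  have "flin {} basis_vec w = w" for w :: "('a, 'b) fvec"
    by (rule poly_mapping_eqI) (simp add: lookup_flin_basis_vec rho_empty)
  then show ?thesis by (simp add: rational_def rho_empty)
qed

lemma coeff_closed_empty:
  assumes "homogeneous_ideal I"
  shows "coeff_closed {} I"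
proof -
  have "coeffs_in {} f = cst f" for f :: "('a, 'b) mpoly"
    by (rule coeffs_rho_fixed) (rule rho_empty)
  with assms show ?thesis
    by (simp add: coeff_closed_def homogeneous_ideal_def is_ideal_def cst_def lookup_single when_def)
qed

text \<open>Nothing is known about the picked resolutions \<open>F\<close> and \<open>F'\<close>, so
  they are compared with a rational one \<open>G\<close> and a degreewise finite one
  \<open>G'\<close>. Finiteness passes from \<open>G'\<close> to \<open>F'\<close> to
  \<open>G\<close> to \<open>F\<close>, and the cardinalities satisfy CF \<le> CG \<le> CF'.\<close>

lemma betti_le:
  fixes U V U' V' :: "('v::finite, 'k::field) mpoly set"
  assumes U: "homogeneous_ideal U" "coeff_closed Z U" and V: "homogeneous_ideal V" "coeff_closed Z V"
    and U': "homogeneous_ideal U'" and V': "homogeneous_ideal V'" and VU: "V \<subseteq> U" "V' \<subseteq> U'"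
    and incl: "U \<subseteq> U'" "rho Z ` U' \<subseteq> U" "V \<subseteq> V'" "rho Z ` V' \<subseteq> V"
  shows "betti U V i j \<le> betti U' V' i j"
proof -
  define F where "F = (SOME F. graded_free_resolution U V F)"
  define F' where "F' = (SOME F. graded_free_resolution U' V' F)"
  obtain G where G: "graded_free_resolution U V G" "rational Z G"
    using ex_resolution[OF U V VU(1)] by metis
  obtain G' where G': "graded_free_resolution U' V' G'" "\<And>i. finite_in_degrees (gens G' i) (shift G' i)"
    using ex_resolution[OF U' coeff_closed_empty[OF U'] V' coeff_closed_empty[OF V'] VU(2)] by metis
  have F: "graded_free_resolution U V F" and F': "graded_free_resolution U' V' F'"
    unfolding F_def F'_def using G(1) G'(1) by (auto intro: someI)
  have r: "resolution U V F" "resolution U V G" "resolution U' V' F'" "resolution U' V' G'"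
    using F F' G G' V V' by (simp_all add: resolution_def)
  note q = quotient_dim_eq_card[OF resolution.subspace_tor_boundaries
      resolution.subspace_tor_cycles resolution.tor_boundaries_subset]
  let ?q = "\<lambda>F. quotient_basis (tor_cycles F i j) (tor_boundaries F i j)"
  obtain CF where CF: "?q F CF" "kmod.quotient_dim (tor_cycles F i j) (tor_boundaries F i j) = card CF"
    using q[OF r(1) r(1) r(1)] .
  obtain CG where CG: "?q G CG" using q[OF r(2) r(2) r(2)] .
  obtain CF' where CF': "?q F' CF'" "kmod.quotient_dim (tor_cycles F' i j) (tor_boundaries F' i j) = card CF'"
    using q[OF r(3) r(3) r(3)] .
  obtain CG' where CG': "?q G' CG'" using q[OF r(4) r(4) r(4)] .
  have "finite CG'"
  proof -
    obtain T :: "('v, 'k) fvec set" where "finite T"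
      "{w \<in> free_on (gens G' i). fhomogeneous (shift G' i) j w} \<subseteq> kmod.span T"
      by (rule finite_homogeneous_span[OF G'(2)])
    moreover have "CG' \<subseteq> tor_cycles G' i j"
      using CG' kmod.span_superset[of "CG' \<union> tor_boundaries G' i j"] by (auto simp: quotient_basis_def)
    moreover have "tor_cycles G' i j \<subseteq> {w \<in> free_on (gens G' i). fhomogeneous (shift G' i) j w}"
      by (auto simp: tor_cycles_def)
    moreover have "kmod.independent CG'" using CG' by (simp add: quotient_basis_def)
    ultimately show ?thesis using kmod.independent_span_bound[of T CG'] by blast
  qed
  have e: "rho {} ` A \<subseteq> A" for A :: "('v, 'k) mpoly set" by (simp add: rho_empty)
  have "finite CF'"
    using tor_basis_retract[OF r(3,4) rational_empty order_refl e order_refl e CF'(1) CG' \<open>finite CG'\<close>] by blast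
  then have "finite CG" "card CG \<le> card CF'"
    using tor_basis_retract[OF r(2,3) G(2) incl CG CF'(1)] by blast+
  moreover from this have "card CF \<le> card CG"
    using tor_basis_retract[OF r(1,2) rational_empty order_refl e order_refl e CF(1) CG] by blast
  ultimately show ?thesis
    using CF(2) CF'(2) by (simp add: betti_def Let_def flip: F_def F'_def)
qed

theorem proposition3p9:
  fixes G H :: "'v::finite pair_pre_digraph"
    and J_G J_H :: "('v, 'k::field) mpoly set"
  assumes "pair_graph G" and "pverts G = UNIV"
    and "induced_subgraph (with_proj H) (with_proj G)"
    and "J_G = binomial_edge_ideal G" and "J_H = binomial_edge_ideal H"
  shows "(\<forall>i j m. i > 0 \<longrightarrow> j > 0 \<longrightarrow> m \<ge> 1 \<longrightarrow>
            betti_quot (symbolic_power mpoly_ring J_H m) i j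
              \<le> betti_quot (symbolic_power mpoly_ring J_G m) i j) \<and>
         (\<forall>m\<ge>1. reg_ideal (symbolic_power mpoly_ring J_H m)
              \<le> reg_ideal (symbolic_power mpoly_ring J_G m)) \<and>
         (convergent (reg_quotients J_H) \<longrightarrow> convergent (reg_quotients J_G) \<longrightarrow>
            asymptotic_reg J_H \<le> asymptotic_reg J_G)"
proof -
  interpret pair_graph G by fact
  define W where "W = pverts H"
  define Z where "Z = {z. vtx z \<notin> W}"
  have symG: "sym (parcs G)" using pair_sym_arcs by (simp add: symmetric_def)
  have "parcs H = {e \<in> parcs G. fst e \<in> W \<and> snd e \<in> W}"
    using assms(3) unfolding induced_subgraph_def W_def by simp
  then have H: "parcs H = parcs G \<inter> W \<times> W"
    by (simp only: set_eq_iff mem_Times_iff mem_Collect_eq Int_iff simp_thms)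
  have symH: "sym (parcs H)" using symG unfolding H sym_def by blast
  let ?G = "\<lambda>m. edge_symbolic (parcs G) m :: ('v, 'k) mpoly set"
  let ?H = "\<lambda>m. edge_symbolic (parcs H) m :: ('v, 'k) mpoly set"
  have J: "symbolic_power mpoly_ring J_G m = ?G m" "symbolic_power mpoly_ring J_H m = ?H m" for m
    by (simp_all add: assms symbolic_power_binomial_edge_ideal)
  have hom: "homogeneous_ideal (?G m)" "homogeneous_ideal (?H m)" for m
    using symG symH by (simp_all add: homogeneous_ideal_def is_ideal_edge_symbolic edge_symbolic_homogeneous)
  have coeff: "coeff_closed Z (?H m)" for m
    unfolding coeff_closed_def Z_def using edge_symbolic_coeffs[OF symH, of W] H by blast
  have incl: "?H m \<subseteq> ?G m" "rho Z ` ?G m \<subseteq> ?H m" for m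
    using edge_symbolic_mono[OF symG symH] edge_symbolic_rho[OF symG H] by (auto simp: H Z_def)
  have triv: "homogeneous_ideal (UNIV :: ('v, 'k) mpoly set)" "coeff_closed Z (UNIV :: ('v, 'k) mpoly set)"
    "homogeneous_ideal ({0} :: ('v, 'k) mpoly set)" "coeff_closed Z ({0} :: ('v, 'k) mpoly set)"
    by (simp_all add: homogeneous_ideal_def is_ideal_def coeff_closed_def restr_def rhom.zero[OF rhom_coeffs])
  have zero: "{0} \<subseteq> ?G m" "{0} \<subseteq> ?H m" for m
    using hom[of m] by (simp_all add: homogeneous_ideal_def is_ideal_def)
  have quot: "betti_quot (?H m) i j \<le> betti_quot (?G m) i j" for m i j
    unfolding betti_quot_def
    by (rule betti_le[OF triv(1,2) hom(2) coeff triv(1) hom(1) _ _ _ _ incl]) simp_all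
  \<comment> \<open>For the ideal as a module the symbolic powers take the place of
    \<open>U\<close>, with \<open>V\<close> = 0.\<close>
  have ideal: "betti (?H m) {0} i j \<le> betti (?G m) {0} i j" for m i j
    by (rule betti_le[OF hom(2) coeff triv(3,4) hom(1) triv(3) zero(2,1) incl])
      (simp_all add: rhom.zero[OF rhom_rho])
  have reg: "reg_ideal (?H m) \<le> reg_ideal (?G m)" for m
    unfolding reg_ideal_def regularity_def
  proof (rule Sup_subset_mono, rule subsetI)
    fix x assume "x \<in> {ereal (real j - real i) |i j. betti (?H m) {0} i j \<noteq> 0}"
    then obtain i j where x: "x = ereal (real j - real i)" and "betti (?H m) {0} i j \<noteq> 0"
      by blast
    then have "betti (?G m) {0} i j \<noteq> 0" using ideal[of m i j] by simp
    with x show "x \<in> {ereal (real j - real i) |i j. betti (?G m) {0} i j \<noteq> 0}"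
      by blast
  qed
  have "asymptotic_reg J_H \<le> asymptotic_reg J_G"
    if "convergent (reg_quotients J_H)" "convergent (reg_quotients J_G)"
  proof -
    \<comment> \<open>The index m = 0, where the denominator vanishes, is left out; the limits do
      not see it.\<close>
    have "reg_quotients J_H m \<le> reg_quotients J_G m" if "m \<ge> 1" for m
      unfolding reg_quotients_def J using that reg by (intro ereal_divide_right_mono) simp_all
    with that show ?thesis
      unfolding asymptotic_reg_def convergent_LIMSEQ_iff by (blast intro: LIMSEQ_le)
  qed
  with quot reg show ?thesis by (simp add: J)
qed

end
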